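(* Let $$\gamma_1(0):=\Big(\frac{1}{(2\pi)^3}\int_{\mathbb{T}^3}\frac{\sin^2p_1\,dp}{\epsilon(p)}\Big)^{-1}\approx 4.7655 .$$ Then: (a) for every $\gamma\in(0,\gamma_1(0))$ there exists $\lambda_1(0,\gamma)>0$ such that for any $\lambda>\lambda_1(0,\gamma)$ the operator $H_{\gamma,\lambda}(0)$ has no discrete spectrum below its essential spectrum; (b) for every $\gamma>\gamma_1(0)$ there exists $\lambda_2(0,\gamma)>0$ such that for any $\lambda>\lambda_2(0,\gamma)$ the operator $H_{\gamma,\lambda}(0)$ has exactly one eigenvalue $z$ lying below its essential spectrum; moreover, $z$ is a triple eigenvalue (its multiplicity is three), and the associated eigenfunctions are odd in $\mathbb{T}^3\times\mathbb{T}^3$, i.e. $f(-p,-q)=-f(p,q)$. In particular, for $K=0$ the threshold separating absence from existence of eigenvalues below the essential spectrum (for large $\lambda$), and the threshold above which there are at least three such eigenvalues counted with multiplicity (for large $\lambda$), are both equal to $\gamma_1(0)$, and the same lower bound $\lambda_2(0,\gamma)$ on $\lambda$ serves for the existence of one and of three eigenvalues.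
   Context: $\mathbb{T}^3=(-\pi,\pi]^3$ is the three-dimensional torus (coordinates mod $2\pi$) and $\epsilon(p)=\sum_{i=1}^3(1-\cos p_i)$. For $\gamma>0$ put $\mathcal{E}_{\gamma,0}(p,q)=\epsilon(p)+\epsilon(q)+\gamma\,\epsilon(p+q)$. Let $L^{2,a}((\mathbb{T}^3)^2)$ be the Hilbert space of $f\in L^2(\mathbb{T}^3\times\mathbb{T}^3)$ with $f(p,q)=-f(q,p)$. For $\lambda\ge0$, $H_{\gamma,\lambda}(0)$ is the bounded self-adjoint operator on $L^{2,a}((\mathbb{T}^3)^2)$ given by $$H_{\gamma,\lambda}(0)f(p,q)=\mathcal{E}_{\gamma,0}(p,q)f(p,q)-\frac{\lambda}{(2\pi)^3}\int_{\mathbb{T}^3}f(s,q)\,ds-\frac{\lambda}{(2\pi)^3}\int_{\mathbb{T}^3}f(p,s)\,ds .$$ "Below its essential spectrum" means smaller than $\inf\sigma_{\mathrm{ess}}(H_{\gamma,\lambda}(0))$. *)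

theory Defs
  imports "HOL-Analysis.Analysis"
begin

text \<open>
  Elements of an \<open>L\<^sup>2\<close> space are represented by square-integrable functions, and all notions
  below respect equality almost everywhere.  A subspace is given by the set \<open>V\<close> of its
  representatives, and an operator on it by a linear map \<open>A\<close> on functions that preserves \<open>V\<close> and
  maps almost everywhere equal functions in \<open>V\<close> to almost everywhere equal ones.
\<close>

definition L2 :: "'a measure \<Rightarrow> ('a \<Rightarrow> complex) set" where
  "L2 M = {f \<in> borel_measurable M. integrable M (\<lambda>x. (cmod (f x))\<^sup>2)}"

definition L2_norm :: "'a measure \<Rightarrow> ('a \<Rightarrow> complex) \<Rightarrow> real" where
  "L2_norm M f = sqrt (\<integral>x. (cmod (f x))\<^sup>2 \<partial>M)"

text \<open>
  The first conjunct says that \<open>A - z\<close> is injective, the second that it is surjective with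
  bounded inverse.
\<close>

definition resolvent_set ::
    "'a measure \<Rightarrow> ('a \<Rightarrow> complex) set \<Rightarrow> (('a \<Rightarrow> complex) \<Rightarrow> 'a \<Rightarrow> complex) \<Rightarrow> complex set" where
  "resolvent_set M V A = {z.
     (\<forall>f\<in>V. (AE x in M. A f x - z * f x = 0) \<longrightarrow> (AE x in M. f x = 0)) \<and>
     (\<exists>C. \<forall>g\<in>V. \<exists>f\<in>V. (AE x in M. A f x - z * f x = g x) \<and> L2_norm M f \<le> C * L2_norm M g)}"

definition spectrum ::
    "'a measure \<Rightarrow> ('a \<Rightarrow> complex) set \<Rightarrow> (('a \<Rightarrow> complex) \<Rightarrow> 'a \<Rightarrow> complex) \<Rightarrow> complex set" where
  "spectrum M V A = - resolvent_set M V A"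

definition eigenspace ::
    "'a measure \<Rightarrow> ('a \<Rightarrow> complex) set \<Rightarrow> (('a \<Rightarrow> complex) \<Rightarrow> 'a \<Rightarrow> complex) \<Rightarrow> complex
      \<Rightarrow> ('a \<Rightarrow> complex) set" where
  "eigenspace M V A z = {f \<in> V. AE x in M. A f x = z * f x}"

definition is_eigenvalue ::
    "'a measure \<Rightarrow> ('a \<Rightarrow> complex) set \<Rightarrow> (('a \<Rightarrow> complex) \<Rightarrow> 'a \<Rightarrow> complex) \<Rightarrow> complex \<Rightarrow> bool" where
  "is_eigenvalue M V A z \<longleftrightarrow> (\<exists>f\<in>eigenspace M V A z. \<not> (AE x in M. f x = 0))"

definition lin_indep_AE :: "'a measure \<Rightarrow> nat \<Rightarrow> (nat \<Rightarrow> 'a \<Rightarrow> complex) \<Rightarrow> bool" where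
  "lin_indep_AE M n b \<longleftrightarrow>
     (\<forall>c :: nat \<Rightarrow> complex. (AE x in M. (\<Sum>i<n. c i * b i x) = 0) \<longrightarrow> (\<forall>i<n. c i = 0))"

text \<open>
  The complex dimension of the eigenspace, as the supremum of the sizes of its linearly
  independent families.
\<close>

definition multiplicity_ev ::
    "'a measure \<Rightarrow> ('a \<Rightarrow> complex) set \<Rightarrow> (('a \<Rightarrow> complex) \<Rightarrow> 'a \<Rightarrow> complex) \<Rightarrow> complex \<Rightarrow> enat" where
  "multiplicity_ev M V A z =
     (SUP n \<in> {n. \<exists>b. (\<forall>i<n. b i \<in> eigenspace M V A z) \<and> lin_indep_AE M n b}. enat n)"

text \<open>
  For self-adjoint \<open>A\<close>, the discrete spectrum consists of the isolated points of the spectrum that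
  are eigenvalues of finite multiplicity (geometric and algebraic multiplicity agree).
\<close>

definition discrete_spectrum ::
    "'a measure \<Rightarrow> ('a \<Rightarrow> complex) set \<Rightarrow> (('a \<Rightarrow> complex) \<Rightarrow> 'a \<Rightarrow> complex) \<Rightarrow> complex set" where
  "discrete_spectrum M V A = {z \<in> spectrum M V A.
     \<not> z islimpt spectrum M V A \<and> is_eigenvalue M V A z \<and> multiplicity_ev M V A z < \<infinity>}"

definition essential_spectrum ::
    "'a measure \<Rightarrow> ('a \<Rightarrow> complex) set \<Rightarrow> (('a \<Rightarrow> complex) \<Rightarrow> 'a \<Rightarrow> complex) \<Rightarrow> complex set" where
  "essential_spectrum M V A = spectrum M V A - discrete_spectrum M V A"

text \<open>The spectrum of a self-adjoint operator is real, so we order its points as reals.\<close>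

definition ess_inf ::
    "'a measure \<Rightarrow> ('a \<Rightarrow> complex) set \<Rightarrow> (('a \<Rightarrow> complex) \<Rightarrow> 'a \<Rightarrow> complex) \<Rightarrow> real" where
  "ess_inf M V A = Inf {x. complex_of_real x \<in> essential_spectrum M V A}"

definition discrete_below ::
    "'a measure \<Rightarrow> ('a \<Rightarrow> complex) set \<Rightarrow> (('a \<Rightarrow> complex) \<Rightarrow> 'a \<Rightarrow> complex) \<Rightarrow> real set" where
  "discrete_below M V A = {x. complex_of_real x \<in> discrete_spectrum M V A \<and> x < ess_inf M V A}"

definition eigenvalues_below ::
    "'a measure \<Rightarrow> ('a \<Rightarrow> complex) set \<Rightarrow> (('a \<Rightarrow> complex) \<Rightarrow> 'a \<Rightarrow> complex) \<Rightarrow> real set" where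
  "eigenvalues_below M V A = {x. is_eigenvalue M V A (complex_of_real x) \<and> x < ess_inf M V A}"

text \<open>
  The number of eigenvalues below the essential spectrum, counted with multiplicity.  The supremum
  over finite subsets gives \<open>\<infinity>\<close> if there are infinitely many.
\<close>

definition count_below ::
    "'a measure \<Rightarrow> ('a \<Rightarrow> complex) set \<Rightarrow> (('a \<Rightarrow> complex) \<Rightarrow> 'a \<Rightarrow> complex) \<Rightarrow> enat" where
  "count_below M V A =
     (SUP Z \<in> {Z. finite Z \<and> Z \<subseteq> eigenvalues_below M V A}.
        \<Sum>x\<in>Z. multiplicity_ev M V A (complex_of_real x))"

definition torus3 :: "(real ^ 3) measure" where
  "torus3 = restrict_space lborel {p. \<forall>i. - pi < p $ i \<and> p $ i \<le> pi}"

abbreviation torus3_sq :: "((real ^ 3) \<times> (real ^ 3)) measure" where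
  "torus3_sq \<equiv> torus3 \<Otimes>\<^sub>M torus3"

definition L2_antisym :: "((real ^ 3) \<times> (real ^ 3) \<Rightarrow> complex) set" where
  "L2_antisym = {f \<in> L2 torus3_sq. AE (p, q) in torus3_sq. f (p, q) = - f (q, p)}"

definition eps :: "real ^ 3 \<Rightarrow> real" where
  "eps p = (\<Sum>i\<in>UNIV. 1 - cos (p $ i))"

text \<open>Since \<open>eps\<close> is \<open>2\<pi>\<close>-periodic in each coordinate, \<open>p + q\<close> need not be reduced modulo \<open>2\<pi>\<close>.\<close>

definition disp :: "real \<Rightarrow> real ^ 3 \<Rightarrow> real ^ 3 \<Rightarrow> real" where
  "disp \<gamma> p q = eps p + eps q + \<gamma> * eps (p + q)"

definition H :: "real \<Rightarrow> real \<Rightarrow> ((real ^ 3) \<times> (real ^ 3) \<Rightarrow> complex) \<Rightarrow> (real ^ 3) \<times> (real ^ 3) \<Rightarrow> complex" where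
  "H \<gamma> l f = (\<lambda>(p, q). of_real (disp \<gamma> p q) * f (p, q)
     - of_real (l / (2 * pi) ^ 3) * (\<integral>s. f (s, q) \<partial>torus3)
     - of_real (l / (2 * pi) ^ 3) * (\<integral>s. f (p, s) \<partial>torus3))"

text \<open>
  The point \<open>- x\<close> leaves the fundamental domain only for \<open>x\<close> in a null set, so it need not be
  reduced modulo \<open>2\<pi>\<close> either.
\<close>

definition odd_AE :: "((real ^ 3) \<times> (real ^ 3) \<Rightarrow> complex) \<Rightarrow> bool" where
  "odd_AE f \<longleftrightarrow> (AE (p, q) in torus3_sq. f (- p, - q) = - f (p, q))"

definition gamma1 :: real where
  "gamma1 = inverse (1 / (2 * pi) ^ 3 * (\<integral>p. (sin (p $ 1))\<^sup>2 / eps p \<partial>torus3))"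

text \<open>
  \<open>g\<close> is the threshold for \<open>n\<close> eigenvalues: for all large \<open>l\<close>, there are fewer than \<open>n\<close>
  eigenvalues below the essential spectrum if \<open>\<gamma> < g\<close>, and at least \<open>n\<close> if \<open>\<gamma> > g\<close>.
\<close>

definition is_threshold :: "nat \<Rightarrow> real \<Rightarrow> bool" where
  "is_threshold n g \<longleftrightarrow> 0 < g \<and>
     (\<forall>\<gamma>. 0 < \<gamma> \<and> \<gamma> < g \<longrightarrow>
        (\<exists>l0>0. \<forall>l>l0. count_below torus3_sq L2_antisym (H \<gamma> l) < enat n)) \<and>
     (\<forall>\<gamma>>g. \<exists>l0>0. \<forall>l>l0. enat n \<le> count_below torus3_sq L2_antisym (H \<gamma> l))"

end

theory Submission
  imports Defs
begin

text \<open>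
  For an antisymmetric \<open>f\<close> put \<open>F q = \<integral>s. f (s, q) \<partial>torus3\<close>.  Since \<open>disp\<close> is a multiplication operator,
  completing the square in \<open>f\<close> for given \<open>F\<close> bounds the form of \<open>H - \<tau>\<close> from below by a form in \<open>F\<close>
  alone.  Let \<open>\<tau> < 0\<close> be the lowest energy of the one-particle operator at \<open>q = 0\<close>.  For large coupling,
  \<open>\<tau>\<close> is close to minus the coupling constant, and expanding \<open>1 / (disp - \<tau>)\<close> shows that the reduced form is a
  positive multiple of
  \<open>(\<integral>p. eps p * (F p)\<^sup>2) - \<gamma> / (2 * pi) ^ 3 * (\<Sum>i. (\<integral>p. sin (p $ i) * F p)\<^sup>2)\<close>
  up to nonnegative terms and a relative error that tends to zero; the error is controlled because
  \<open>1 / eps\<close> is integrable in dimension three.  As the functions \<open>sin (p $ i) / sqrt (eps p)\<close> are orthogonal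
  with equal norms, Bessel's inequality makes this form positive if \<open>\<gamma> < gamma1\<close>.  If \<open>\<gamma> > gamma1\<close>, it is
  positive on a subspace of codimension three and negative at \<open>F p = sin (p $ 1) / eps p\<close>.  Minimising the form
  of \<open>H\<close> over the functions that are odd in the first and even in the other coordinates then yields an
  eigenvector below \<open>\<tau>\<close>, permuting the coordinates yields two more, and on their orthogonal complement
  \<open>H > \<tau>\<close>.  Hence everything below \<open>\<tau>\<close> except this eigenvalue is in the resolvent set (by a Banach fixed point
  argument), and \<open>\<tau>\<close> is not an eigenvalue but has a Weyl sequence, so it is the infimum of the essential
  spectrum.
\<close>

section \<open>Self-adjoint operators with a spectral gap\<close>

text \<open>The energy parameter \<open>w\<close> is primary and the coupling \<open>k\<close> is
  determined by it, since \<tau> is given only implicitly by an integral equation; the intermediate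
  value theorem leads back from a large \<open>k\<close> to a large \<open>w\<close>. The difficulty
  is that the reduced form degenerates: its diagonal part has the size of \<open>eps q\<close>,
  which vanishes at \<open>q = 0\<close>, so an error is admissible only if it is a small multiple
  of the integral of \<open>eps\<close> times the square of F. Errors given by the L1 norm of F are
  of this kind by a weighted Cauchy-Schwarz inequality. The one term of larger order, the square of
  the integral of F divided by \<open>w\<close>, is positive and absorbs the mixed term next to it.
  The strict inequality at \<tau> settles the spectral side: it excludes \<tau> as an eigenvalue, so
  that a Weyl sequence alone makes \<tau> essential. Since \<open>H\<close> has real coefficients,
  the analysis takes place in a real Hilbert space of classes, and complex functions are pairs of
  such classes.\<close>

lemma coercive_surj:
  fixes A :: "'a::{real_inner,complete_space} \<Rightarrow> 'a"
  assumes A: "bounded_linear A" and c: "c > 0" and co: "\<And>x. c * (norm x)\<^sup>2 \<le> A x \<bullet> x"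
  shows "\<exists>x. A x = g"
proof -
  interpret A: bounded_linear A by fact
  obtain K0 where K0: "\<And>x. norm (A x) \<le> norm x * K0"
    using A.bounded by blast
  \<comment> \<open>The maximum with \<open>c\<close> makes \<open>K\<close> positive and keeps
    \<open>1 - c^2 / K^2\<close> nonnegative, so that the contraction factor \<open>L\<close> is a
    real number below 1.\<close>
  define K where "K = max K0 c"
  have K: "norm (A x) \<le> K * norm x" for x
    using K0[of x] mult_left_mono[of K0 K "norm x"] by (simp add: K_def mult.commute)
  have Kc: "0 < K" "c \<le> K" using c by (auto simp: K_def)
  \<comment> \<open>This \<open>r\<close> minimises \<open>1 - 2 * r * c + r^2 * K^2\<close>, the
    bound on the squared contraction factor.\<close>
  define r where "r = c / K\<^sup>2"
  have r: "r > 0" using c Kc by (simp add: r_def)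
  define L where "L = sqrt (1 - c\<^sup>2 / K\<^sup>2)"
  have cK: "c\<^sup>2 / K\<^sup>2 \<le> 1" using c Kc by (simp add: power_mono)
  have L: "0 \<le> L" "L < 1" using c Kc cK by (auto simp: L_def)
  have contr: "norm (x - r *\<^sub>R A x) \<le> L * norm x" for x
  proof -
    have "(norm (x - r *\<^sub>R A x))\<^sup>2 = (norm x)\<^sup>2 - 2 * r * (A x \<bullet> x) + r\<^sup>2 * (norm (A x))\<^sup>2"
      unfolding power2_norm_eq_inner by (simp add: inner_simps inner_commute algebra_simps power2_eq_square)
    also have "\<dots> \<le> (norm x)\<^sup>2 - 2 * r * (c * (norm x)\<^sup>2) + r\<^sup>2 * (K * norm x)\<^sup>2"
      using co[of x] r K[of x] by (intro add_mono diff_mono mult_left_mono power_mono) auto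
    also have "\<dots> = (1 - c\<^sup>2 / K\<^sup>2) * (norm x)\<^sup>2"
      using Kc by (simp add: r_def field_simps power2_eq_square)
    also have "\<dots> = (L * norm x)\<^sup>2" using cK by (simp add: L_def power_mult_distrib)
    finally show ?thesis by (rule power2_le_imp_le) (use L in simp)
  qed
  have "\<exists>!x. x - r *\<^sub>R (A x - g) = x"
  proof (rule banach_fix_type[OF L], intro allI)
    fix x y
    have "dist (x - r *\<^sub>R (A x - g)) (y - r *\<^sub>R (A y - g)) = norm ((x - y) - r *\<^sub>R A (x - y))"
      by (simp add: dist_norm A.diff algebra_simps)
    then show "dist (x - r *\<^sub>R (A x - g)) (y - r *\<^sub>R (A y - g)) \<le> L * dist x y"
      using contr[of "x - y"] by (simp add: dist_norm)
  qed
  then obtain x where "x - r *\<^sub>R (A x - g) = x" by blast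
  then have "A x = g" using r by simp
  then show ?thesis by blast
qed

text \<open>The first-order condition at a minimum: for small \<open>t\<close> of the right sign the
  linear term dominates. With \<open>d\<close> positive and larger than \<open>c\<close>, the choice
  \<open>t = - b / d\<close> is small enough.\<close>

lemma linear_term_zero:
  fixes b c :: real
  assumes "\<And>t. 0 \<le> 2 * t * b + t\<^sup>2 * c"
  shows "b = 0"
proof (rule ccontr)
  assume b: "b \<noteq> 0"
  define d where "d = \<bar>c\<bar> + 1"
  have d: "d > 0" "c < d" by (auto simp: d_def)
  have "0 \<le> 2 * (-b / d) * b + (-b / d)\<^sup>2 * c" by (rule assms)
  also have "\<dots> = (b\<^sup>2 / d\<^sup>2) * (c - 2 * d)"
    using d by (simp add: field_simps power2_eq_square)
  also have "\<dots> < 0" using b d by (intro mult_pos_neg) auto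
  finally show False by simp
qed

text \<open>The unit sphere is not compact, but on the part of \<open>V\<close> orthogonal to
  \<open>u\<close> the form of \<open>T - m\<close> is coercive with constant
  \<open>\<tau> - m\<close>, so a minimising sequence can fail to converge in one direction only.
  The numbers \<open>X n \<bullet> u\<close> are bounded and converge along a subsequence, which is
  then Cauchy.\<close>

lemma min_eigenvector:
  fixes T :: "'a::{real_inner,complete_space} \<Rightarrow> 'a"
  assumes T: "bounded_linear T" and sym: "\<And>x y. T x \<bullet> y = x \<bullet> T y"
    and V: "subspace V" "closed V" and TV: "\<And>x. x \<in> V \<Longrightarrow> T x \<in> V"
    and hyp: "\<And>x. x \<in> V \<Longrightarrow> x \<bullet> u = 0 \<Longrightarrow> \<tau> * (norm x)\<^sup>2 \<le> T x \<bullet> x"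
    and v: "v \<in> V" "T v \<bullet> v < \<tau> * (norm v)\<^sup>2"
  shows "\<exists>m<\<tau>. \<exists>x\<in>V. norm x = 1 \<and> T x = m *\<^sub>R x"
proof -
  interpret T: bounded_linear T by fact
  obtain K where K: "\<And>x. norm (T x) \<le> norm x * K" using T.bounded by blast
  define R where "R = {T x \<bullet> x | x. x \<in> V \<and> norm x = 1}"
  define m where "m = Inf R"
  have v0: "v \<noteq> 0" using v T.zero by auto
  have bdd: "bdd_below R"
  proof (rule bdd_belowI[of _ "- K"])
    fix y assume "y \<in> R"
    then obtain x where x: "norm x = 1" "y = T x \<bullet> x" by (auto simp: R_def)
    have "\<bar>T x \<bullet> x\<bar> \<le> norm (T x) * norm x" by (rule Cauchy_Schwarz_ineq2)
    also have "\<dots> \<le> K" using K[of x] x by simp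
    finally show "- K \<le> y" using x by simp
  qed
  have unit: "T (x /\<^sub>R norm x) \<bullet> (x /\<^sub>R norm x) = (T x \<bullet> x) / (norm x)\<^sup>2" for x
    by (simp add: T.scaleR power2_eq_square divide_inverse)
  have inR: "(T x \<bullet> x) / (norm x)\<^sup>2 \<in> R" if "x \<in> V" "x \<noteq> 0" for x
    unfolding R_def mem_Collect_eq unit[symmetric]
    using that V by (intro exI[of _ "x /\<^sub>R norm x"]) (auto simp: subspace_scale)
  have mlow: "m * (norm x)\<^sup>2 \<le> T x \<bullet> x" if "x \<in> V" for x
  proof (cases "x = 0")
    case False
    have "m \<le> (T x \<bullet> x) / (norm x)\<^sup>2"
      unfolding m_def by (rule cInf_lower[OF inR[OF that False] bdd])
    then show ?thesis using False by (simp add: field_simps)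
  qed (simp add: T.zero)
  have m\<tau>: "m < \<tau>"
  proof -
    have "m \<le> (T v \<bullet> v) / (norm v)\<^sup>2"
      unfolding m_def by (rule cInf_lower[OF inR[OF v(1) v0] bdd])
    also have "\<dots> < \<tau>" using v(2) v0 by (simp add: field_simps)
    finally show ?thesis .
  qed
  have Rne: "R \<noteq> {}" using inR[OF v(1) v0] by auto
  define Q where "Q = (\<lambda>x. T x \<bullet> x - m * (norm x)\<^sup>2)"
  have Q0: "0 \<le> Q x" if "x \<in> V" for x using mlow[OF that] by (simp add: Q_def)
  \<comment> \<open>The parallelogram law stands in for the triangle inequality of the seminorm
    given by \<open>Q\<close>, up to a factor 2.\<close>
  have Qpar: "Q (x + y) + Q (x - y) = 2 * Q x + 2 * Q y" for x y
    by (simp add: Q_def T.add T.diff power2_norm_eq_inner inner_simps algebra_simps)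
  have Qadd: "Q (x + y) \<le> 2 * Q x + 2 * Q y" if "x \<in> V" "y \<in> V" for x y
    using Qpar[of x y] Q0[of "x - y"] that V by (auto simp: subspace_diff)
  have Qdiff: "Q (x - y) \<le> 2 * Q x + 2 * Q y" if "x \<in> V" "y \<in> V" for x y
    using Qpar[of x y] Q0[of "x + y"] that V by (auto simp: subspace_add)
  have Qscale: "Q (s *\<^sub>R x) = s\<^sup>2 * Q x" for s x
    by (simp add: Q_def T.scaleR power_mult_distrib power2_eq_square algebra_simps)
  have "\<exists>x\<in>V. norm x = 1 \<and> Q x < 1 / real (Suc n)" for n
  proof -
    have "Inf R < m + 1 / real (Suc n)" by (simp add: m_def)
    then obtain y where "y \<in> R" "y < m + 1 / real (Suc n)"
      using cInf_lessD[OF Rne] by blast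
    then show ?thesis by (auto simp: R_def Q_def)
  qed
  then obtain X where X: "\<And>n. X n \<in> V" "\<And>n. norm (X n) = 1" "\<And>n. Q (X n) < 1 / real (Suc n)"
    by metis
  have "bounded (range (\<lambda>n. X n \<bullet> u))"
  proof (rule boundedI)
    fix y assume "y \<in> range (\<lambda>n. X n \<bullet> u)"
    then obtain n where "y = X n \<bullet> u" by auto
    then show "norm y \<le> norm u" using Cauchy_Schwarz_ineq2[of "X n" u] X(2)[of n] by simp
  qed
  then obtain l r where r: "strict_mono (r::nat \<Rightarrow> nat)" and l: "((\<lambda>n. X n \<bullet> u) \<circ> r) \<longlonglongrightarrow> l"
    using bounded_imp_convergent_subsequence by blast
  define Y where "Y = X \<circ> r"
  have Y: "Y n \<in> V" "norm (Y n) = 1" "0 \<le> Q (Y n)" for n using X Q0 by (auto simp: Y_def)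
  have QY: "(\<lambda>n. Q (Y n)) \<longlonglongrightarrow> 0"
  proof (rule tendsto_sandwich[of "\<lambda>_. 0" _ _ "\<lambda>n. 1 / real (Suc n)"])
    have "Q (Y n) \<le> 1 / real (Suc n)" for n
    proof -
      have "Q (Y n) < 1 / real (Suc (r n))" using X(3) by (simp add: Y_def)
      also have "\<dots> \<le> 1 / real (Suc n)" using seq_suble[OF r, of n] by (simp add: field_simps)
      finally show ?thesis by simp
    qed
    then show "\<forall>\<^sub>F n in sequentially. Q (Y n) \<le> 1 / real (Suc n)" by simp
    show "(\<lambda>n. 1 / real (Suc n)) \<longlonglongrightarrow> 0" using LIMSEQ_inverse_real_of_nat by (simp add: inverse_eq_divide)
  qed (use Y in auto)
  have Yu: "(\<lambda>n. Y n \<bullet> u) \<longlonglongrightarrow> l" using l by (simp add: Y_def o_def)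
  \<comment> \<open>Otherwise \<open>hyp\<close> would apply to \<open>v\<close> itself.\<close>
  have vu: "v \<bullet> u \<noteq> 0" using hyp[OF v(1)] v(2) by force
  define A where "A = 8 / (\<tau> - m)"
  define B where "B = (4 * Q v / (\<tau> - m) + 2 * (norm v)\<^sup>2) / (v \<bullet> u)\<^sup>2"
  have A: "A \<ge> 0" using m\<tau> by (simp add: A_def)
  have B: "B \<ge> 0" using m\<tau> Q0[OF v(1)] by (simp add: B_def)
  have main: "(norm (Y i - Y j))\<^sup>2 \<le> A * (Q (Y i) + Q (Y j)) + B * (Y i \<bullet> u - Y j \<bullet> u)\<^sup>2" for i j
  proof -
    \<comment> \<open>Correcting the difference by a multiple of \<open>v\<close> makes it
      orthogonal to \<open>u\<close>, where coercivity holds.\<close>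
    define s where "s = (Y i \<bullet> u - Y j \<bullet> u) / (v \<bullet> u)"
    define d where "d = (Y i - Y j) - s *\<^sub>R v"
    have mem: "Y i - Y j \<in> V" "s *\<^sub>R v \<in> V" using Y v V by (auto simp: subspace_diff subspace_scale)
    then have dV: "d \<in> V" using V by (auto simp: d_def subspace_diff)
    have du: "d \<bullet> u = 0" using vu by (simp add: d_def s_def inner_simps)
    have "(\<tau> - m) * (norm d)\<^sup>2 \<le> Q d" using hyp[OF dV du] by (simp add: Q_def algebra_simps)
    also have "\<dots> \<le> 2 * Q (Y i - Y j) + 2 * (s\<^sup>2 * Q v)"
      using Qdiff[OF mem] by (simp add: d_def Qscale)
    also have "\<dots> \<le> 2 * (2 * Q (Y i) + 2 * Q (Y j)) + 2 * (s\<^sup>2 * Q v)"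
      using Qdiff[OF Y(1) Y(1), of i j] by simp
    finally have nd: "(norm d)\<^sup>2 \<le> (4 * (Q (Y i) + Q (Y j)) + 2 * s\<^sup>2 * Q v) / (\<tau> - m)"
      using m\<tau> by (simp add: field_simps)
    have "(norm (Y i - Y j))\<^sup>2 = (norm (d + s *\<^sub>R v))\<^sup>2" by (simp add: d_def)
    also have "\<dots> \<le> 2 * (norm d)\<^sup>2 + 2 * (norm (s *\<^sub>R v))\<^sup>2"
      using inner_ge_zero[of "d - s *\<^sub>R v"]
      by (simp only: power2_norm_eq_inner) (simp add: inner_simps inner_commute algebra_simps)
    also have "\<dots> \<le> 2 * ((4 * (Q (Y i) + Q (Y j)) + 2 * s\<^sup>2 * Q v) / (\<tau> - m)) + 2 * (s\<^sup>2 * (norm v)\<^sup>2)"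
      using nd by (simp only: norm_scaleR power_mult_distrib power2_abs)
    also have "\<dots> = A * (Q (Y i) + Q (Y j)) + B * (Y i \<bullet> u - Y j \<bullet> u)\<^sup>2"
    proof -
      have "(Y i \<bullet> u - Y j \<bullet> u)\<^sup>2 = s\<^sup>2 * (v \<bullet> u)\<^sup>2" using vu by (simp add: s_def power_divide)
      then have "B * (Y i \<bullet> u - Y j \<bullet> u)\<^sup>2 = s\<^sup>2 * (4 * Q v / (\<tau> - m) + 2 * (norm v)\<^sup>2)"
        using vu by (simp add: B_def)
      then show ?thesis using m\<tau> by (simp add: A_def field_simps)
    qed
    finally show ?thesis .
  qed
  have "Cauchy Y"
  proof (rule metric_CauchyI)
    fix e :: real assume e: "e > 0"
    define k where "k = A + 1"
    have k: "k > 0" "A \<le> k" using A by (auto simp: k_def)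
    define e1 where "e1 = e\<^sup>2 / (4 * k)"
    define e2 where "e2 = e / (2 * sqrt (B + 1))"
    have e12: "e1 > 0" "e2 > 0" using e k B by (auto simp: e1_def e2_def)
    obtain N1 where N1: "\<And>n. n \<ge> N1 \<Longrightarrow> \<bar>Q (Y n)\<bar> < e1"
      using LIMSEQ_D[OF QY e12(1)] by auto
    obtain N2 where N2: "\<And>i j. i \<ge> N2 \<Longrightarrow> j \<ge> N2 \<Longrightarrow> \<bar>Y i \<bullet> u - Y j \<bullet> u\<bar> < e2"
      using metric_CauchyD[OF LIMSEQ_imp_Cauchy[OF Yu] e12(2)] by (auto simp: dist_real_def)
    show "\<exists>M. \<forall>i\<ge>M. \<forall>j\<ge>M. dist (Y i) (Y j) < e"
    proof (intro exI[of _ "max N1 N2"] allI impI)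
      fix i j assume ij: "max N1 N2 \<le> i" "max N1 N2 \<le> j"
      have sq: "(Y i \<bullet> u - Y j \<bullet> u)\<^sup>2 \<le> e2\<^sup>2" using N2[of i j] ij
        by (subst abs_le_square_iff[symmetric]) (use e12 in auto)
      have "(norm (Y i - Y j))\<^sup>2 \<le> A * (e1 + e1) + B * e2\<^sup>2"
        using main[of i j] N1[of i] N1[of j] ij sq A B
        by (smt (verit) mult_left_mono max.bounded_iff)
      also have "\<dots> < e\<^sup>2"
      proof -
        have "A * (e1 + e1) = (A / k) * (e\<^sup>2 / 2)" using k by (simp add: e1_def)
        also have "\<dots> \<le> 1 * (e\<^sup>2 / 2)" using k by (intro mult_right_mono) auto
        finally have "A * (e1 + e1) \<le> e\<^sup>2 / 2" by simp
        moreover have "B * e2\<^sup>2 = (B / (B + 1)) * (e\<^sup>2 / 4)"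
          using B by (simp add: e2_def power_mult_distrib power_divide)
        moreover have "\<dots> \<le> 1 * (e\<^sup>2 / 4)" using B by (intro mult_right_mono) auto
        moreover have "0 < e\<^sup>2" using e by simp
        ultimately show ?thesis by linarith
      qed
      finally show "dist (Y i) (Y j) < e" unfolding dist_norm
        by (rule power2_less_imp_less) (use e in simp)
    qed
  qed
  then obtain x where x: "Y \<longlonglongrightarrow> x" using Cauchy_convergent_iff convergent_def by blast
  have xV: "x \<in> V" using closed_sequentially[OF V(2) _ x] Y by auto
  have "(\<lambda>n. norm (Y n)) \<longlonglongrightarrow> norm x" using x by (rule tendsto_norm)
  then have nx: "norm x = 1" using Y(2) LIMSEQ_unique by (simp add: tendsto_const_iff)
  have "(\<lambda>n. Q (Y n)) \<longlonglongrightarrow> Q x"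
    unfolding Q_def by (intro tendsto_intros T.tendsto x)
  then have Qx: "Q x = 0" using QY LIMSEQ_unique by blast
  \<comment> \<open>Varying the minimiser in the direction of its own residual \<open>g\<close>
    turns the first-order condition into \<open>g \<bullet> g = 0\<close>.\<close>
  define g where "g = T x - m *\<^sub>R x"
  have gV: "g \<in> V" using xV TV V by (auto simp: g_def subspace_diff subspace_scale)
  have "g \<bullet> g = 0"
  proof (rule linear_term_zero)
    fix t :: real
    have "0 \<le> Q (x + t *\<^sub>R g)" using xV gV V by (intro Q0) (auto simp: subspace_add subspace_scale)
    also have "Q (x + t *\<^sub>R g) = Q x + 2 * t * ((T x - m *\<^sub>R x) \<bullet> g) + t\<^sup>2 * Q g"
      unfolding Q_def power2_norm_eq_inner T.add T.scaleR
      using sym[of g x] by (simp add: inner_simps inner_commute power2_eq_square algebra_simps)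
    finally show "0 \<le> 2 * t * (g \<bullet> g) + t\<^sup>2 * Q g" by (simp add: Qx g_def[symmetric])
  qed
  then have "T x = m *\<^sub>R x" by (simp add: g_def)
  then show ?thesis using m\<tau> xV nx by blast
qed

text \<open>The \<open>e i\<close> will span the eigenspace of the only eigenvalue below \<tau>,
  while positivity is known orthogonally to other vectors \<open>u i\<close>; by \<open>eu\<close>
  each \<open>e i\<close> meets only the \<open>u\<close> of its own index. The set \<open>I\<close>
  may be empty, and then \<open>z\<close> is just some number below \<tau>.\<close>

locale spectral_gap =
  fixes T :: "'a::{real_inner,complete_space} \<Rightarrow> 'a" and I :: "'k set" and e u :: "'k \<Rightarrow> 'a"
    and z \<tau> :: real
  assumes T: "bounded_linear T" and sym: "\<And>x y. T x \<bullet> y = x \<bullet> T y"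
    and I: "finite I" and z\<tau>: "z < \<tau>"
    and on: "\<And>i j. i \<in> I \<Longrightarrow> j \<in> I \<Longrightarrow> e i \<bullet> e j = (if i = j then 1 else 0)"
    and Te: "\<And>i. i \<in> I \<Longrightarrow> T (e i) = z *\<^sub>R e i"
    and eu: "\<And>i j. i \<in> I \<Longrightarrow> j \<in> I \<Longrightarrow> i \<noteq> j \<Longrightarrow> e i \<bullet> u j = 0"
    and strict: "\<And>x. x \<noteq> 0 \<Longrightarrow> (\<And>i. i \<in> I \<Longrightarrow> x \<bullet> u i = 0) \<Longrightarrow> \<tau> * (norm x)\<^sup>2 < T x \<bullet> x"
begin

interpretation T: bounded_linear T by (rule T)

definition P :: "'a \<Rightarrow> 'a" where "P x = (\<Sum>i\<in>I. (x \<bullet> e i) *\<^sub>R e i)"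

lemma sum_e: "(\<Sum>i\<in>I. c i *\<^sub>R e i) \<bullet> e j = c j" if "j \<in> I" for c
proof -
  have "(\<Sum>i\<in>I. c i *\<^sub>R e i) \<bullet> e j = (\<Sum>i\<in>I. if i = j then c i else 0)"
    unfolding inner_sum_left using that by (intro sum.cong) (auto simp: on)
  then show ?thesis using I that by simp
qed

lemma P_e: "j \<in> I \<Longrightarrow> P x \<bullet> e j = x \<bullet> e j"
  by (simp add: P_def sum_e)

lemma TP: "T (\<Sum>i\<in>I. c i *\<^sub>R e i) = z *\<^sub>R (\<Sum>i\<in>I. c i *\<^sub>R e i)"
  by (simp add: T.sum T.scaleR Te scaleR_sum_right mult.commute)

text \<open>A combination \<open>n\<close> of the \<open>e i\<close> is added so that
  \<open>x + n\<close> is orthogonal to all \<open>u i\<close>. As \<open>x\<close> is orthogonal to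
  \<open>n\<close> and \<open>T n = z *\<^sub>R n\<close> with \<open>z < \<tau>\<close>, the part
  \<open>n\<close> only lowers the form relative to \<tau>, so the strict inequality passes from
  \<open>x + n\<close> to \<open>x\<close>.\<close>

lemma orth_strict:
  assumes x: "x \<noteq> 0" and xe: "\<And>i. i \<in> I \<Longrightarrow> x \<bullet> e i = 0"
  shows "\<tau> * (norm x)\<^sup>2 < T x \<bullet> x"
proof -
  \<comment> \<open>If \<open>e i\<close> were orthogonal to \<open>u i\<close>, it would be
    orthogonal to every \<open>u j\<close>, and \<open>strict\<close> would contradict
    \<open>z < \<tau>\<close>.\<close>
  have eu0: "e i \<bullet> u i \<noteq> 0" if i: "i \<in> I" for i
  proof
    assume 0: "e i \<bullet> u i = 0"
    have n: "norm (e i) = 1" using on[OF i i] by (simp add: norm_eq_sqrt_inner)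
    have "\<tau> * (norm (e i))\<^sup>2 < T (e i) \<bullet> e i"
    proof (rule strict)
      show "e i \<noteq> 0" using n by auto
      show "e i \<bullet> u j = 0" if "j \<in> I" for j using 0 eu[OF i that] by (cases "i = j") auto
    qed
    then show False using n z\<tau> by (simp add: Te[OF i] on[OF i i])
  qed
  define c where "c = (\<lambda>i. - (x \<bullet> u i) / (e i \<bullet> u i))"
  define n where "n = (\<Sum>i\<in>I. c i *\<^sub>R e i)"
  have nu: "n \<bullet> u j = - (x \<bullet> u j)" if j: "j \<in> I" for j
  proof -
    have "n \<bullet> u j = (\<Sum>i\<in>I. if i = j then c i * (e i \<bullet> u i) else 0)"
      unfolding n_def inner_sum_left using j by (intro sum.cong) (auto simp: eu)
    then show ?thesis using I j eu0 by (simp add: c_def)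
  qed
  have xn: "x \<bullet> n = 0" by (simp add: n_def inner_sum_right xe)
  have Tn: "T n = z *\<^sub>R n" unfolding n_def by (rule TP)
  have "x + n \<noteq> 0"
  proof
    assume "x + n = 0"
    then have "(x + n) \<bullet> x = 0" by simp
    then show False using x xn by (simp add: inner_simps inner_commute)
  qed
  then have "\<tau> * (norm (x + n))\<^sup>2 < T (x + n) \<bullet> (x + n)"
    by (rule strict) (simp add: inner_simps nu)
  also have "T (x + n) \<bullet> (x + n) = T x \<bullet> x + z * (norm n)\<^sup>2"
    using sym[of x n] xn by (simp add: T.add Tn inner_simps inner_commute power2_norm_eq_inner)
  also have "(norm (x + n))\<^sup>2 = (norm x)\<^sup>2 + (norm n)\<^sup>2"
    using xn by (simp add: power2_norm_eq_inner inner_simps inner_commute)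
  finally have "\<tau> * (norm x)\<^sup>2 + (\<tau> - z) * (norm n)\<^sup>2 < T x \<bullet> x"
    by (simp add: algebra_simps)
  moreover have "0 \<le> (\<tau> - z) * (norm n)\<^sup>2" using z\<tau> by simp
  ultimately show ?thesis by linarith
qed

lemma P_decomp: "(x - P x) \<bullet> P x = 0"
proof -
  have "(x - P x) \<bullet> P x = (\<Sum>i\<in>I. (x \<bullet> e i) * ((x - P x) \<bullet> e i))"
    by (subst (2) P_def) (simp add: inner_sum_right)
  then show ?thesis using P_e by (simp add: inner_diff_left)
qed

text \<open>Lifts the eigenvalue \<open>z\<close> to \<tau> on the span of the \<open>e i\<close>,
  so that the form is at least \<tau> on the whole space and \<open>coercive_surj\<close> applies at
  energies below \<tau>.\<close>

definition T' :: "'a \<Rightarrow> 'a" where "T' x = T x + (\<tau> - z) *\<^sub>R P x"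

lemma T'_bl: "bounded_linear T'"
  unfolding T'_def[abs_def] P_def
  by (intro bounded_linear_add T bounded_linear_const_scaleR bounded_linear_sum
      bounded_linear_scaleR_const bounded_linear_inner_left)

lemma T'_ge: "\<tau> * (norm x)\<^sup>2 \<le> T' x \<bullet> x"
proof -
  define y where "y = x - P x"
  have xy: "x = y + P x" by (simp add: y_def)
  have yP: "y \<bullet> P x = 0" using P_decomp by (simp add: y_def)
  have TPx: "T (P x) = z *\<^sub>R P x" unfolding P_def by (rule TP)
  have Ty: "\<tau> * (norm y)\<^sup>2 \<le> T y \<bullet> y"
  proof (cases "y = 0")
    case False
    then show ?thesis using orth_strict[of y] by (force simp: y_def inner_diff_left P_e)
  qed (simp add: T.zero)
  have "T' x \<bullet> x = (T y + z *\<^sub>R P x + (\<tau> - z) *\<^sub>R P x) \<bullet> (y + P x)"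
    unfolding T'_def by (subst (1 3) xy) (simp add: T.add TPx)
  also have "\<dots> = T y \<bullet> y + \<tau> * (norm (P x))\<^sup>2"
    using sym[of y "P x"] yP
    by (simp add: TPx inner_simps inner_commute power2_norm_eq_inner algebra_simps)
  also have "\<dots> \<ge> \<tau> * ((norm y)\<^sup>2 + (norm (P x))\<^sup>2)" using Ty by (simp add: algebra_simps)
  finally show ?thesis
    using yP by (subst (1) xy) (simp add: power2_norm_eq_inner inner_simps inner_commute)
qed

text \<open>Eigenvectors for different eigenvalues are orthogonal, so an eigenvalue other than
  \<open>z\<close> would have its vector where the form exceeds \<tau>. The case
  \<open>\<mu> = \<tau>\<close> is included on purpose: the threshold must not be an
  eigenvalue.\<close>

lemma eigen_low:
  assumes "T x = \<mu> *\<^sub>R x" "x \<noteq> 0" "\<mu> \<le> \<tau>"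
  shows "\<mu> = z \<and> x = P x"
proof -
  have \<mu>: "\<mu> = z"
  proof (rule ccontr)
    assume ne: "\<mu> \<noteq> z"
    have "x \<bullet> e i = 0" if "i \<in> I" for i
      using sym[of x "e i"] that ne by (simp add: assms Te)
    then have "\<tau> * (norm x)\<^sup>2 < T x \<bullet> x" by (rule orth_strict[OF assms(2)])
    then show False using assms by (simp add: power2_norm_eq_inner mult_right_mono leD)
  qed
  define y where "y = x - P x"
  have TPx: "T (P x) = z *\<^sub>R P x" unfolding P_def by (rule TP)
  have Ty: "T y = z *\<^sub>R y" by (simp add: y_def T.diff assms \<mu> TPx scaleR_diff_right)
  have "y = 0"
  proof (rule ccontr)
    assume y: "y \<noteq> 0"
    then have "\<tau> * (norm y)\<^sup>2 < T y \<bullet> y"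
      by (rule orth_strict) (simp add: y_def inner_diff_left P_e)
    then show False using z\<tau> y by (simp add: Ty power2_norm_eq_inner)
  qed
  then show ?thesis using \<mu> by (simp add: y_def)
qed

end

text \<open>Pairs \<open>(a, b)\<close> stand for \<open>a + \<i> b\<close>, so that \<open>'a \<times> 'a\<close> is the complexification of \<open>'a\<close>.\<close>

definition cmul :: "complex \<Rightarrow> 'a \<times> 'a \<Rightarrow> 'a \<times> 'a::real_vector" where
  "cmul w v = (Re w *\<^sub>R fst v - Im w *\<^sub>R snd v, Re w *\<^sub>R snd v + Im w *\<^sub>R fst v)"

lemma cmul_bl: "bounded_linear (cmul w :: 'a::real_normed_vector \<times> 'a \<Rightarrow> _)"
  unfolding cmul_def[abs_def]
  by (intro bounded_linear_Pair bounded_linear_sub bounded_linear_add bounded_linear_const_scaleR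
      bounded_linear_fst bounded_linear_snd)

lemma cmul_inner: "cmul w v \<bullet> v = Re w * (norm v)\<^sup>2"
  by (cases v) (simp add: cmul_def inner_simps inner_commute power2_norm_eq_inner algebra_simps)

lemma norm_cmul: "norm (cmul w v) = cmod w * norm (v :: 'a::real_inner \<times> 'a)"
proof (rule power2_eq_imp_eq)
  show "(norm (cmul w v))\<^sup>2 = (cmod w * norm v)\<^sup>2"
    unfolding power_mult_distrib power2_norm_eq_inner
    by (cases v) (simp add: cmul_def inner_simps inner_commute
        inner_complex_def power2_eq_square algebra_simps)
qed auto

lemma cmul_cmul: "cmul w (cmul w' v) = cmul (w * w') v"
  by (cases v) (simp add: cmul_def algebra_simps)

context spectral_gap
begin

interpretation T: bounded_linear T by (rule T)

lemma eigen_complex: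
  assumes eq: "map_prod T T v = cmul w v" and v: "v \<noteq> 0"
  shows "Im w = 0"
proof -
  obtain a b where ab: "v = (a, b)" by (cases v)
  have Ta: "T a = Re w *\<^sub>R a - Im w *\<^sub>R b" and Tb: "T b = Re w *\<^sub>R b + Im w *\<^sub>R a"
    using eq by (auto simp: ab cmul_def)
  have "T a \<bullet> b = a \<bullet> T b" by (rule sym)
  then have "Im w * (a \<bullet> a + b \<bullet> b) = 0" by (simp add: Ta Tb inner_simps inner_commute algebra_simps)
  moreover have "a \<bullet> a + b \<bullet> b \<noteq> 0"
    using v by (simp add: ab add_nonneg_eq_0_iff zero_prod_def)
  ultimately show ?thesis by simp
qed

text \<open>On pairs, \<open>T'\<close> minus \<open>w\<close> is coercive with constant
  \<open>\<tau> - Re w\<close> for the real inner product, hence invertible. Its solution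
  \<open>v\<close> solves the equation for \<open>T\<close> up to a multiple of \<open>P v\<close>,
  which is compensated inside the span of the \<open>e i\<close>, where \<open>T\<close> acts as
  \<open>z\<close>.\<close>

lemma resolvent_bound:
  assumes w: "Re w < \<tau>" "w \<noteq> of_real z"
  shows "\<exists>C. \<forall>g. \<exists>v. map_prod T T v - cmul w v = g \<and> norm v \<le> C * norm g"
proof -
  define A where "A = (\<lambda>v. map_prod T' T' v - cmul w v)"
  define d where "d = \<tau> - Re w"
  have d: "d > 0" using w by (simp add: d_def)
  have "bounded_linear (\<lambda>v. map_prod T' T' v)"
  proof -
    have "map_prod T' T' = (\<lambda>v. (T' (fst v), T' (snd v)))" by (auto simp: map_prod_def)
    then show ?thesis
      by (simp add: bounded_linear_Pair bounded_linear_compose[OF T'_bl] bounded_linear_fst bounded_linear_snd)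
  qed
  then have A: "bounded_linear A" unfolding A_def by (intro bounded_linear_sub cmul_bl)
  have co: "d * (norm v)\<^sup>2 \<le> A v \<bullet> v" for v
  proof -
    obtain a b where v: "v = (a, b)" by (cases v)
    have "A v \<bullet> v = T' a \<bullet> a + T' b \<bullet> b - cmul w v \<bullet> v" by (simp add: A_def v inner_diff_left)
    also have "\<dots> \<ge> \<tau> * (norm a)\<^sup>2 + \<tau> * (norm b)\<^sup>2 - Re w * (norm v)\<^sup>2"
      using T'_ge[of a] T'_ge[of b] by (simp add: cmul_inner)
    also have "\<tau> * (norm a)\<^sup>2 + \<tau> * (norm b)\<^sup>2 - Re w * (norm v)\<^sup>2 = d * (norm v)\<^sup>2"
      by (simp add: d_def v norm_Pair algebra_simps)
    finally show ?thesis .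
  qed
  \<comment> \<open>On the span of the \<open>e i\<close> the operator \<open>T - w\<close> is
    multiplication by \<open>z - w\<close>; with this factor it maps \<open>s\<close> times the
    projection of \<open>v\<close> to \<open>\<tau> - z\<close> times that projection.\<close>
  define s where "s = of_real (\<tau> - z) / (of_real z - w)"
  have s: "(of_real z - w) * s = of_real (\<tau> - z)" using w by (simp add: s_def)
  show ?thesis
  proof (intro exI[of _ "(1 + cmod s) / d"] allI)
    fix g :: "'a \<times> 'a"
    obtain v where v: "A v = g" using coercive_surj[OF A d co] by blast
    have "d * (norm v)\<^sup>2 \<le> norm g * norm v"
      using co[of v] norm_cauchy_schwarz[of g v] by (simp add: v)
    then have vg: "norm v \<le> norm g / d"
      using d by (cases "v = 0") (auto simp: field_simps power2_eq_square)
    define n where "n = map_prod P P v"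
    define h where "h = cmul s n"
    have TPx: "T (P x) = z *\<^sub>R P x" for x unfolding P_def by (rule TP)
    have Th: "map_prod T T h = z *\<^sub>R h"
      by (cases v) (simp add: h_def n_def cmul_def T.add T.diff T.scaleR TPx algebra_simps)
    have zr: "z *\<^sub>R x = cmul (of_real z) x" for x :: "'a \<times> 'a" by (cases x) (simp add: cmul_def)
    have "map_prod T T h - cmul w h = cmul (of_real z - w) h"
      unfolding Th by (cases h) (simp add: cmul_def algebra_simps)
    also have "\<dots> = cmul (of_real (\<tau> - z)) n" by (simp add: h_def cmul_cmul s)
    also have "\<dots> = (\<tau> - z) *\<^sub>R n" by (cases n) (simp add: cmul_def)
    finally have h: "map_prod T T h - cmul w h = (\<tau> - z) *\<^sub>R n" .
    have "map_prod T T (v + h) - cmul w (v + h)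
        = (map_prod T T v - cmul w v) + (map_prod T T h - cmul w h)"
      by (cases v; cases h) (simp add: cmul_def T.add algebra_simps)
    also have "\<dots> = A v" unfolding h by (cases v) (simp add: A_def n_def T'_def algebra_simps)
    finally have eq: "map_prod T T (v + h) - cmul w (v + h) = g" by (simp add: v)
    have nP: "norm (P x) \<le> norm x" for x
    proof (rule power2_le_imp_le)
      have "(norm x)\<^sup>2 = (norm (x - P x))\<^sup>2 + (norm (P x))\<^sup>2"
        using P_decomp[of x] by (simp add: power2_norm_eq_inner inner_simps inner_commute)
      then show "(norm (P x))\<^sup>2 \<le> (norm x)\<^sup>2" by simp
    qed simp
    have "norm n \<le> norm v"
      using nP by (cases v) (auto simp: n_def norm_Pair intro!: add_mono power_mono)
    then have "norm h \<le> cmod s * norm v" by (simp add: h_def norm_cmul mult_left_mono)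
    then have "norm (v + h) \<le> norm v + cmod s * norm v" using norm_triangle_ineq[of v h] by linarith
    also have "\<dots> = (1 + cmod s) * norm v" by (simp add: algebra_simps)
    also have "\<dots> \<le> (1 + cmod s) * (norm g / d)" by (intro mult_left_mono vg) simp
    finally have "norm (v + h) \<le> (1 + cmod s) / d * norm g" by simp
    then show "\<exists>v. map_prod T T v - cmul w v = g \<and> norm v \<le> (1 + cmod s) / d * norm g"
      using eq by blast
  qed
qed

end

section \<open>Lebesgue measure on the torus\<close>

abbreviation tset :: "(real ^ 3) set" where
  "tset \<equiv> {p. \<forall>i. - pi < p $ i \<and> p $ i \<le> pi}"

lemma tset_borel [measurable]: "tset \<in> sets borel"
  by measurable

lemma space_torus3: "space torus3 = tset"
  by (simp add: torus3_def space_restrict_space)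

lemma sets_torus3: "A \<in> sets torus3 \<longleftrightarrow> A \<subseteq> tset \<and> A \<in> sets borel"
  unfolding torus3_def by (subst sets_restrict_space_iff) (auto)

lemma measurable_torus3: "f \<in> borel_measurable borel \<Longrightarrow> f \<in> borel_measurable torus3"
  unfolding torus3_def by (rule measurable_restrict_space1) simp

lemma measurable_torus3_nth [measurable]: "(\<lambda>p. p $ i) \<in> borel_measurable torus3"
  by (rule measurable_torus3) measurable

lemma measurable_fst_nth [measurable]: "(\<lambda>x. fst x $ i) \<in> borel_measurable torus3_sq"
  by (rule measurable_compose[OF measurable_fst measurable_torus3_nth])

lemma measurable_snd_nth [measurable]: "(\<lambda>x. snd x $ i) \<in> borel_measurable torus3_sq"
  by (rule measurable_compose[OF measurable_snd measurable_torus3_nth])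

lemma measurable_eps [measurable]: "eps \<in> borel_measurable torus3"
  unfolding eps_def[abs_def] by measurable

lemma nn_integral_torus3:
  assumes "f \<in> borel_measurable borel"
  shows "(\<integral>\<^sup>+p. f p \<partial>torus3) = (\<integral>\<^sup>+p. f p * indicator tset p \<partial>lborel)"
  unfolding torus3_def by (subst nn_integral_restrict_space) auto

lemma Basis_prod_real3:
  fixes g :: "(real ^ 3) \<Rightarrow> 'b::comm_monoid_mult"
  shows "(\<Prod>b\<in>Basis. g b) = (\<Prod>i\<in>UNIV. g (axis i 1))"
proof -
  have "Basis = range (\<lambda>i. axis i 1 :: real ^ 3)" by (auto simp: Basis_vec_def)
  moreover have "inj (\<lambda>i. axis i 1 :: real ^ 3)" by (auto simp: inj_on_def axis_eq_axis)
  ultimately show ?thesis using prod.reindex[of "\<lambda>i. axis i 1 :: real ^ 3" UNIV g] by (simp only: o_def)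
qed

text \<open>Tonelli's theorem over the coordinates. The values in \<open>ennreal\<close> allow its
  use for proving integrability, as for \<open>1 / eps\<close>.\<close>

lemma nn_integral_torus3_prod:
  fixes g :: "3 \<Rightarrow> real \<Rightarrow> ennreal"
  assumes [measurable]: "\<And>i. g i \<in> borel_measurable borel"
  shows "(\<integral>\<^sup>+p. (\<Prod>i\<in>UNIV. g i (p $ i)) \<partial>torus3)
    = (\<Prod>i\<in>UNIV. \<integral>\<^sup>+x. g i x * indicator {- pi<..pi} x \<partial>lborel)"
proof -
  define h where "h = (\<lambda>i x. g i x * indicator {- pi<..pi} x)"
  define ax where "ax = (\<lambda>b. SOME i. b = (axis i 1 :: real ^ 3))"
  have ax: "ax (axis i 1) = i" for i by (simp add: ax_def axis_eq_axis)
  have ind: "(\<Prod>i\<in>UNIV. indicator {- pi<..pi} (p $ i)) = (indicator tset p :: ennreal)" for p :: "real ^ 3"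
  proof (cases "p \<in> tset")
    case True
    then have "(indicator {- pi<..pi} (p $ i) :: ennreal) = 1" for i by simp
    then show ?thesis using True by simp
  next
    case False
    then obtain i where "p $ i \<notin> {- pi<..pi}" by auto
    then have "(indicator {- pi<..pi} (p $ i) :: ennreal) = 0" by simp
    then have "(\<Prod>i\<in>UNIV. indicator {- pi<..pi} (p $ i)) = (0 :: ennreal)" by (intro prod_zero) auto
    then show ?thesis using False by simp
  qed
  have "(\<integral>\<^sup>+p. (\<Prod>i\<in>UNIV. g i (p $ i)) \<partial>torus3) = (\<integral>\<^sup>+p. (\<Prod>i\<in>UNIV. h i (p $ i)) \<partial>lborel)"
    by (subst nn_integral_torus3) (auto simp: h_def prod.distrib ind intro!: borel_measurable_prod_ennreal)
  also have "\<dots> = (\<integral>\<^sup>+p. (\<Prod>b\<in>Basis. h (ax b) (p \<bullet> b)) \<partial>lborel)"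
    by (simp add: Basis_prod_real3 ax inner_axis)
  also have "\<dots> = (\<Prod>b\<in>Basis. \<integral>\<^sup>+x. h (ax b) x \<partial>lborel)"
    by (rule nn_integral_lborel_prod) (auto simp: h_def)
  finally show ?thesis by (simp add: Basis_prod_real3 ax h_def)
qed

lemma lborel_half_open: "(\<integral>\<^sup>+x. indicator {- pi<..pi} x \<partial>lborel) = ennreal (2 * pi)"
  by simp

lemma emeasure_torus3: "emeasure torus3 (space torus3) = ennreal ((2 * pi) ^ 3)"
proof -
  have "emeasure torus3 (space torus3) = (\<integral>\<^sup>+p. (\<Prod>i\<in>(UNIV::3 set). 1) \<partial>torus3)"
    by simp
  also have "\<dots> = (\<Prod>i\<in>(UNIV::3 set). ennreal (2 * pi))"
    using nn_integral_torus3_prod[of "\<lambda>_ _. 1"] by (simp only: lborel_half_open mult_1_left) simp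
  also have "\<dots> = ennreal (2 * pi) ^ 3" by simp
  also have "\<dots> = ennreal ((2 * pi) ^ 3)" by (rule ennreal_power) simp
  finally show ?thesis .
qed

global_interpretation torus3: finite_measure torus3
  by standard (simp add: emeasure_torus3)

global_interpretation torus3_pair: pair_sigma_finite torus3 torus3
  by standard

lemma measure_torus3: "measure torus3 (space torus3) = (2 * pi) ^ 3"
  by (simp add: measure_def emeasure_torus3)

lemma space_torus3_sq: "space torus3_sq = tset \<times> tset"
  by (simp add: space_pair_measure space_torus3)

lemma emeasure_torus3_sq: "emeasure torus3_sq (space torus3_sq) = ennreal ((2 * pi) ^ 6)"
proof -
  have "emeasure torus3_sq (space torus3_sq) = ennreal ((2 * pi) ^ 3) * ennreal ((2 * pi) ^ 3)"
    unfolding space_pair_measure by (subst torus3.emeasure_pair_measure_Times) (auto simp: emeasure_torus3)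
  also have "\<dots> = ennreal ((2 * pi) ^ 6)"
    by (subst ennreal_mult[symmetric]) (auto simp: power_add[symmetric])
  finally show ?thesis .
qed

global_interpretation torus3_sq: finite_measure torus3_sq
  by standard (simp add: emeasure_torus3_sq)

lemma measure_torus3_sq: "measure torus3_sq (space torus3_sq) = (2 * pi) ^ 6"
  by (simp add: measure_def emeasure_torus3_sq)

lemma integrable_torus3_bounded:
  fixes f :: "_ \<Rightarrow> real"
  assumes "f \<in> borel_measurable torus3" "\<And>p. p \<in> tset \<Longrightarrow> \<bar>f p\<bar> \<le> B"
  shows "integrable torus3 f"
  by (rule torus3.integrable_const_bound[where B = B]) (use assms in \<open>auto simp: space_torus3\<close>)

section \<open>Symmetries of the torus\<close>

lemma AE_torus3_interior: "AE p in torus3. \<forall>i. p $ i \<noteq> pi"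
proof -
  have "AE p in torus3. p $ i \<noteq> pi" for i
  proof -
    have "{p::real^3. p $ i = pi} \<in> null_sets lborel"
      using negligible_standard_hyperplane[of "axis i 1 :: real ^ 3" pi]
      by (subst null_sets_completion_iff[symmetric])
         (auto simp: negligible_iff_null_sets inner_axis axis_in_Basis_iff)
    then have "AE p in (lborel :: (real^3) measure). p $ i \<noteq> pi"
      by (rule AE_I') auto
    then show ?thesis unfolding torus3_def by (subst AE_restrict_space_iff) auto
  qed
  then show ?thesis by (simp add: AE_all_countable)
qed

lemma AE_torus3_nonzero: "AE p in torus3. p \<noteq> 0"
proof -
  have "AE p in (lborel :: (real^3) measure). p \<noteq> 0"
    by (rule AE_I'[of "{0}"]) (auto simp: null_sets_def)
  then show ?thesis unfolding torus3_def by (subst AE_restrict_space_iff) auto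
qed

definition mpres :: "((real ^ 3) \<Rightarrow> (real ^ 3)) \<Rightarrow> bool" where
  "mpres \<theta> \<longleftrightarrow> \<theta> \<in> torus3 \<rightarrow>\<^sub>M torus3 \<and> distr torus3 torus3 \<theta> = torus3"

text \<open>The value \<open>pi\<close> is kept fixed, so that the fundamental domain is preserved.\<close>

definition reflect :: "3 \<Rightarrow> real ^ 3 \<Rightarrow> real ^ 3" where
  "reflect j p = (\<chi> i. if i = j \<and> p $ i < pi then - p $ i else p $ i)"

definition permute_coords :: "(3 \<Rightarrow> 3) \<Rightarrow> real ^ 3 \<Rightarrow> real ^ 3" where
  "permute_coords \<sigma> p = (\<chi> i. p $ \<sigma> i)"

lemma reflect_nth: "reflect j p $ i = (if i = j \<and> p $ i < pi then - p $ i else p $ i)"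
  by (simp add: reflect_def)

lemma permute_coords_nth [simp]: "permute_coords \<sigma> p $ i = p $ \<sigma> i"
  by (simp add: permute_coords_def)

lemma measurable_vec_cart:
  fixes f :: "'a \<Rightarrow> real ^ 3"
  assumes "\<And>i. (\<lambda>x. f x $ i) \<in> borel_measurable M"
  shows "f \<in> borel_measurable M"
  by (subst borel_measurable_euclidean_space) (auto simp: Basis_vec_def inner_axis assms)

lemma measurable_into_torus3:
  assumes "\<And>i. (\<lambda>x. f x $ i) \<in> borel_measurable M" "\<And>x. x \<in> space M \<Longrightarrow> f x \<in> tset"
  shows "f \<in> M \<rightarrow>\<^sub>M torus3"
  unfolding torus3_def using assms
  by (intro measurable_restrict_space2) (auto intro!: measurable_vec_cart)

text \<open>Compares \<theta> with a measure-preserving map \<open>\<rho>\<close> of the whole space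
  that leaves the open cube invariant. The two may differ on the faces where a coordinate equals
  \<open>pi\<close>, which are null; this allows \<open>reflect\<close> to fix the value
  \<open>pi\<close>.\<close>

lemma mpresI:
  fixes \<rho> :: "real ^ 3 \<Rightarrow> real ^ 3"
  assumes \<theta>: "\<theta> \<in> torus3 \<rightarrow>\<^sub>M torus3"
    and \<rho>: "\<rho> \<in> borel_measurable borel" "distr lborel borel \<rho> = lborel"
    and eq: "\<And>p. p \<in> tset \<Longrightarrow> (\<forall>i. p $ i \<noteq> pi) \<Longrightarrow> \<theta> p = \<rho> p"
    and inv: "\<And>p. (\<forall>i. - pi < \<rho> p $ i \<and> \<rho> p $ i < pi) \<longleftrightarrow> (\<forall>i. - pi < p $ i \<and> p $ i < pi)"
  shows "mpres \<theta>"
proof -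
  define T0 where "T0 = {p :: real ^ 3. \<forall>i. - pi < p $ i \<and> p $ i < pi}"
  have T0 [measurable]: "T0 \<in> sets borel" unfolding T0_def by measurable
  have T0s: "T0 \<subseteq> tset" unfolding T0_def using less_imp_le by blast
  have em: "emeasure torus3 A = emeasure lborel (A \<inter> T0)" if A: "A \<in> sets torus3" for A
  proof -
    have A': "A \<subseteq> tset" "A \<in> sets borel" using A by (auto simp: sets_torus3)
    have "emeasure torus3 A = emeasure torus3 (A \<inter> T0)"
    proof (rule emeasure_eq_AE)
      show "AE p in torus3. (p \<in> A) = (p \<in> A \<inter> T0)"
        using AE_torus3_interior AE_space
      proof eventually_elim
        case (elim p)
        then show ?case by (force simp: T0_def space_torus3 order_less_le)
      qed
    qed (use A A' T0 T0s in \<open>auto simp: sets_torus3\<close>)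
    also have "\<dots> = emeasure lborel (A \<inter> T0)"
      unfolding torus3_def using A' by (subst emeasure_restrict_space) auto
    finally show ?thesis .
  qed
  have "distr torus3 torus3 \<theta> = torus3"
  proof (rule measure_eqI)
    fix A assume "A \<in> sets (distr torus3 torus3 \<theta>)"
    then have A: "A \<in> sets torus3" by simp
    have A': "A \<subseteq> tset" "A \<in> sets borel" using A by (auto simp: sets_torus3)
    have "emeasure (distr torus3 torus3 \<theta>) A = emeasure torus3 (\<theta> -` A \<inter> space torus3)"
      by (rule emeasure_distr[OF \<theta> A])
    also have "\<dots> = emeasure lborel ((\<theta> -` A \<inter> space torus3) \<inter> T0)"
      by (rule em) (rule measurable_sets[OF \<theta> A])
    also have "(\<theta> -` A \<inter> space torus3) \<inter> T0 = \<rho> -` (A \<inter> T0) \<inter> space lborel"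
    proof -
      have "\<theta> p = \<rho> p" if "p \<in> T0" for p
      proof (rule eq)
        show "p \<in> tset" using that T0s by blast
        show "\<forall>i. p $ i \<noteq> pi" using that by (simp add: T0_def) (metis less_irrefl)
      qed
      moreover have "\<rho> p \<in> T0 \<longleftrightarrow> p \<in> T0" for p using inv by (simp add: T0_def)
      ultimately show ?thesis using T0s by (auto simp: space_torus3)
    qed
    also have "emeasure lborel \<dots> = emeasure (distr lborel borel \<rho>) (A \<inter> T0)"
      using \<rho> A' by (subst emeasure_distr) auto
    also have "\<dots> = emeasure torus3 A" using em[OF A] \<rho> by simp
    finally show "emeasure (distr torus3 torus3 \<theta>) A = emeasure torus3 A" .
  qed simp
  then show ?thesis using \<theta> by (simp add: mpres_def)
qed

lemma mpres_permute:
  assumes \<sigma>: "bij \<sigma>"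
  shows "mpres (permute_coords \<sigma>)"
proof (rule mpresI[where \<rho> = "permute_coords \<sigma>"])
  show "permute_coords \<sigma> \<in> torus3 \<rightarrow>\<^sub>M torus3"
    by (rule measurable_into_torus3) (auto simp: space_torus3)
  show m: "permute_coords \<sigma> \<in> borel_measurable borel"
    by (rule measurable_vec_cart) auto
  have all: "(\<forall>i. P (\<sigma> i)) \<longleftrightarrow> (\<forall>i. P i)" for P
  proof safe
    fix i assume *: "\<forall>i. P (\<sigma> i)"
    obtain k where "i = \<sigma> k" using bij_is_surj[OF \<sigma>] by (rule surjE)
    then show "P i" using * by simp
  qed simp
  show "(\<forall>i. - pi < permute_coords \<sigma> p $ i \<and> permute_coords \<sigma> p $ i < pi)
      \<longleftrightarrow> (\<forall>i. - pi < p $ i \<and> p $ i < pi)" for p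
    using all[of "\<lambda>i. - pi < p $ i \<and> p $ i < pi"] by simp
  show "distr lborel borel (permute_coords \<sigma>) = lborel"
  proof (rule lborel_eqI[symmetric])
    fix l u :: "real ^ 3" assume lu: "\<And>b. b \<in> Basis \<Longrightarrow> l \<bullet> b \<le> u \<bullet> b"
    have lu': "l $ i \<le> u $ i" for i using lu[of "axis i 1"] by (auto simp: inner_axis)
    define \<tau> where "\<tau> = inv \<sigma>"
    have \<tau>: "\<tau> (\<sigma> i) = i" "\<sigma> (\<tau> i) = i" for i
      using \<sigma> by (auto simp: \<tau>_def bij_is_inj bij_is_surj surj_f_inv_f)
    have pre: "permute_coords \<sigma> -` box l u = box (permute_coords \<tau> l) (permute_coords \<tau> u)"
      using all[of "\<lambda>i. l $ \<tau> i < x $ i \<and> x $ i < u $ \<tau> i" for x]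
      by (auto simp: mem_box_cart \<tau>)
    have "emeasure (distr lborel borel (permute_coords \<sigma>)) (box l u)
        = emeasure lborel (box (permute_coords \<tau> l) (permute_coords \<tau> u))"
      using m by (subst emeasure_distr) (auto simp: pre)
    also have "\<dots> = ennreal (\<Prod>b\<in>Basis. (permute_coords \<tau> u - permute_coords \<tau> l) \<bullet> b)"
      by (rule emeasure_lborel_box) (auto simp: Basis_vec_def inner_axis lu')
    also have "(\<Prod>b\<in>Basis. (permute_coords \<tau> u - permute_coords \<tau> l) \<bullet> b) = (\<Prod>i\<in>UNIV. (u - l) $ \<tau> i)"
      by (subst Basis_prod_real3) (simp add: inner_axis)
    also have "\<dots> = (\<Prod>i\<in>UNIV. (u - l) $ i)"
    proof -
      have "bij_betw \<tau> UNIV UNIV" using \<sigma> by (simp add: \<tau>_def bij_imp_bij_inv)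
      then show ?thesis by (rule prod.reindex_bij_betw)
    qed
    also have "\<dots> = (\<Prod>b\<in>Basis. (u - l) \<bullet> b)" by (subst Basis_prod_real3) (simp add: inner_axis)
    finally show "emeasure (distr lborel borel (permute_coords \<sigma>)) (box l u) = (\<Prod>b\<in>Basis. (u - l) \<bullet> b)" .
  qed simp
qed auto

lemma mpres_reflect: "mpres (reflect j)"
proof -
  define \<rho> :: "real ^ 3 \<Rightarrow> real ^ 3" where "\<rho> = (\<lambda>p. \<chi> i. if i = j then - p $ i else p $ i)"
  have \<rho>n: "\<rho> p $ i = (if i = j then - p $ i else p $ i)" for p i by (simp add: \<rho>_def)
  show ?thesis
  proof (rule mpresI[where \<rho> = \<rho>])
    show "reflect j \<in> torus3 \<rightarrow>\<^sub>M torus3"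
    proof (rule measurable_into_torus3)
      show "reflect j p \<in> tset" if "p \<in> space torus3" for p
        using that by (simp add: space_torus3 reflect_nth) (smt (verit))
    qed (auto simp: reflect_nth)
    show m: "\<rho> \<in> borel_measurable borel"
      by (rule measurable_vec_cart) (auto simp: \<rho>n)
    show "reflect j p = \<rho> p" if "p \<in> tset" "\<forall>i. p $ i \<noteq> pi" for p
      using that by (auto simp: vec_eq_iff reflect_nth \<rho>n order_less_le)
    show "(\<forall>i. - pi < \<rho> p $ i \<and> \<rho> p $ i < pi) \<longleftrightarrow> (\<forall>i. - pi < p $ i \<and> p $ i < pi)" for p
      unfolding \<rho>n by (rule iff_allI) auto
    show "distr lborel borel \<rho> = lborel"
    proof (rule lborel_eqI[symmetric])
      fix l u :: "real ^ 3" assume lu: "\<And>b. b \<in> Basis \<Longrightarrow> l \<bullet> b \<le> u \<bullet> b"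
      have lu': "l $ i \<le> u $ i" for i using lu[of "axis i 1"] by (auto simp: inner_axis)
      \<comment> \<open>The reflection exchanges and negates the two bounds in direction
        \<open>j\<close>, so all side lengths are unchanged.\<close>
      define l' u' where "l' = (\<chi> i. if i = j then - u $ i else l $ i)"
        and "u' = (\<chi> i. if i = j then - l $ i else u $ i)"
      have pre: "\<rho> -` box l u = box l' u'"
        by (auto simp: mem_box_cart \<rho>n l'_def u'_def split: if_splits) (smt (verit))+
      have "emeasure (distr lborel borel \<rho>) (box l u) = emeasure lborel (box l' u')"
        using m by (subst emeasure_distr) (auto simp: pre)
      also have "\<dots> = ennreal (\<Prod>b\<in>Basis. (u' - l') \<bullet> b)"
        by (rule emeasure_lborel_box) (auto simp: Basis_vec_def inner_axis lu' l'_def u'_def)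
      also have "(\<Prod>b\<in>Basis. (u' - l') \<bullet> b) = (\<Prod>b\<in>Basis. (u - l) \<bullet> b)"
        unfolding Basis_prod_real3 by (rule prod.cong) (auto simp: inner_axis l'_def u'_def)
      finally show "emeasure (distr lborel borel \<rho>) (box l u) = (\<Prod>b\<in>Basis. (u - l) \<bullet> b)" .
    qed simp
  qed
qed

lemma mpres_integral:
  fixes f :: "real ^ 3 \<Rightarrow> real"
  assumes "mpres \<theta>" "f \<in> borel_measurable torus3"
  shows "(\<integral>p. f (\<theta> p) \<partial>torus3) = (\<integral>p. f p \<partial>torus3)"
  using integral_distr[of \<theta> torus3 torus3 f] assms by (simp add: mpres_def)

definition both :: "(real ^ 3 \<Rightarrow> real ^ 3) \<Rightarrow> (real ^ 3) \<times> (real ^ 3) \<Rightarrow> (real ^ 3) \<times> (real ^ 3)" where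
  "both \<theta> x = (\<theta> (fst x), \<theta> (snd x))"

lemma mpres_both:
  assumes "mpres \<theta>"
  shows "both \<theta> \<in> torus3_sq \<rightarrow>\<^sub>M torus3_sq" "distr torus3_sq torus3_sq (both \<theta>) = torus3_sq"
proof -
  have \<theta> [measurable]: "\<theta> \<in> torus3 \<rightarrow>\<^sub>M torus3" and d: "distr torus3 torus3 \<theta> = torus3"
    using assms by (auto simp: mpres_def)
  show "both \<theta> \<in> torus3_sq \<rightarrow>\<^sub>M torus3_sq" unfolding both_def by measurable
  have "distr torus3 torus3 \<theta> \<Otimes>\<^sub>M distr torus3 torus3 \<theta>
      = distr torus3_sq torus3_sq (\<lambda>(x, y). (\<theta> x, \<theta> y))"
    by (rule pair_measure_distr[OF \<theta> \<theta>]) (simp add: d torus3.sigma_finite_measure_axioms)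
  then show "distr torus3_sq torus3_sq (both \<theta>) = torus3_sq"
    by (simp add: d both_def[abs_def] case_prod_beta')
qed

lemma mpres_AE:
  assumes "mpres \<theta>" "AE x in torus3_sq. Q x"
  shows "AE x in torus3_sq. Q (both \<theta> x)"
proof -
  have "AE x in distr torus3_sq torus3_sq (both \<theta>). Q x" by (subst mpres_both(2)[OF assms(1)]) (rule assms(2))
  then show ?thesis by (rule AE_distrD[OF mpres_both(1)[OF assms(1)]])
qed

section \<open>Integrals of trigonometric functions\<close>

text \<open>The product formula is for nonnegative factors, so \<open>1 + cos\<close> is integrated
  in place of \<open>cos\<close>; over a period it has the same integral as the constant 1.\<close>

lemma integral_cos_torus3: "(\<integral>p. cos (p $ i) \<partial>torus3) = 0"
proof -
  have ico: "integrable torus3 (\<lambda>p. cos (p $ i))"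
    by (rule integrable_torus3_bounded[of _ 1]) auto
  define g where "g = (\<lambda>j x. if j = i then ennreal (1 + cos x) else 1)"
  have one: "(\<integral>\<^sup>+x. ennreal (1 + cos x) * indicator {- pi<..pi} x \<partial>lborel) = ennreal (2 * pi)"
  proof -
    have hi: "((\<lambda>x. 1 + cos x) has_integral ((pi + sin pi) - (- pi + sin (- pi)))) {- pi..pi}"
      by (rule fundamental_theorem_of_calculus)
         (auto intro!: derivative_eq_intros simp: has_real_derivative_iff_has_vector_derivative[symmetric])
    have c0: "0 \<le> 1 + cos x" for x :: real using cos_ge_minus_one[of x] by linarith
    have "(\<integral>\<^sup>+x. indicator {- pi..pi} x * ennreal (1 + cos x) \<partial>lborel)
        = (\<integral>\<^sup>+x. ennreal (indicator {- pi..pi} x * (1 + cos x)) \<partial>lborel)"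
      by (rule nn_integral_cong) (auto simp: indicator_def)
    also have "\<dots> = ennreal (2 * pi)"
      using nn_integral_has_integral_lebesgue[OF c0 hi] by simp
    finally have "(\<integral>\<^sup>+x. indicator {- pi..pi} x * ennreal (1 + cos x) \<partial>lborel) = ennreal (2 * pi)" .
    moreover have "(\<integral>\<^sup>+x. ennreal (1 + cos x) * indicator {- pi<..pi} x \<partial>lborel)
       = (\<integral>\<^sup>+x. indicator {- pi..pi} x * ennreal (1 + cos x) \<partial>lborel)"
      by (rule nn_integral_cong_AE, rule AE_I'[of "{- pi}"]) (auto simp: indicator_def split: if_splits)
    ultimately show ?thesis by simp
  qed
  have "(\<integral>\<^sup>+p. ennreal (1 + cos (p $ i)) \<partial>torus3) = (\<integral>\<^sup>+p. (\<Prod>j\<in>UNIV. g j (p $ j)) \<partial>torus3)"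
    by (simp add: g_def prod.delta)
  also have "\<dots> = (\<Prod>j\<in>UNIV. \<integral>\<^sup>+x. g j x * indicator {- pi<..pi} x \<partial>lborel)"
    by (rule nn_integral_torus3_prod) (auto simp: g_def)
  also have "\<dots> = (\<Prod>j\<in>(UNIV::3 set). ennreal (2 * pi))"
  proof (rule prod.cong)
    show "(\<integral>\<^sup>+x. g j x * indicator {- pi<..pi} x \<partial>lborel) = ennreal (2 * pi)" for j
      using one lborel_half_open by (cases "j = i") (simp_all add: g_def)
  qed simp
  also have "\<dots> = ennreal (2 * pi) ^ 3" by simp
  also have "\<dots> = ennreal ((2 * pi) ^ 3)" by (rule ennreal_power) simp
  finally have "(\<integral>\<^sup>+p. ennreal (1 + cos (p $ i)) \<partial>torus3) = ennreal ((2 * pi) ^ 3)" .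
  moreover have "0 \<le> 1 + cos x" for x :: real using cos_ge_minus_one[of x] by linarith
  ultimately have "(\<integral>p. 1 + cos (p $ i) \<partial>torus3) = (2 * pi) ^ 3"
    by (subst integral_eq_nn_integral) auto
  then show ?thesis using ico by (simp add: measure_torus3)
qed

lemma integral_odd_torus3:
  fixes f :: "real ^ 3 \<Rightarrow> real"
  assumes "f \<in> borel_measurable torus3" "\<And>p. p \<in> tset \<Longrightarrow> f (reflect j p) = - f p"
  shows "(\<integral>p. f p \<partial>torus3) = 0"
proof -
  have "(\<integral>p. f p \<partial>torus3) = (\<integral>p. f (reflect j p) \<partial>torus3)"
    by (rule mpres_integral[symmetric]) (auto simp: mpres_reflect assms)
  also have "\<dots> = (\<integral>p. - f p \<partial>torus3)"
    by (rule Bochner_Integration.integral_cong) (auto simp: assms space_torus3)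
  finally show ?thesis by simp
qed

section \<open>Bounds for the dispersion and integrability of its inverse\<close>

text \<open>With \<open>u = \<bar>x\<bar> / 4\<close>, doubling the angle twice gives
  \<open>1 - cos x = 8 * (sin u)^2 * (cos u)^2\<close>. As \<open>u \<le> pi / 4\<close>,
  \<open>cos\<close> is at least \<open>sqrt 2 / 2\<close> between 0 and \<open>u\<close>, and by
  the mean value theorem \<open>sin u\<close> is at least \<open>u\<close> times the same
  factor.\<close>

lemma one_minus_cos_ge:
  fixes x :: real
  assumes "\<bar>x\<bar> \<le> pi"
  shows "x\<^sup>2 / 8 \<le> 1 - cos x"
proof -
  define u where "u = \<bar>x\<bar> / 4"
  have u: "0 \<le> u" "u \<le> pi / 4" using assms by (auto simp: u_def)
  have cu: "sqrt 2 / 2 \<le> cos t" if "0 \<le> t" "t \<le> u" for t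
    unfolding cos_45[symmetric] using that u by (intro cos_monotone_0_pi_le) auto
  have "u * (sqrt 2 / 2) \<le> sin u"
  proof (cases "u = 0")
    case False
    then obtain t where "0 < t" "t < u" "sin u - sin 0 = (u - 0) * cos t"
      using MVT2[of 0 u sin cos] u by (auto intro!: derivative_eq_intros)
    then show ?thesis using cu[of t] u by (simp add: mult_left_mono)
  qed simp
  then have "(u * (sqrt 2 / 2))\<^sup>2 * (sqrt 2 / 2)\<^sup>2 \<le> (sin u)\<^sup>2 * (cos u)\<^sup>2"
    using u cu[of u] by (intro mult_mono power_mono) auto
  then have 1: "u\<^sup>2 / 4 \<le> (sin u)\<^sup>2 * (cos u)\<^sup>2" by (simp add: power_mult_distrib power_divide)
  have "cos x = cos (2 * (2 * u))" by (simp add: u_def)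
  also have "\<dots> = 1 - 2 * (2 * sin u * cos u)\<^sup>2"
    by (subst cos_double_sin) (simp add: sin_double)
  finally have "1 - cos x = 8 * ((sin u)\<^sup>2 * (cos u)\<^sup>2)" by (simp add: power_mult_distrib)
  moreover have "x\<^sup>2 = 16 * u\<^sup>2" by (simp add: u_def power_divide)
  ultimately show ?thesis using 1 by linarith
qed

lemma eps_nonneg: "0 \<le> eps p"
  unfolding eps_def by (rule sum_nonneg) simp

lemma eps_le: "eps p \<le> 6"
proof -
  have "eps p \<le> (\<Sum>i\<in>(UNIV::3 set). 2)" unfolding eps_def
  proof (rule sum_mono)
    show "1 - cos (p $ i) \<le> 2" for i using cos_ge_minus_one[of "p $ i"] by linarith
  qed
  then show ?thesis by simp
qed

lemma one_minus_cos_le_eps: "1 - cos (p $ i) \<le> eps p"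
  unfolding eps_def by (rule member_le_sum) auto

lemma eps_pos: "p \<in> tset \<Longrightarrow> p \<noteq> 0 \<Longrightarrow> 0 < eps p"
proof -
  assume p: "p \<in> tset" "p \<noteq> 0"
  then obtain i where i: "p $ i \<noteq> 0" by (auto simp: vec_eq_iff)
  have "- pi < p $ i \<and> p $ i \<le> pi" using p by blast
  then have "\<bar>p $ i\<bar> \<le> pi" by auto
  then have "(p $ i)\<^sup>2 / 8 \<le> eps p"
    using one_minus_cos_ge[of "p $ i"] one_minus_cos_le_eps[of p i] by linarith
  moreover have "0 < (p $ i)\<^sup>2" using i by simp
  ultimately show ?thesis by linarith
qed

lemma AE_eps_pos: "AE p in torus3. 0 < eps p"
  using AE_torus3_nonzero AE_space by eventually_elim (auto simp: eps_pos space_torus3)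

text \<open>\<open>1 / eps p\<close> is dominated by the product of the \<open>(1 - cos (p $ i)) powr (- 1 / 3)\<close>, because each
  \<open>1 - cos (p $ i)\<close> is at most \<open>eps p\<close>.\<close>

lemma integrable_inverse_eps: "integrable torus3 (\<lambda>p. 1 / eps p)"
proof (rule integrableI_bounded)
  \<comment> \<open>As \<open>0 powr (- 1 / 3)\<close> is \<open>0\<close>, the power alone would
    break the bound on the coordinate planes; the value \<open>top\<close> at \<open>0\<close>
    repairs this on a null set.\<close>
  define g where "g = (\<lambda>x::real. ennreal ((x\<^sup>2 / 8) powr (- 1 / 3)) + (if x = 0 then top else 0))"
  have g [measurable]: "g \<in> borel_measurable borel" unfolding g_def by measurable
  have dom: "ennreal (norm (1 / eps p)) \<le> (\<Prod>i\<in>UNIV. g (p $ i))" if p: "p \<in> tset" for p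
  proof (cases "\<exists>i. p $ i = 0")
    case True
    have "g x \<noteq> 0" for x by (simp add: g_def)
    then have "(\<Prod>i\<in>UNIV - {i}. g (p $ i)) \<noteq> 0" for i by simp
    moreover obtain i where "p $ i = 0" using True by blast
    then have "g (p $ i) = top" by (simp add: g_def)
    ultimately have "(\<Prod>i\<in>UNIV. g (p $ i)) = top"
      by (subst prod.remove[of _ i]) (auto simp: ennreal_top_mult)
    then show ?thesis by simp
  next
    case False
    then have nz: "p $ i \<noteq> 0" for i by blast
    have ep: "0 < eps p" using nz[of 1] by (intro eps_pos p) auto
    have "1 / eps p = eps p powr (- 1 / 3 + (- 1 / 3) + (- 1 / 3))"
      using ep by (simp add: powr_minus_divide)
    also have "\<dots> = (\<Prod>i\<in>(UNIV::3 set). eps p powr (- 1 / 3))"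
      unfolding powr_add by (simp add: power3_eq_cube)
    also have "\<dots> \<le> (\<Prod>i\<in>UNIV. ((p $ i)\<^sup>2 / 8) powr (- 1 / 3))"
    proof (rule prod_mono, intro conjI)
      fix i
      have "- pi < p $ i \<and> p $ i \<le> pi" using p by blast
      then have "(p $ i)\<^sup>2 / 8 \<le> eps p"
        using one_minus_cos_ge[of "p $ i"] one_minus_cos_le_eps[of p i] by linarith
      then show "eps p powr (- 1 / 3) \<le> ((p $ i)\<^sup>2 / 8) powr (- 1 / 3)"
        using nz by (intro powr_mono2') auto
    qed simp
    finally have "ennreal (1 / eps p) \<le> ennreal (\<Prod>i\<in>UNIV. ((p $ i)\<^sup>2 / 8) powr (- 1 / 3))"
      by (rule ennreal_leI)
    also have "\<dots> = (\<Prod>i\<in>UNIV. g (p $ i))" by (simp add: g_def nz prod_ennreal)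
    finally show ?thesis using ep by simp
  qed
  have half: "(\<integral>\<^sup>+x. indicator {0..pi} x * ennreal (x powr (- 2 / 3)) \<partial>lborel) = ennreal (3 * pi powr (1/3))"
  proof -
    have "(\<integral>\<^sup>+x. indicator {0..pi} x * ennreal (x powr (- 2 / 3)) \<partial>lborel)
        = (\<integral>\<^sup>+x. ennreal (indicator {0..pi} x * x powr (- 2 / 3)) \<partial>lborel)"
      by (rule nn_integral_cong) (auto simp: indicator_def)
    also have "\<dots> = ennreal (pi powr (- 2 / 3 + 1) / (- 2 / 3 + 1))"
      by (rule nn_integral_has_integral_lebesgue[OF _ has_integral_powr_from_0]) auto
    also have "pi powr (- 2 / 3 + 1) / (- 2 / 3 + 1) = 3 * pi powr (1 / 3)" by simp
    finally show ?thesis .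
  qed
  \<comment> \<open>The cube root of 8 gives the factor 2, and the remaining power
    \<open>- 2 / 3\<close> is integrable at \<open>0\<close>.\<close>
  have gx: "g x * indicator {- pi<..pi} x
     \<le> ennreal 2 * (indicator {0..pi} x * ennreal (x powr (- 2 / 3)) + indicator {0..pi} (- x) * ennreal ((- x) powr (- 2 / 3)))"
    if "x \<noteq> 0" for x
  proof -
    have "(x\<^sup>2 / 8) powr (- 1 / 3) = 2 * \<bar>x\<bar> powr (- 2 / 3)"
    proof -
      have "(x\<^sup>2 / 8) powr (- 1 / 3) = (\<bar>x\<bar>\<^sup>2) powr (- 1 / 3) / 8 powr (- 1 / 3)"
        by (simp add: powr_divide)
      also have "(\<bar>x\<bar>\<^sup>2) powr (- 1 / 3) = \<bar>x\<bar> powr (- 2 / 3)"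
      proof -
        have "\<bar>x\<bar> powr (- 2 / 3) = (\<bar>x\<bar> powr 2) powr (- 1 / 3)" by (simp only: powr_powr) simp
        also have "\<bar>x\<bar> powr 2 = \<bar>x\<bar>\<^sup>2" using that by (subst powr_numeral) auto
        finally show ?thesis by simp
      qed
      also have "(8::real) powr (- 1 / 3) = (2 powr 3) powr (- 1 / 3)" by simp
      also have "\<dots> = 1 / 2" unfolding powr_powr by (simp add: powr_minus_divide)
      finally show ?thesis by simp
    qed
    then show ?thesis using that
      by (auto simp: g_def indicator_def ennreal_mult')
  qed
  have ref: "(\<integral>\<^sup>+x. indicator {0..pi} (- x) * ennreal ((- x) powr (- 2 / 3)) \<partial>lborel)
     = (\<integral>\<^sup>+x. indicator {0..pi} x * ennreal (x powr (- 2 / 3)) \<partial>lborel)"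
    by (subst (2) nn_integral_real_affine[of _ "-1" 0]) auto
  have "(\<integral>\<^sup>+x. g x * indicator {- pi<..pi} x \<partial>lborel)
     \<le> (\<integral>\<^sup>+x. ennreal 2 * (indicator {0..pi} x * ennreal (x powr (- 2 / 3)) + indicator {0..pi} (- x) * ennreal ((- x) powr (- 2 / 3))) \<partial>lborel)"
  proof (rule nn_integral_mono_AE)
    show "AE x in lborel. g x * indicator {- pi<..pi} x
       \<le> ennreal 2 * (indicator {0..pi} x * ennreal (x powr (- 2 / 3)) + indicator {0..pi} (- x) * ennreal ((- x) powr (- 2 / 3)))"
      using AE_lborel_singleton[of "0 :: real"] by eventually_elim (rule gx)
  qed
  also have "\<dots> = ennreal 2 * ((\<integral>\<^sup>+x. indicator {0..pi} x * ennreal (x powr (- 2 / 3)) \<partial>lborel)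
      + (\<integral>\<^sup>+x. indicator {0..pi} (- x) * ennreal ((- x) powr (- 2 / 3)) \<partial>lborel))"
    by (simp add: nn_integral_cmult nn_integral_add distrib_left)
  also have "\<dots> = ennreal 2 * (ennreal (3 * pi powr (1/3)) + ennreal (3 * pi powr (1/3)))"
    by (simp only: ref half)
  also have "\<dots> < top" by (simp add: ennreal_mult_less_top)
  finally have fin: "(\<integral>\<^sup>+x. g x * indicator {- pi<..pi} x \<partial>lborel) < top" .
  have "(\<integral>\<^sup>+p. ennreal (norm (1 / eps p)) \<partial>torus3) \<le> (\<integral>\<^sup>+p. (\<Prod>i\<in>UNIV. g (p $ i)) \<partial>torus3)"
  proof (rule nn_integral_mono)
    show "ennreal (norm (1 / eps p)) \<le> (\<Prod>i\<in>UNIV. g (p $ i))" if "p \<in> space torus3" for p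
      by (rule dom) (use that in \<open>simp add: space_torus3\<close>)
  qed
  also have "\<dots> = (\<Prod>i\<in>(UNIV::3 set). \<integral>\<^sup>+x. g x * indicator {- pi<..pi} x \<partial>lborel)"
    by (rule nn_integral_torus3_prod) simp
  also have "\<dots> < \<infinity>" using fin by (simp add: power_less_top_ennreal)
  finally show "(\<integral>\<^sup>+p. ennreal (norm (1 / eps p)) \<partial>torus3) < \<infinity>" .
qed measurable

section \<open>Real square-integrable functions\<close>

definition rL2 :: "'a measure \<Rightarrow> ('a \<Rightarrow> real) set" where
  "rL2 M = {f \<in> borel_measurable M. integrable M (\<lambda>x. (f x)\<^sup>2)}"

lemma rL2_meas: "f \<in> rL2 M \<Longrightarrow> f \<in> borel_measurable M"
  and rL2_sq: "f \<in> rL2 M \<Longrightarrow> integrable M (\<lambda>x. (f x)\<^sup>2)"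
  by (auto simp: rL2_def)

lemma rL2_mult_integrable:
  assumes "f \<in> rL2 M" "g \<in> rL2 M"
  shows "integrable M (\<lambda>x. f x * g x)"
proof (rule Bochner_Integration.integrable_bound)
  show "integrable M (\<lambda>x. (f x)\<^sup>2 + (g x)\<^sup>2)" using assms by (auto simp: rL2_def)
  show "(\<lambda>x. f x * g x) \<in> borel_measurable M" using assms by (auto simp: rL2_def)
  show "AE x in M. norm (f x * g x) \<le> norm ((f x)\<^sup>2 + (g x)\<^sup>2)"
  proof (rule AE_I2)
    fix x
    have "2 * (\<bar>f x\<bar> * \<bar>g x\<bar>) \<le> \<bar>f x\<bar>\<^sup>2 + \<bar>g x\<bar>\<^sup>2"
      using sum_squares_bound[of "\<bar>f x\<bar>" "\<bar>g x\<bar>"] by simp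
    moreover have "0 \<le> \<bar>f x\<bar> * \<bar>g x\<bar>" "\<bar>(f x)\<^sup>2 + (g x)\<^sup>2\<bar> = \<bar>f x\<bar>\<^sup>2 + \<bar>g x\<bar>\<^sup>2" by simp_all
    ultimately show "norm (f x * g x) \<le> norm ((f x)\<^sup>2 + (g x)\<^sup>2)"
      unfolding real_norm_def abs_mult by linarith
  qed
qed

lemma rL2_zero: "(\<lambda>_. 0) \<in> rL2 M"
  by (simp add: rL2_def)

lemma rL2_add:
  assumes "f \<in> rL2 M" "g \<in> rL2 M"
  shows "(\<lambda>x. f x + g x) \<in> rL2 M"
proof -
  have "(\<lambda>x. (f x + g x)\<^sup>2) = (\<lambda>x. (f x)\<^sup>2 + (g x)\<^sup>2 + 2 * (f x * g x))"
    by (auto simp: power2_sum)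
  then show ?thesis using assms rL2_mult_integrable[OF assms] by (auto simp: rL2_def)
qed

lemma rL2_cmult: "f \<in> rL2 M \<Longrightarrow> (\<lambda>x. c * f x) \<in> rL2 M"
  by (auto simp: rL2_def power_mult_distrib)

lemma rL2_diff:
  assumes "f \<in> rL2 M" "g \<in> rL2 M"
  shows "(\<lambda>x. f x - g x) \<in> rL2 M"
  using rL2_add[OF assms(1) rL2_cmult[OF assms(2), of "-1"]] by simp

lemma rL2_bounded_mult:
  assumes f: "f \<in> rL2 M" and b: "b \<in> borel_measurable M" "\<And>x. x \<in> space M \<Longrightarrow> \<bar>b x\<bar> \<le> B"
  shows "(\<lambda>x. b x * f x) \<in> rL2 M"
proof -
  have "integrable M (\<lambda>x. (b x * f x)\<^sup>2)"
  proof (rule Bochner_Integration.integrable_bound)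
    show "integrable M (\<lambda>x. B\<^sup>2 * (f x)\<^sup>2)" using f by (auto simp: rL2_def)
    show "AE x in M. norm ((b x * f x)\<^sup>2) \<le> norm (B\<^sup>2 * (f x)\<^sup>2)"
    proof (rule AE_I2)
      fix x assume x: "x \<in> space M"
      have "\<bar>b x\<bar>\<^sup>2 \<le> B\<^sup>2" using b(2)[OF x] by (rule power_mono) simp
      then show "norm ((b x * f x)\<^sup>2) \<le> norm (B\<^sup>2 * (f x)\<^sup>2)"
        by (simp add: power_mult_distrib mult_right_mono)
    qed
  qed (use f b in \<open>auto simp: rL2_def\<close>)
  then show ?thesis using f b by (auto simp: rL2_def)
qed

lemma (in finite_measure) rL2_const: "(\<lambda>_. c) \<in> rL2 M"
  by (simp add: rL2_def)

lemma (in finite_measure) rL2_integrable: "f \<in> rL2 M \<Longrightarrow> integrable M f"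
  using rL2_mult_integrable[of f M "\<lambda>_. 1"] rL2_const[of 1] by simp

lemma (in finite_measure) rL2_bounded:
  "f \<in> borel_measurable M \<Longrightarrow> (\<And>x. x \<in> space M \<Longrightarrow> \<bar>f x\<bar> \<le> B) \<Longrightarrow> f \<in> rL2 M"
  using rL2_bounded_mult[OF rL2_const[of 1], of f B] by simp

lemma discriminant_le:
  fixes a b c :: real
  assumes "0 \<le> a" "\<And>t. 0 \<le> a * t\<^sup>2 + 2 * b * t + c"
  shows "b\<^sup>2 \<le> a * c"
proof (cases "a = 0")
  case True
  have "b = 0"
  proof (rule ccontr)
    assume "b \<noteq> 0"
    \<comment> \<open>At this \<open>t\<close> the affine function \<open>2 * b * t + c\<close> has
      the value \<open>- 1\<close>.\<close>
    then show False using assms(2)[of "- (c + 1) / (2 * b)"] True by simp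
  qed
  then show ?thesis using True by simp
next
  case False
  have "a * (- b / a)\<^sup>2 + 2 * b * (- b / a) + c = c - b\<^sup>2 / a"
    using False by (simp add: field_simps power2_eq_square)
  then have "b\<^sup>2 / a \<le> c" using assms(2)[of "- b / a"] by simp
  then show ?thesis using False assms(1) by (simp add: field_simps)
qed

lemma rL2_Cauchy_Schwarz:
  assumes f: "f \<in> rL2 M" and g: "g \<in> rL2 M"
  shows "(\<integral>x. f x * g x \<partial>M)\<^sup>2 \<le> (\<integral>x. (f x)\<^sup>2 \<partial>M) * (\<integral>x. (g x)\<^sup>2 \<partial>M)"
proof (rule discriminant_le)
  fix t :: real
  have "0 \<le> (\<integral>x. (t * f x + g x)\<^sup>2 \<partial>M)" by simp
  also have "(\<integral>x. (t * f x + g x)\<^sup>2 \<partial>M) = (\<integral>x. t\<^sup>2 * (f x)\<^sup>2 + 2 * t * (f x * g x) + (g x)\<^sup>2 \<partial>M)"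
    by (rule Bochner_Integration.integral_cong) (auto simp: power2_sum power_mult_distrib algebra_simps)
  also have "\<dots> = t\<^sup>2 * (\<integral>x. (f x)\<^sup>2 \<partial>M) + 2 * t * (\<integral>x. f x * g x \<partial>M) + (\<integral>x. (g x)\<^sup>2 \<partial>M)"
    using rL2_sq[OF f] rL2_sq[OF g] rL2_mult_integrable[OF f g] by simp
  finally show "0 \<le> (\<integral>x. (f x)\<^sup>2 \<partial>M) * t\<^sup>2 + 2 * (\<integral>x. f x * g x \<partial>M) * t + (\<integral>x. (g x)\<^sup>2 \<partial>M)"
    by (simp add: algebra_simps)
qed simp

section \<open>The Hilbert space of real antisymmetric functions\<close>

lemma measurable_swap: "prod.swap \<in> torus3_sq \<rightarrow>\<^sub>M torus3_sq"
  using measurable_pair_swap'[of torus3 torus3] by (simp add: prod.swap_def[abs_def] case_prod_beta')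

lemma distr_swap: "distr torus3_sq torus3_sq prod.swap = torus3_sq"
  using torus3_pair.distr_pair_swap by (simp add: prod.swap_def[abs_def] case_prod_beta')

lemma AE_swap:
  assumes "AE x in torus3_sq. Q x"
  shows "AE x in torus3_sq. Q (prod.swap x)"
proof -
  have "AE x in distr torus3_sq torus3_sq prod.swap. Q x" by (subst distr_swap) (rule assms)
  then show ?thesis by (rule AE_distrD[OF measurable_swap])
qed

lemma integral_swap:
  fixes f :: "_ \<Rightarrow> real"
  assumes "f \<in> borel_measurable torus3_sq"
  shows "(\<integral>x. f (prod.swap x) \<partial>torus3_sq) = (\<integral>x. f x \<partial>torus3_sq)"
  using integral_distr[OF measurable_swap assms] by (simp add: distr_swap)

definition antisym_fun :: "((real ^ 3) \<times> (real ^ 3) \<Rightarrow> real) set" where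
  "antisym_fun = {f \<in> rL2 torus3_sq. AE x in torus3_sq. f (prod.swap x) = - f x}"

definition asym_eq :: "((real ^ 3) \<times> (real ^ 3) \<Rightarrow> real) \<Rightarrow> _ \<Rightarrow> bool" where
  "asym_eq f g \<longleftrightarrow> f \<in> antisym_fun \<and> g \<in> antisym_fun \<and> (AE x in torus3_sq. f x = g x)"

lemma asym_rL2: "f \<in> antisym_fun \<Longrightarrow> f \<in> rL2 torus3_sq"
  by (simp add: antisym_fun_def)

lemma asym_zero: "(\<lambda>_. 0) \<in> antisym_fun"
  by (simp add: antisym_fun_def rL2_zero)

lemma asym_add:
  assumes "f \<in> antisym_fun" "g \<in> antisym_fun"
  shows "(\<lambda>x. f x + g x) \<in> antisym_fun"
proof -
  have "AE x in torus3_sq. f (prod.swap x) = - f x" "AE x in torus3_sq. g (prod.swap x) = - g x"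
    using assms by (auto simp: antisym_fun_def)
  then have "AE x in torus3_sq. f (prod.swap x) + g (prod.swap x) = - (f x + g x)"
    by eventually_elim simp
  then show ?thesis using assms by (simp add: antisym_fun_def rL2_add)
qed

lemma asym_cmult: "f \<in> antisym_fun \<Longrightarrow> (\<lambda>x. c * f x) \<in> antisym_fun"
  by (auto simp: antisym_fun_def rL2_cmult elim: eventually_mono)

\<comment> \<open>Real functions suffice because \<open>H\<close> has real coefficients. A type of
  classes makes the inner product and completeness classes of the abstract part available; the
  quotient is partial because only functions in \<open>antisym_fun\<close> represent
  elements.\<close>
quotient_type asym_L2 = "(real ^ 3) \<times> (real ^ 3) \<Rightarrow> real" / partial: asym_eq
proof (rule part_equivpI)
  show "\<exists>f. asym_eq f f" using asym_zero by (auto simp: asym_eq_def)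
  show "symp asym_eq" by (auto simp: asym_eq_def symp_def elim: eventually_mono)
  show "transp asym_eq"
  proof (rule transpI)
    fix f g h assume "asym_eq f g" "asym_eq g h"
    then have *: "f \<in> antisym_fun" "h \<in> antisym_fun" "AE x in torus3_sq. f x = g x" "AE x in torus3_sq. g x = h x"
      by (auto simp: asym_eq_def)
    from *(3,4) have "AE x in torus3_sq. f x = h x" by eventually_elim simp
    then show "asym_eq f h" using * by (simp add: asym_eq_def)
  qed
qed

abbreviation "cls \<equiv> abs_asym_L2"
abbreviation "rp \<equiv> rep_asym_L2"

lemma rp_asym [simp]: "rp a \<in> antisym_fun"
  using Quotient3_rep_reflp[OF Quotient3_asym_L2, of a] by (simp add: asym_eq_def)

lemma cls_rp [simp]: "cls (rp a) = a"
  by (rule Quotient3_abs_rep[OF Quotient3_asym_L2])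

lemma cls_eq_iff: "f \<in> antisym_fun \<Longrightarrow> g \<in> antisym_fun \<Longrightarrow> cls f = cls g \<longleftrightarrow> (AE x in torus3_sq. f x = g x)"
  using Quotient3_rel[OF Quotient3_asym_L2, of f g] by (simp add: asym_eq_def)

lemma rp_cls: "f \<in> antisym_fun \<Longrightarrow> AE x in torus3_sq. rp (cls f) x = f x"
  by (subst cls_eq_iff[symmetric]) auto

lemma rp_rL2 [simp]: "rp a \<in> rL2 torus3_sq"
  using asym_rL2 rp_asym by blast

lemma rp_meas [measurable]: "rp a \<in> borel_measurable torus3_sq"
  using rL2_meas rp_rL2 by blast

instantiation asym_L2 :: real_inner
begin

definition zero_asym_L2 :: asym_L2 where "0 = cls (\<lambda>_. 0)"
definition plus_asym_L2 :: "asym_L2 \<Rightarrow> asym_L2 \<Rightarrow> asym_L2" where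
  "a + b = cls (\<lambda>x. rp a x + rp b x)"
definition scaleR_asym_L2 :: "real \<Rightarrow> asym_L2 \<Rightarrow> asym_L2" where
  "scaleR c a = cls (\<lambda>x. c * rp a x)"
definition uminus_asym_L2 :: "asym_L2 \<Rightarrow> asym_L2" where "- a = (-1) *\<^sub>R (a :: asym_L2)"
definition minus_asym_L2 :: "asym_L2 \<Rightarrow> asym_L2 \<Rightarrow> asym_L2" where "a - b = a + (- b :: asym_L2)"
definition inner_asym_L2 :: "asym_L2 \<Rightarrow> asym_L2 \<Rightarrow> real" where
  "inner a b = (\<integral>x. rp a x * rp b x \<partial>torus3_sq)"
definition norm_asym_L2 :: "asym_L2 \<Rightarrow> real" where "norm a = sqrt (inner a (a :: asym_L2))"
definition dist_asym_L2 :: "asym_L2 \<Rightarrow> asym_L2 \<Rightarrow> real" where "dist a b = norm (a - b :: asym_L2)"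
definition sgn_asym_L2 :: "asym_L2 \<Rightarrow> asym_L2" where "sgn a = inverse (norm a) *\<^sub>R (a :: asym_L2)"
definition uniformity_asym_L2 :: "(asym_L2 \<times> asym_L2) filter" where
  "uniformity_asym_L2 = (INF e\<in>{0<..}. principal {(x, y). dist x (y :: asym_L2) < e})"
definition open_asym_L2 :: "asym_L2 set \<Rightarrow> bool" where
  "open_asym_L2 U \<longleftrightarrow> (\<forall>x\<in>U. \<forall>\<^sub>F (x', y) in uniformity. x' = x \<longrightarrow> y \<in> U)"

lemma cls_add: "f \<in> antisym_fun \<Longrightarrow> g \<in> antisym_fun \<Longrightarrow> cls f + cls g = cls (\<lambda>x. f x + g x)"
proof -
  assume fg: "f \<in> antisym_fun" "g \<in> antisym_fun"
  have "AE x in torus3_sq. rp (cls f) x + rp (cls g) x = f x + g x"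
    using rp_cls[OF fg(1)] rp_cls[OF fg(2)] by eventually_elim simp
  then show ?thesis unfolding plus_asym_L2_def
    by (subst cls_eq_iff) (auto intro!: asym_add fg)
qed

lemma cls_scaleR: "f \<in> antisym_fun \<Longrightarrow> c *\<^sub>R cls f = cls (\<lambda>x. c * f x)"
proof -
  assume f: "f \<in> antisym_fun"
  have "AE x in torus3_sq. c * rp (cls f) x = c * f x"
    using rp_cls[OF f] by eventually_elim simp
  then show ?thesis unfolding scaleR_asym_L2_def
    by (subst cls_eq_iff) (auto intro!: asym_cmult f)
qed

lemma cls_inner:
  assumes fg: "f \<in> antisym_fun" "g \<in> antisym_fun"
  shows "inner (cls f) (cls g) = (\<integral>x. f x * g x \<partial>torus3_sq)"
proof -
  have "AE x in torus3_sq. rp (cls f) x * rp (cls g) x = f x * g x"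
    using rp_cls[OF fg(1)] rp_cls[OF fg(2)] by eventually_elim simp
  then show ?thesis unfolding inner_asym_L2_def
    using fg[THEN asym_rL2, THEN rL2_meas] by (intro integral_cong_AE) auto
qed

instance
proof
  fix a b c :: asym_L2 and r s :: real
  define f g h where "f = rp a" and "g = rp b" and "h = rp c"
  have m: "f \<in> antisym_fun" "g \<in> antisym_fun" "h \<in> antisym_fun" by (auto simp: f_def g_def h_def)
  have e: "a = cls f" "b = cls g" "c = cls h" by (auto simp: f_def g_def h_def)
  have ab: "a + b = cls (\<lambda>x. f x + g x)" "(\<lambda>x. f x + g x) \<in> antisym_fun"
    and bc: "b + c = cls (\<lambda>x. g x + h x)" "(\<lambda>x. g x + h x) \<in> antisym_fun"
    using m by (auto simp only: e cls_add asym_add)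
  have ra: "r *\<^sub>R a = cls (\<lambda>x. r * f x)" "(\<lambda>x. r * f x) \<in> antisym_fun"
    and sa: "s *\<^sub>R a = cls (\<lambda>x. s * f x)" "(\<lambda>x. s * f x) \<in> antisym_fun"
    and rb: "r *\<^sub>R b = cls (\<lambda>x. r * g x)" "(\<lambda>x. r * g x) \<in> antisym_fun"
    using m by (auto simp only: e cls_scaleR asym_cmult)
  have "a + b + c = cls (\<lambda>x. f x + g x + h x)"
    unfolding ab(1) e(3) by (rule cls_add[OF ab(2) m(3)])
  moreover have "a + (b + c) = cls (\<lambda>x. f x + (g x + h x))"
    unfolding bc(1) e(1) by (rule cls_add[OF m(1) bc(2)])
  ultimately show "a + b + c = a + (b + c)" by (simp only: add.assoc)
  show "a + b = b + a"
    using cls_add[OF m(2,1)] by (simp only: ab(1) e(1,2)[symmetric] add.commute)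
  show "0 + a = a"
    using cls_add[OF asym_zero m(1)] by (simp add: e(1)[symmetric] zero_asym_L2_def[symmetric])
  show "- a + a = 0"
    using cls_scaleR[OF m(1), of "-1"] cls_add[OF asym_cmult[OF m(1), of "-1"] m(1)]
    by (simp add: e(1)[symmetric] zero_asym_L2_def uminus_asym_L2_def)
  show "a - b = a + - b" by (simp add: minus_asym_L2_def)
  show "r *\<^sub>R (a + b) = r *\<^sub>R a + r *\<^sub>R b"
    using cls_scaleR[OF ab(2), of r] cls_add[OF ra(2) rb(2)]
    by (simp only: ab(1) ra(1) rb(1) distrib_left)
  show "(r + s) *\<^sub>R a = r *\<^sub>R a + s *\<^sub>R a"
    using cls_scaleR[OF m(1), of "r + s"] cls_add[OF ra(2) sa(2)]
    by (simp only: ra(1) sa(1) e(1)[symmetric] distrib_right)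
  show "r *\<^sub>R s *\<^sub>R a = (r * s) *\<^sub>R a"
    using cls_scaleR[OF m(1), of "r * s"] cls_scaleR[OF sa(2), of r]
    by (simp only: sa(1) e(1)[symmetric] mult.assoc)
  show "1 *\<^sub>R a = a" using cls_scaleR[OF m(1), of 1] by (simp add: e(1)[symmetric])
  show "dist a b = norm (a - b)" by (simp add: dist_asym_L2_def)
  show "sgn a = inverse (norm a) *\<^sub>R a" by (simp add: sgn_asym_L2_def)
  show "uniformity = (INF e\<in>{0<..}. principal {(x, y). dist x (y :: asym_L2) < e})"
    by (simp add: uniformity_asym_L2_def)
  show "open U \<longleftrightarrow> (\<forall>x\<in>U. \<forall>\<^sub>F (x', y) in uniformity. x' = x \<longrightarrow> y \<in> U)" for U :: "asym_L2 set"
    by (simp add: open_asym_L2_def)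
  show "inner a b = inner b a" by (simp add: inner_asym_L2_def mult.commute)
  have int: "integrable torus3_sq (\<lambda>x. k x * l x)" if "k \<in> antisym_fun" "l \<in> antisym_fun" for k l
    by (rule rL2_mult_integrable) (auto intro: asym_rL2 that)
  show "inner (a + b) c = inner a c + inner b c"
    using cls_inner[OF ab(2) m(3)] cls_inner[OF m(1) m(3)] cls_inner[OF m(2) m(3)] int[OF m(1,3)] int[OF m(2,3)]
    by (simp only: ab(1)[symmetric] e[symmetric] distrib_right Bochner_Integration.integral_add)
  show "inner (r *\<^sub>R a) b = r * inner a b"
    using cls_inner[OF ra(2) m(2)] cls_inner[OF m(1,2)]
    by (simp only: ra(1)[symmetric] e[symmetric] mult.assoc integral_mult_right_zero)
  show "0 \<le> inner a a" by (simp add: inner_asym_L2_def)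
  show "inner a a = 0 \<longleftrightarrow> a = 0"
  proof -
    have "inner a a = 0 \<longleftrightarrow> (AE x in torus3_sq. f x * f x = 0)"
      unfolding inner_asym_L2_def f_def[symmetric]
      using int[OF m(1,1)] by (intro integral_nonneg_eq_0_iff_AE) auto
    also have "\<dots> \<longleftrightarrow> a = 0" unfolding e(1) zero_asym_L2_def by (simp add: cls_eq_iff m asym_zero)
    finally show ?thesis .
  qed
  show "norm a = sqrt (inner a a)" by (simp add: norm_asym_L2_def)
qed

end

lemma cls_diff:
  assumes fg: "f \<in> antisym_fun" "g \<in> antisym_fun"
  shows "cls f - cls g = cls (\<lambda>x. f x - g x)"
proof -
  have "- cls g = cls (\<lambda>x. (-1) * g x)" using cls_scaleR[OF fg(2), of "-1"] by simp
  then have "cls f - cls g = cls f + cls (\<lambda>x. (-1) * g x)" by (simp only: diff_conv_add_uminus)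
  also have "\<dots> = cls (\<lambda>x. f x + (-1) * g x)" by (rule cls_add[OF fg(1) asym_cmult[OF fg(2)]])
  finally show ?thesis by simp
qed

lemma cls_norm: "f \<in> antisym_fun \<Longrightarrow> (norm (cls f))\<^sup>2 = (\<integral>x. (f x)\<^sup>2 \<partial>torus3_sq)"
  by (simp add: power2_norm_eq_inner cls_inner) (simp add: power2_eq_square)

lemma asym_diff: "f \<in> antisym_fun \<Longrightarrow> g \<in> antisym_fun \<Longrightarrow> (\<lambda>x. f x - g x) \<in> antisym_fun"
  using asym_add[of f "\<lambda>x. (-1) * g x"] asym_cmult[of g "-1"] by simp

lemma norm_diff_rp: "(norm (a - b))\<^sup>2 = (\<integral>x. (rp a x - rp b x)\<^sup>2 \<partial>torus3_sq)"
  using cls_norm[OF asym_diff[OF rp_asym rp_asym, of a b]] cls_diff[OF rp_asym rp_asym, of a b] by simp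

text \<open>The Riesz-Fischer argument: on a finite measure space the L2 norm controls the L1 norm,
  so the integrals of the absolute increments are summable, and hence the increments are summable
  almost everywhere.\<close>

lemma asym_AE_summable:
  fixes Y :: "nat \<Rightarrow> asym_L2"
  assumes "\<And>n. norm (Y (Suc n) - Y n) \<le> (1/2) ^ n"
  shows "AE x in torus3_sq. convergent (\<lambda>n. rp (Y n) x)"
proof -
  define h where "h = (\<lambda>n x. \<bar>rp (Y (Suc n)) x - rp (Y n) x\<bar>)"
  \<comment> \<open>The square root of the total mass is the constant between the L1 and the L2
    norm.\<close>
  define C where "C = sqrt ((2 * pi) ^ 6)"
  have dm: "(\<lambda>x. rp (Y (Suc n)) x - rp (Y n) x) \<in> antisym_fun" for n by (intro asym_diff) auto
  have hm [measurable]: "h n \<in> borel_measurable torus3_sq" for n unfolding h_def by measurable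
  have hL: "h n \<in> rL2 torus3_sq" for n
    using asym_rL2[OF dm[of n]] by (simp add: rL2_def h_def)
  have hi: "(\<integral>\<^sup>+x. ennreal (h n x) \<partial>torus3_sq) \<le> ennreal (C * (1/2) ^ n)" for n
  proof -
    have "(\<integral>x. (h n x)\<^sup>2 \<partial>torus3_sq) = (norm (Y (Suc n) - Y n))\<^sup>2"
      by (simp add: norm_diff_rp h_def)
    also have "\<dots> \<le> ((1/2) ^ n)\<^sup>2" by (intro power_mono assms) simp
    finally have sq: "(\<integral>x. (h n x)\<^sup>2 \<partial>torus3_sq) \<le> ((1/2) ^ n)\<^sup>2" .
    have "(\<integral>x. 1 * h n x \<partial>torus3_sq)\<^sup>2 \<le> (\<integral>x. 1\<^sup>2 \<partial>torus3_sq) * (\<integral>x. (h n x)\<^sup>2 \<partial>torus3_sq)"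
      by (rule rL2_Cauchy_Schwarz[OF torus3_sq.rL2_const hL])
    also have "\<dots> \<le> (2 * pi) ^ 6 * ((1/2) ^ n)\<^sup>2"
      using sq by (simp add: measure_torus3_sq mult_left_mono)
    also have "\<dots> = (C * (1/2) ^ n)\<^sup>2" by (simp add: C_def power_mult_distrib)
    finally have "(\<integral>x. h n x \<partial>torus3_sq)\<^sup>2 \<le> (C * (1/2) ^ n)\<^sup>2"
      by (simp only: mult_1_left)
    then have "(\<integral>x. h n x \<partial>torus3_sq) \<le> C * (1/2) ^ n"
      by (rule power2_le_imp_le) (auto simp: C_def)
    then show ?thesis
      using torus3_sq.rL2_integrable[OF hL[of n]]
      by (subst nn_integral_eq_integral) (auto simp: h_def ennreal_leI)
  qed
  have "(\<integral>\<^sup>+x. (\<Sum>n. ennreal (h n x)) \<partial>torus3_sq) = (\<Sum>n. \<integral>\<^sup>+x. ennreal (h n x) \<partial>torus3_sq)"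
    by (rule nn_integral_suminf) measurable
  also have "\<dots> \<le> (\<Sum>n. ennreal (C * (1/2) ^ n))" by (intro suminf_le hi) auto
  also have "\<dots> = ennreal (\<Sum>n. C * (1/2) ^ n)"
    by (rule suminf_ennreal2) (auto simp: C_def intro!: summable_mult)
  finally have "(\<integral>\<^sup>+x. (\<Sum>n. ennreal (h n x)) \<partial>torus3_sq) \<noteq> \<infinity>"
    by (auto simp: top_unique)
  then have "AE x in torus3_sq. (\<Sum>n. ennreal (h n x)) \<noteq> \<infinity>"
    by (intro nn_integral_PInf_AE) measurable
  then show ?thesis
  proof eventually_elim
    case (elim x)
    have "summable (\<lambda>n. h n x)"
      by (rule summable_suminf_not_top) (use elim in \<open>auto simp: h_def\<close>)
    then have "summable (\<lambda>n. rp (Y (Suc n)) x - rp (Y n) x)"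
      using summable_rabs_cancel[of "\<lambda>n. rp (Y (Suc n)) x - rp (Y n) x"] by (simp add: h_def)
    then have "convergent (\<lambda>n. \<Sum>i<n. rp (Y (Suc i)) x - rp (Y i) x)"
      by (simp add: summable_iff_convergent)
    also have "(\<lambda>n. \<Sum>i<n. rp (Y (Suc i)) x - rp (Y i) x) = (\<lambda>n. rp (Y n) x - rp (Y 0) x)"
      by (rule ext, rule sum_lessThan_telescope)
    finally have "convergent (\<lambda>n. (rp (Y n) x - rp (Y 0) x) + rp (Y 0) x)"
      by (rule convergent_add) (rule convergent_const)
    then show ?case by simp
  qed
qed

instance asym_L2 :: complete_space
proof
  fix X :: "nat \<Rightarrow> asym_L2" assume X: "Cauchy X"
  have "\<exists>N. \<forall>m\<ge>N. \<forall>n\<ge>N. norm (X m - X n) \<le> (1/2) ^ k" for k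
    using CauchyD[OF X, of "(1/2) ^ k"] by (force intro: less_imp_le)
  then obtain N where N: "\<And>k m n. m \<ge> N k \<Longrightarrow> n \<ge> N k \<Longrightarrow> norm (X m - X n) \<le> (1/2) ^ k"
    by metis
  \<comment> \<open>The maximum makes \<open>r\<close> monotone and at least \<open>N k\<close>, so
    that consecutive terms differ by at most \<open>(1/2) ^ k\<close>; the summand \<open>k\<close>
    makes \<open>r\<close> exceed any given index, as the use of Fatou's lemma requires.\<close>
  define r where "r = (\<lambda>k. Max (N ` {..k}) + k)"
  have rN: "r k \<ge> N k" "r k \<ge> k" for k
    using Max_ge[of "N ` {..k}" "N k"] by (auto simp: r_def trans_le_add1)
  have rS: "r k \<le> r (Suc k)" for k
    unfolding r_def by (intro add_mono Max_mono) auto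
  define f where "f = (\<lambda>x. lim (\<lambda>k. rp (X (r k)) x))"
  have fm [measurable]: "f \<in> borel_measurable torus3_sq"
    unfolding f_def by (rule borel_measurable_lim_metric) simp
  have "AE x in torus3_sq. convergent (\<lambda>k. rp (X (r k)) x)"
  proof (rule asym_AE_summable)
    show "norm (X (r (Suc k)) - X (r k)) \<le> (1/2) ^ k" for k
      using rN(1)[of k] rS[of k] by (intro N) auto
  qed
  then have lim: "AE x in torus3_sq. (\<lambda>k. rp (X (r k)) x) \<longlonglongrightarrow> f x"
    by (auto simp: f_def convergent_LIMSEQ_iff elim: eventually_mono)
  \<comment> \<open>Fatou's lemma upgrades convergence almost everywhere of the subsequence to a
    norm bound, which gives both square integrability of \<open>f\<close> and convergence of the
    whole sequence.\<close>
  have fatou: "(\<integral>\<^sup>+x. ennreal ((f x - rp (X n) x)\<^sup>2) \<partial>torus3_sq) \<le> ennreal (e\<^sup>2)"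
    if e: "\<And>i. i \<ge> M \<Longrightarrow> norm (X i - X n) \<le> e" for e M n
  proof -
    have ns: "(\<integral>\<^sup>+x. ennreal ((rp (X (r k)) x - rp (X n) x)\<^sup>2) \<partial>torus3_sq) = ennreal ((norm (X (r k) - X n))\<^sup>2)" for k
    proof -
      have d: "(\<lambda>x. rp (X (r k)) x - rp (X n) x) \<in> antisym_fun" by (intro asym_diff) auto
      have "(norm (X (r k) - X n))\<^sup>2 = (\<integral>x. (rp (X (r k)) x - rp (X n) x)\<^sup>2 \<partial>torus3_sq)"
        by (rule norm_diff_rp)
      then show ?thesis
        using rL2_sq[OF asym_rL2[OF d]] by (subst nn_integral_eq_integral) auto
    qed
    have "(\<integral>\<^sup>+x. ennreal ((f x - rp (X n) x)\<^sup>2) \<partial>torus3_sq)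
       = (\<integral>\<^sup>+x. liminf (\<lambda>k. ennreal ((rp (X (r k)) x - rp (X n) x)\<^sup>2)) \<partial>torus3_sq)"
    proof (rule nn_integral_cong_AE)
      show "AE x in torus3_sq. ennreal ((f x - rp (X n) x)\<^sup>2)
          = liminf (\<lambda>k. ennreal ((rp (X (r k)) x - rp (X n) x)\<^sup>2))"
        using lim
      proof eventually_elim
        case (elim x)
        have "(\<lambda>k. ennreal ((rp (X (r k)) x - rp (X n) x)\<^sup>2)) \<longlonglongrightarrow> ennreal ((f x - rp (X n) x)\<^sup>2)"
          by (intro tendsto_ennrealI tendsto_intros elim)
        then show ?case by (intro lim_imp_Liminf[symmetric]) auto
      qed
    qed
    also have "\<dots> \<le> liminf (\<lambda>k. \<integral>\<^sup>+x. ennreal ((rp (X (r k)) x - rp (X n) x)\<^sup>2) \<partial>torus3_sq)"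
      by (rule nn_integral_liminf) measurable
    also have "\<dots> \<le> ennreal (e\<^sup>2)"
    proof (rule Liminf_le)
      show "\<forall>\<^sub>F k in sequentially. (\<integral>\<^sup>+x. ennreal ((rp (X (r k)) x - rp (X n) x)\<^sup>2) \<partial>torus3_sq) \<le> ennreal (e\<^sup>2)"
        unfolding eventually_sequentially
      proof (intro exI allI impI)
        fix k assume "M \<le> k"
        then have "norm (X (r k) - X n) \<le> e" using rN(2)[of k] by (intro e) simp
        then show "(\<integral>\<^sup>+x. ennreal ((rp (X (r k)) x - rp (X n) x)\<^sup>2) \<partial>torus3_sq) \<le> ennreal (e\<^sup>2)"
          unfolding ns by (intro ennreal_leI power_mono) auto
      qed
    qed simp
    finally show ?thesis .
  qed
  have dL: "(\<lambda>x. f x - rp (X n) x) \<in> rL2 torus3_sq"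
    if "\<And>i. i \<ge> M \<Longrightarrow> norm (X i - X n) \<le> e" for e M n
    using fatou[of M n e] that
    by (auto simp: rL2_def integrable_iff_bounded top_unique less_top[symmetric])
  have fa: "f \<in> antisym_fun"
  proof -
    have "(\<lambda>x. (f x - rp (X (N 0)) x) + rp (X (N 0)) x) \<in> rL2 torus3_sq"
      by (rule rL2_add[OF dL rp_rL2]) (rule N[of 0], auto)
    then have 1: "f \<in> rL2 torus3_sq" by simp
    have "AE x in torus3_sq. \<forall>k. rp (X (r k)) (prod.swap x) = - rp (X (r k)) x"
      unfolding AE_all_countable using rp_asym by (simp add: antisym_fun_def)
    then have "AE x in torus3_sq. f (prod.swap x) = - f x"
      using lim AE_swap[OF lim]
    proof eventually_elim
      case (elim x)
      have "(\<lambda>k. - rp (X (r k)) x) \<longlonglongrightarrow> f (prod.swap x)" using elim by simp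
      moreover have "(\<lambda>k. - rp (X (r k)) x) \<longlonglongrightarrow> - f x" by (intro tendsto_intros elim)
      ultimately show ?case by (rule LIMSEQ_unique)
    qed
    then show ?thesis using 1 by (simp add: antisym_fun_def)
  qed
  have "X \<longlonglongrightarrow> cls f"
  proof (rule metric_LIMSEQ_I)
    fix e :: real assume e: "e > 0"
    obtain M where M: "\<And>m n. m \<ge> M \<Longrightarrow> n \<ge> M \<Longrightarrow> norm (X m - X n) < e / 2"
      using CauchyD[OF X, of "e / 2"] e by auto
    show "\<exists>M. \<forall>n\<ge>M. dist (X n) (cls f) < e"
    proof (intro exI allI impI)
      fix n assume n: "M \<le> n"
      have b: "norm (X i - X n) \<le> e / 2" if "i \<ge> M" for i using M[OF that n] by simp
      have d: "(\<lambda>x. f x - rp (X n) x) \<in> antisym_fun" by (intro asym_diff fa) auto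
      have "(norm (cls f - X n))\<^sup>2 = (\<integral>x. (f x - rp (X n) x)\<^sup>2 \<partial>torus3_sq)"
        using cls_norm[OF d] cls_diff[OF fa rp_asym, of "X n"] by simp
      also have "ennreal \<dots> \<le> ennreal ((e / 2)\<^sup>2)"
        using fatou[of M n "e / 2", OF b] rL2_sq[OF asym_rL2[OF d]]
        by (subst nn_integral_eq_integral[symmetric]) auto
      finally have "(norm (cls f - X n))\<^sup>2 \<le> (e / 2)\<^sup>2" by simp
      then have "norm (cls f - X n) \<le> e / 2" by (rule power2_le_imp_le) (use e in simp)
      then show "dist (X n) (cls f) < e" using e by (simp add: dist_norm norm_minus_commute)
    qed
  qed
  then show "convergent X" by (rule convergentI)
qed

section \<open>Partial integration in one variable\<close>

text \<open>For antisymmetric \<open>f\<close>, integrating out the second variable gives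
  \<open>- marg f\<close>, so this one marginal describes both interaction terms of
  \<open>H\<close>.\<close>

definition marg :: "((real ^ 3) \<times> (real ^ 3) \<Rightarrow> real) \<Rightarrow> real ^ 3 \<Rightarrow> real" where
  "marg f q = (\<integral>s. f (s, q) \<partial>torus3)"

lemma measurable_comp_swap:
  "f \<in> borel_measurable torus3_sq \<Longrightarrow> (\<lambda>x. f (prod.swap x)) \<in> borel_measurable torus3_sq"
  by (rule measurable_compose[OF measurable_swap])

lemma integrable_comp_swap:
  fixes f :: "_ \<Rightarrow> real"
  shows "integrable torus3_sq f \<Longrightarrow> integrable torus3_sq (\<lambda>x. f (prod.swap x))"
  using torus3_pair.integrable_product_swap[of f] by (simp add: case_prod_beta' prod.swap_def)

lemma marg_meas [measurable]:
  assumes "f \<in> borel_measurable torus3_sq"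
  shows "marg f \<in> borel_measurable torus3"
  unfolding marg_def[abs_def]
  by (rule torus3.borel_measurable_lebesgue_integral)
     (use measurable_comp_swap[OF assms] in \<open>simp add: case_prod_beta' prod.swap_def\<close>)

lemma section_meas:
  assumes "f \<in> borel_measurable torus3_sq" "q \<in> tset"
  shows "(\<lambda>s. f (s, q)) \<in> borel_measurable torus3"
proof -
  have "(\<lambda>s. (s, q)) \<in> torus3 \<rightarrow>\<^sub>M torus3_sq"
    using assms(2) by (intro measurable_Pair measurable_const) (auto simp: space_torus3)
  then show ?thesis using assms(1) by (rule measurable_compose)
qed

lemma AE_sections:
  assumes "AE x in torus3_sq. Q x"
  shows "AE q in torus3. AE s in torus3. Q (s, q)"
  using torus3_pair.AE_pair[OF AE_swap[OF assms]] by simp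

lemma AE_integrable_sections:
  fixes f :: "_ \<Rightarrow> real"
  assumes "integrable torus3_sq f"
  shows "AE q in torus3. integrable torus3 (\<lambda>s. f (s, q))"
  using torus3_pair.AE_integrable_fst'[OF integrable_comp_swap[OF assms]] by simp

lemma integrable_marg:
  assumes "integrable torus3_sq f"
  shows "integrable torus3 (marg f)"
  using torus3_pair.integrable_fst'[OF integrable_comp_swap[OF assms]] by (simp add: marg_def[abs_def])

lemma integral_marg:
  assumes "integrable torus3_sq f"
  shows "(\<integral>q. marg f q \<partial>torus3) = (\<integral>x. f x \<partial>torus3_sq)"
  using torus3_pair.integral_fst'[OF integrable_comp_swap[OF assms]] integral_swap[of f] assms
  by (simp add: marg_def)

lemma marg_cong_AE:
  assumes "f \<in> borel_measurable torus3_sq" "g \<in> borel_measurable torus3_sq" "AE x in torus3_sq. f x = g x"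
  shows "AE q in torus3. marg f q = marg g q"
  using AE_sections[OF assms(3)] AE_space
proof eventually_elim
  case (elim q)
  then show ?case unfolding marg_def
    by (intro integral_cong_AE section_meas assms) (auto simp: space_torus3)
qed

lemma rL2_sections:
  assumes "f \<in> rL2 torus3_sq"
  shows "AE q in torus3. (\<lambda>s. f (s, q)) \<in> rL2 torus3"
  using AE_integrable_sections[OF rL2_sq[OF assms]] AE_space
  by eventually_elim (use rL2_meas[OF assms] in \<open>auto simp: rL2_def space_torus3 section_meas\<close>)

text \<open>Cauchy-Schwarz against the constant 1 on almost every section; the factor is the volume
  of the torus.\<close>

lemma marg_rL2:
  assumes f: "f \<in> rL2 torus3_sq"
  shows "marg f \<in> rL2 torus3"
    and "(\<integral>q. (marg f q)\<^sup>2 \<partial>torus3) \<le> (2 * pi) ^ 3 * (\<integral>x. (f x)\<^sup>2 \<partial>torus3_sq)"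
proof -
  have bd: "AE q in torus3. (marg f q)\<^sup>2 \<le> (2 * pi) ^ 3 * marg (\<lambda>x. (f x)\<^sup>2) q"
    using rL2_sections[OF f]
  proof eventually_elim
    case (elim q)
    show ?case
      using rL2_Cauchy_Schwarz[OF torus3.rL2_const[of 1] elim]
      by (simp add: marg_def measure_torus3)
  qed
  have i: "integrable torus3 (\<lambda>q. (2 * pi) ^ 3 * marg (\<lambda>x. (f x)\<^sup>2) q)"
    using integrable_marg[OF rL2_sq[OF f]] by simp
  have m: "marg f \<in> borel_measurable torus3" using rL2_meas[OF f] by simp
  have "integrable torus3 (\<lambda>q. (marg f q)\<^sup>2)"
    by (rule Bochner_Integration.integrable_bound[OF i]) (use bd m in auto)
  then show L: "marg f \<in> rL2 torus3" using m by (simp add: rL2_def)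
  have "(\<integral>q. (marg f q)\<^sup>2 \<partial>torus3) \<le> (\<integral>q. (2 * pi) ^ 3 * marg (\<lambda>x. (f x)\<^sup>2) q \<partial>torus3)"
    by (rule integral_mono_AE[OF rL2_sq[OF L] i bd])
  then show "(\<integral>q. (marg f q)\<^sup>2 \<partial>torus3) \<le> (2 * pi) ^ 3 * (\<integral>x. (f x)\<^sup>2 \<partial>torus3_sq)"
    by (simp add: integral_marg[OF rL2_sq[OF f]])
qed

lemma fst_integrable:
  assumes h: "integrable torus3 h"
  shows "integrable torus3_sq (\<lambda>x. h (fst x) :: real)"
    and "(\<integral>x. h (fst x) \<partial>torus3_sq) = (2 * pi) ^ 3 * (\<integral>p. h p \<partial>torus3)"
proof -
  have m: "(\<lambda>x. h (fst x)) \<in> borel_measurable torus3_sq"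
    using h by (intro measurable_compose[OF measurable_fst]) auto
  show i: "integrable torus3_sq (\<lambda>x. h (fst x))"
    by (rule torus3_pair.Fubini_integrable[OF m]) (use h in \<open>auto simp: measure_torus3\<close>)
  show "(\<integral>x. h (fst x) \<partial>torus3_sq) = (2 * pi) ^ 3 * (\<integral>p. h p \<partial>torus3)"
    using torus3_pair.integral_fst'[OF i] by (simp add: measure_torus3)
qed

lemma snd_integrable:
  assumes h: "integrable torus3 h"
  shows "integrable torus3_sq (\<lambda>x. h (snd x) :: real)"
    and "(\<integral>x. h (snd x) \<partial>torus3_sq) = (2 * pi) ^ 3 * (\<integral>p. h p \<partial>torus3)"
  using integrable_comp_swap[OF fst_integrable(1)[OF h]] fst_integrable[OF h]
    integral_swap[of "\<lambda>x. h (fst x)"] by auto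

lemma rL2_fst: "h \<in> rL2 torus3 \<Longrightarrow> (\<lambda>x. h (fst x)) \<in> rL2 torus3_sq"
  using fst_integrable(1)[of "\<lambda>p. (h p)\<^sup>2"] measurable_compose[OF measurable_fst, of h]
  by (auto simp: rL2_def)

lemma rL2_snd: "h \<in> rL2 torus3 \<Longrightarrow> (\<lambda>x. h (snd x)) \<in> rL2 torus3_sq"
  using snd_integrable(1)[of "\<lambda>p. (h p)\<^sup>2"] measurable_compose[OF measurable_snd, of h]
  by (auto simp: rL2_def)

lemma integral_mult_snd:
  assumes f: "f \<in> rL2 torus3_sq" and h: "h \<in> rL2 torus3"
  shows "(\<integral>x. f x * h (snd x) \<partial>torus3_sq) = (\<integral>q. marg f q * h q \<partial>torus3)"
  using integral_marg[OF rL2_mult_integrable[OF f rL2_snd[OF h]]] by (simp add: marg_def)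

lemma integral_mult_fst:
  assumes f: "f \<in> antisym_fun" and h: "h \<in> rL2 torus3"
  shows "(\<integral>x. f x * h (fst x) \<partial>torus3_sq) = - (\<integral>q. marg f q * h q \<partial>torus3)"
proof -
  have fL: "f \<in> rL2 torus3_sq" using f by (rule asym_rL2)
  note i = rL2_mult_integrable[OF fL rL2_fst[OF h]] rL2_mult_integrable[OF fL rL2_snd[OF h]]
  have "(\<integral>x. f x * h (fst x) \<partial>torus3_sq) = (\<integral>x. f (prod.swap x) * h (snd x) \<partial>torus3_sq)"
    using integral_swap[of "\<lambda>x. f x * h (fst x)"] i by simp
  also have "\<dots> = (\<integral>x. - (f x * h (snd x)) \<partial>torus3_sq)"
  proof (rule integral_cong_AE)
    show "(\<lambda>x. f (prod.swap x) * h (snd x)) \<in> borel_measurable torus3_sq"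
      using integrable_comp_swap[OF i(1)] by auto
    show "AE x in torus3_sq. f (prod.swap x) * h (snd x) = - (f x * h (snd x))"
      using f by (auto simp: antisym_fun_def elim: eventually_mono)
  qed (use i in auto)
  finally show ?thesis using integral_mult_snd[OF fL h] by simp
qed

definition dif :: "(real ^ 3 \<Rightarrow> real) \<Rightarrow> (real ^ 3) \<times> (real ^ 3) \<Rightarrow> real" where
  "dif h x = h (snd x) - h (fst x)"

lemma dif_asym: "h \<in> rL2 torus3 \<Longrightarrow> dif h \<in> antisym_fun"
  using rL2_diff[OF rL2_snd rL2_fst, of h h] by (simp add: antisym_fun_def dif_def[abs_def])

text \<open>Half of \<open>dif\<close> is the adjoint of \<open>marg\<close>: by antisymmetry both
  terms of \<open>dif h\<close> contribute equally. Hence the interaction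
  \<open>dif (marg f)\<close> is symmetric in \<open>f\<close>, with form twice the squared norm of
  the marginal.\<close>

lemma integral_mult_dif:
  assumes f: "f \<in> antisym_fun" and h: "h \<in> rL2 torus3"
  shows "(\<integral>x. f x * dif h x \<partial>torus3_sq) = 2 * (\<integral>q. marg f q * h q \<partial>torus3)"
proof -
  have fL: "f \<in> rL2 torus3_sq" using f by (rule asym_rL2)
  show ?thesis
    using integral_mult_fst[OF f h] integral_mult_snd[OF fL h]
      rL2_mult_integrable[OF fL rL2_fst[OF h]] rL2_mult_integrable[OF fL rL2_snd[OF h]]
    by (simp add: dif_def right_diff_distrib)
qed

section \<open>The operator on real functions\<close>

lemma asym_mult:
  assumes f: "f \<in> antisym_fun" and b: "b \<in> borel_measurable torus3_sq" "\<And>x. x \<in> tset \<times> tset \<Longrightarrow> \<bar>b x\<bar> \<le> B"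
    and s: "\<And>x. b (prod.swap x) = b x"
  shows "(\<lambda>x. b x * f x) \<in> antisym_fun"
proof -
  have "(\<lambda>x. b x * f x) \<in> rL2 torus3_sq"
    by (rule rL2_bounded_mult[where B = B]) (use f b in \<open>auto simp: asym_rL2 space_torus3_sq\<close>)
  then show ?thesis using f by (auto simp: antisym_fun_def s elim: eventually_mono)
qed

definition disp_pair :: "real \<Rightarrow> (real ^ 3) \<times> (real ^ 3) \<Rightarrow> real" where
  "disp_pair \<gamma> x = disp \<gamma> (fst x) (snd x)"

lemma disp_pair_swap: "disp_pair \<gamma> (prod.swap x) = disp_pair \<gamma> x"
  by (simp add: disp_pair_def disp_def add.commute)

lemma disp_pair_meas [measurable]: "disp_pair \<gamma> \<in> borel_measurable torus3_sq"
  unfolding disp_pair_def[abs_def] disp_def eps_def vector_add_component by measurable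

lemma disp_pair_bound: "\<bar>disp_pair \<gamma> x\<bar> \<le> 12 + 6 * \<bar>\<gamma>\<bar>"
proof -
  have "\<bar>disp_pair \<gamma> x\<bar> \<le> \<bar>eps (fst x)\<bar> + \<bar>eps (snd x)\<bar> + \<bar>\<gamma> * eps (fst x + snd x)\<bar>"
    unfolding disp_pair_def disp_def by linarith
  also have "\<dots> \<le> 6 + 6 + \<bar>\<gamma>\<bar> * 6"
    unfolding abs_mult using eps_le eps_nonneg by (intro add_mono mult_left_mono) (auto simp: abs_of_nonneg)
  finally show ?thesis by simp
qed

text \<open>By antisymmetry the two integrals in \<open>H\<close> at \<open>(p, q)\<close> are
  \<open>marg f q\<close> and \<open>- marg f p\<close>, which add up to
  \<open>dif (marg f)\<close>; \<open>k\<close> stands for \<open>l / (2 * pi) ^ 3\<close>.\<close>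

definition H_real :: "real \<Rightarrow> real \<Rightarrow> ((real ^ 3) \<times> (real ^ 3) \<Rightarrow> real) \<Rightarrow> (real ^ 3) \<times> (real ^ 3) \<Rightarrow> real" where
  "H_real \<gamma> k f x = disp_pair \<gamma> x * f x - k * dif (marg f) x"

lemma disp_pair_mult_asym: "f \<in> antisym_fun \<Longrightarrow> (\<lambda>x. disp_pair \<gamma> x * f x) \<in> antisym_fun"
  by (rule asym_mult[OF _ disp_pair_meas disp_pair_bound disp_pair_swap])

lemma dif_marg_asym: "f \<in> antisym_fun \<Longrightarrow> dif (marg f) \<in> antisym_fun"
  by (intro dif_asym marg_rL2(1) asym_rL2)

lemma H_real_asym: "f \<in> antisym_fun \<Longrightarrow> H_real \<gamma> k f \<in> antisym_fun"
  unfolding H_real_def[abs_def] by (intro asym_diff disp_pair_mult_asym asym_cmult dif_marg_asym)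

lemma AE_torus3_both:
  assumes "AE q in torus3. Q q"
  shows "AE x in torus3_sq. Q (fst x) \<and> Q (snd x)"
proof -
  obtain N where N: "N \<in> null_sets torus3" "{q \<in> space torus3. \<not> Q q} \<subseteq> N"
    using assms by (auto simp: eventually_ae_filter)
  have "N \<times> space torus3 \<in> null_sets torus3_sq" "space torus3 \<times> N \<in> null_sets torus3_sq"
    using N by (auto simp: null_sets_def torus3.emeasure_pair_measure_Times)
  then have "AE x in torus3_sq. x \<notin> N \<times> space torus3" "AE x in torus3_sq. x \<notin> space torus3 \<times> N"
    by (auto intro: AE_not_in)
  then show ?thesis using AE_space
    by eventually_elim (use N(2) in \<open>auto simp: space_pair_measure\<close>)
qed

lemma dif_cong_AE:
  assumes "AE q in torus3. h q = h' q"
  shows "AE x in torus3_sq. dif h x = dif h' x"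
  using AE_torus3_both[OF assms] by eventually_elim (simp add: dif_def)

lemma H_real_cong_AE:
  assumes fg: "f \<in> antisym_fun" "g \<in> antisym_fun" "AE x in torus3_sq. f x = g x"
  shows "AE x in torus3_sq. H_real \<gamma> k f x = H_real \<gamma> k g x"
  using dif_cong_AE[OF marg_cong_AE[OF _ _ fg(3)]] fg(3) fg(1,2)[THEN asym_rL2, THEN rL2_meas]
  by (auto simp: H_real_def elim: eventually_elim2)

definition H_op :: "real \<Rightarrow> real \<Rightarrow> asym_L2 \<Rightarrow> asym_L2" where
  "H_op \<gamma> k a = cls (H_real \<gamma> k (rp a))"

lemma H_op_cls:
  assumes "f \<in> antisym_fun"
  shows "H_op \<gamma> k (cls f) = cls (H_real \<gamma> k f)"
  unfolding H_op_def using H_real_cong_AE[OF rp_asym assms rp_cls[OF assms]]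
  by (subst cls_eq_iff) (auto intro: H_real_asym assms)

lemma H_op_inner_cls:
  assumes f: "f \<in> antisym_fun" and g: "g \<in> antisym_fun"
  shows "H_op \<gamma> k (cls f) \<bullet> cls g
    = (\<integral>x. disp_pair \<gamma> x * (f x * g x) \<partial>torus3_sq) - 2 * k * (\<integral>q. marg f q * marg g q \<partial>torus3)"
proof -
  have gL: "marg g \<in> rL2 torus3" "marg f \<in> rL2 torus3" using f g by (auto intro: marg_rL2 asym_rL2)
  have i: "integrable torus3_sq (\<lambda>x. disp_pair \<gamma> x * f x * g x)" "integrable torus3_sq (\<lambda>x. g x * dif (marg f) x)"
    using f g by (auto intro!: rL2_mult_integrable asym_rL2 disp_pair_mult_asym dif_marg_asym)
  have "H_op \<gamma> k (cls f) \<bullet> cls g = (\<integral>x. H_real \<gamma> k f x * g x \<partial>torus3_sq)"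
    unfolding H_op_cls[OF f] by (rule cls_inner[OF H_real_asym[OF f] g])
  also have "\<dots> = (\<integral>x. disp_pair \<gamma> x * f x * g x - k * (g x * dif (marg f) x) \<partial>torus3_sq)"
    by (simp add: H_real_def algebra_simps)
  also have "\<dots> = (\<integral>x. disp_pair \<gamma> x * f x * g x \<partial>torus3_sq) - k * (\<integral>x. g x * dif (marg f) x \<partial>torus3_sq)"
    using i by simp
  also have "(\<integral>x. g x * dif (marg f) x \<partial>torus3_sq) = 2 * (\<integral>q. marg g q * marg f q \<partial>torus3)"
    by (rule integral_mult_dif[OF g gL(2)])
  finally show ?thesis by (simp add: algebra_simps)
qed

lemma H_op_sym: "H_op \<gamma> k a \<bullet> b = a \<bullet> H_op \<gamma> k b"
  using H_op_inner_cls[of "rp a" "rp b" \<gamma> k] H_op_inner_cls[of "rp b" "rp a" \<gamma> k]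
  by (simp add: inner_commute mult.commute)

text \<open>Follows from symmetry alone: against a test vector the operator moves to the other side,
  where the inner product is linear.\<close>

lemma H_op_linear: "linear (H_op \<gamma> k)"
proof (rule linearI)
  fix a b :: asym_L2 and c :: real
  have *: "a = b" if "\<And>d. a \<bullet> d = b \<bullet> d" for a b :: asym_L2
    using that[of "a - b"] by (metis inner_diff_left inner_eq_zero_iff right_minus_eq)
  show "H_op \<gamma> k (a + b) = H_op \<gamma> k a + H_op \<gamma> k b"
    by (rule *) (simp add: H_op_sym inner_add_left)
  show "H_op \<gamma> k (c *\<^sub>R a) = c *\<^sub>R H_op \<gamma> k a"
    by (rule *) (simp add: H_op_sym)
qed

lemma norm_dif:
  assumes F: "F \<in> rL2 torus3"
  shows "(norm (cls (dif F)))\<^sup>2 \<le> 4 * (2 * pi) ^ 3 * (\<integral>q. (F q)\<^sup>2 \<partial>torus3)"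
proof -
  note Fs = fst_integrable[OF rL2_sq[OF F]] snd_integrable[OF rL2_sq[OF F]]
  have "(norm (cls (dif F)))\<^sup>2 = (\<integral>x. (dif F x)\<^sup>2 \<partial>torus3_sq)"
    by (rule cls_norm[OF dif_asym[OF F]])
  also have "\<dots> \<le> (\<integral>x. 2 * (F (snd x))\<^sup>2 + 2 * (F (fst x))\<^sup>2 \<partial>torus3_sq)"
  proof (rule integral_mono)
    show "integrable torus3_sq (\<lambda>x. (dif F x)\<^sup>2)" by (rule rL2_sq[OF asym_rL2[OF dif_asym[OF F]]])
    show "integrable torus3_sq (\<lambda>x. 2 * (F (snd x))\<^sup>2 + 2 * (F (fst x))\<^sup>2)" using Fs by simp
    show "(dif F x)\<^sup>2 \<le> 2 * (F (snd x))\<^sup>2 + 2 * (F (fst x))\<^sup>2" for x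
      using zero_le_power2[of "F (snd x) + F (fst x)"] unfolding dif_def power2_diff power2_sum by argo
  qed
  also have "\<dots> = 4 * (2 * pi) ^ 3 * (\<integral>q. (F q)\<^sup>2 \<partial>torus3)" using Fs by simp
  finally show ?thesis .
qed

lemma norm_dif_marg:
  assumes f: "f \<in> antisym_fun"
  shows "norm (cls (dif (marg f))) \<le> 2 * (2 * pi) ^ 3 * norm (cls f)"
proof (rule power2_le_imp_le)
  have "(norm (cls (dif (marg f))))\<^sup>2 \<le> 4 * (2 * pi) ^ 3 * (\<integral>q. (marg f q)\<^sup>2 \<partial>torus3)"
    by (intro norm_dif marg_rL2 asym_rL2 f)
  also have "\<dots> \<le> 4 * (2 * pi) ^ 3 * ((2 * pi) ^ 3 * (\<integral>x. (f x)\<^sup>2 \<partial>torus3_sq))"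
    by (intro mult_left_mono marg_rL2 asym_rL2 f) simp
  also have "\<dots> = (2 * (2 * pi) ^ 3 * norm (cls f))\<^sup>2"
    unfolding power_mult_distrib cls_norm[OF f] by (simp add: power_mult_distrib)
  finally show "(norm (cls (dif (marg f))))\<^sup>2 \<le> (2 * (2 * pi) ^ 3 * norm (cls f))\<^sup>2" .
qed simp

lemma H_op_bl: "bounded_linear (H_op \<gamma> k)"
proof -
  define B where "B = 12 + 6 * \<bar>\<gamma>\<bar>"
  have "norm (H_op \<gamma> k a) \<le> norm a * (B + \<bar>k\<bar> * (2 * (2 * pi) ^ 3))" for a
  proof -
    define f where "f = rp a"
    have f: "f \<in> antisym_fun" "a = cls f" by (auto simp: f_def)
    have e: "H_op \<gamma> k a = cls (\<lambda>x. disp_pair \<gamma> x * f x) - k *\<^sub>R cls (dif (marg f))"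
      unfolding f(2) H_op_cls[OF f(1)] H_real_def[abs_def] cls_scaleR[OF dif_marg_asym[OF f(1)]]
      by (rule cls_diff[symmetric]) (intro disp_pair_mult_asym asym_cmult dif_marg_asym f)+
    have 1: "norm (cls (\<lambda>x. disp_pair \<gamma> x * f x)) \<le> B * norm (cls f)"
    proof (rule power2_le_imp_le)
      have "(norm (cls (\<lambda>x. disp_pair \<gamma> x * f x)))\<^sup>2 = (\<integral>x. (disp_pair \<gamma> x * f x)\<^sup>2 \<partial>torus3_sq)"
        by (rule cls_norm[OF disp_pair_mult_asym[OF f(1)]])
      also have "\<dots> \<le> (\<integral>x. B\<^sup>2 * (f x)\<^sup>2 \<partial>torus3_sq)"
      proof (rule integral_mono)
        show "integrable torus3_sq (\<lambda>x. (disp_pair \<gamma> x * f x)\<^sup>2)"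
          by (rule rL2_sq[OF asym_rL2[OF disp_pair_mult_asym[OF f(1)]]])
        show "integrable torus3_sq (\<lambda>x. B\<^sup>2 * (f x)\<^sup>2)" using rL2_sq[OF asym_rL2[OF f(1)]] by simp
        show "(disp_pair \<gamma> x * f x)\<^sup>2 \<le> B\<^sup>2 * (f x)\<^sup>2" for x
          unfolding power_mult_distrib using disp_pair_bound[of \<gamma> x]
          by (intro mult_right_mono) (auto simp: abs_le_square_iff[symmetric] B_def)
      qed
      also have "\<dots> = (B * norm (cls f))\<^sup>2" by (simp add: power_mult_distrib cls_norm[OF f(1)])
      finally show "(norm (cls (\<lambda>x. disp_pair \<gamma> x * f x)))\<^sup>2 \<le> (B * norm (cls f))\<^sup>2" .
    qed (simp add: B_def)
    have 2: "\<bar>k\<bar> * norm (cls (dif (marg f))) \<le> \<bar>k\<bar> * (2 * (2 * pi) ^ 3 * norm (cls f))"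
      by (intro mult_left_mono norm_dif_marg f) simp
    have "norm (H_op \<gamma> k a) \<le> norm (cls (\<lambda>x. disp_pair \<gamma> x * f x)) + norm (k *\<^sub>R cls (dif (marg f)))"
      unfolding e by (rule norm_triangle_ineq4)
    also have "\<dots> \<le> B * norm (cls f) + \<bar>k\<bar> * (2 * (2 * pi) ^ 3 * norm (cls f))"
      using 1 2 by simp
    finally show ?thesis by (simp add: f(2) algebra_simps)
  qed
  then show ?thesis
    by (rule bounded_linear_intro[OF linear_add[OF H_op_linear] linear_scale[OF H_op_linear]])
qed

section \<open>Symmetries of the operator\<close>

definition Usym :: "(real ^ 3 \<Rightarrow> real ^ 3) \<Rightarrow> asym_L2 \<Rightarrow> asym_L2" where
  "Usym \<theta> a = cls (\<lambda>x. rp a (both \<theta> x))"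

lemma both_rL2:
  assumes \<theta>: "mpres \<theta>" and f: "f \<in> rL2 torus3_sq"
  shows "(\<lambda>x. f (both \<theta> x)) \<in> rL2 torus3_sq"
proof -
  note b = mpres_both[OF \<theta>]
  have "integrable (distr torus3_sq torus3_sq (both \<theta>)) (\<lambda>x. (f x)\<^sup>2)"
    unfolding b(2) by (rule rL2_sq[OF f])
  then have "integrable torus3_sq (\<lambda>x. (f (both \<theta> x))\<^sup>2)" by (rule integrable_distr[OF b(1)])
  moreover have "(\<lambda>x. f (both \<theta> x)) \<in> borel_measurable torus3_sq"
    by (rule measurable_compose[OF b(1) rL2_meas[OF f]])
  ultimately show ?thesis by (simp add: rL2_def)
qed

lemma both_asym:
  assumes \<theta>: "mpres \<theta>" and f: "f \<in> antisym_fun"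
  shows "(\<lambda>x. f (both \<theta> x)) \<in> antisym_fun"
proof -
  have "AE x in torus3_sq. f (prod.swap (both \<theta> x)) = - f (both \<theta> x)"
    by (rule mpres_AE[OF \<theta>]) (use f in \<open>simp add: antisym_fun_def\<close>)
  moreover have "prod.swap (both \<theta> x) = both \<theta> (prod.swap x)" for x
    by (simp add: both_def)
  ultimately show ?thesis using both_rL2[OF \<theta> asym_rL2[OF f]] by (simp add: antisym_fun_def)
qed

lemma Usym_cls:
  assumes \<theta>: "mpres \<theta>" and f: "f \<in> antisym_fun"
  shows "Usym \<theta> (cls f) = cls (\<lambda>x. f (both \<theta> x))"
  unfolding Usym_def using mpres_AE[OF \<theta> rp_cls[OF f]]
  by (subst cls_eq_iff) (auto intro!: both_asym \<theta> f)

lemma Usym_inner: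
  assumes \<theta>: "mpres \<theta>"
  shows "Usym \<theta> a \<bullet> Usym \<theta> b = a \<bullet> b"
proof -
  have "Usym \<theta> a \<bullet> Usym \<theta> b = (\<integral>x. rp a (both \<theta> x) * rp b (both \<theta> x) \<partial>torus3_sq)"
    unfolding Usym_def by (intro cls_inner both_asym \<theta> rp_asym)
  also have "\<dots> = (\<integral>x. rp a x * rp b x \<partial>distr torus3_sq torus3_sq (both \<theta>))"
    using mpres_both[OF \<theta>] by (subst integral_distr) auto
  also have "\<dots> = a \<bullet> b" unfolding mpres_both(2)[OF \<theta>] by (simp add: inner_asym_L2_def)
  finally show ?thesis .
qed

lemma Usym_bl:
  assumes \<theta>: "mpres \<theta>"
  shows "bounded_linear (Usym \<theta>)"
proof (rule bounded_linear_intro)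
  fix a b :: asym_L2 and c :: real
  have e: "Usym \<theta> a = cls (\<lambda>x. rp a (both \<theta> x))" "(\<lambda>x. rp a (both \<theta> x)) \<in> antisym_fun" for a
    by (auto simp: Usym_def intro!: both_asym \<theta>)
  show "Usym \<theta> (a + b) = Usym \<theta> a + Usym \<theta> b"
    using Usym_cls[OF \<theta> asym_add[OF rp_asym rp_asym], of a b] cls_add[OF rp_asym rp_asym, of a b]
      cls_add[OF e(2) e(2), of a b] by (simp add: e(1))
  show "Usym \<theta> (c *\<^sub>R a) = c *\<^sub>R Usym \<theta> a"
    using Usym_cls[OF \<theta> asym_cmult[OF rp_asym], of c a] cls_scaleR[OF rp_asym, of c a]
      cls_scaleR[OF e(2), of c a] by (simp add: e(1))
  show "norm (Usym \<theta> a) \<le> norm a * 1"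
    by (simp add: norm_eq_sqrt_inner Usym_inner[OF \<theta>])
qed

lemma marg_both:
  assumes \<theta>: "mpres \<theta>" and f: "f \<in> borel_measurable torus3_sq" and q: "q \<in> tset"
  shows "marg (\<lambda>x. f (both \<theta> x)) q = marg f (\<theta> q)"
proof -
  have "\<theta> q \<in> tset" using \<theta> q measurable_space[of \<theta> torus3 torus3 q] by (simp add: mpres_def space_torus3)
  then show ?thesis
    unfolding marg_def using mpres_integral[OF \<theta> section_meas[OF f]] by (simp add: both_def)
qed

text \<open>Acting in the same way on both variables and preserving the measure, \<theta> commutes
  with \<open>marg\<close> and \<open>dif\<close>, so only the dispersion has to be
  invariant.\<close>

lemma Usym_H_op:
  assumes \<theta>: "mpres \<theta>" and d: "\<And>x. x \<in> tset \<times> tset \<Longrightarrow> disp_pair \<gamma> (both \<theta> x) = disp_pair \<gamma> x"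
  shows "H_op \<gamma> k (Usym \<theta> a) = Usym \<theta> (H_op \<gamma> k a)"
proof -
  define f where "f = rp a"
  have f: "f \<in> antisym_fun" "a = cls f" by (auto simp: f_def)
  have "AE x in torus3_sq. H_real \<gamma> k (\<lambda>x. f (both \<theta> x)) x = H_real \<gamma> k f (both \<theta> x)"
    using AE_space
  proof eventually_elim
    case (elim x)
    then have "fst x \<in> tset" "snd x \<in> tset" "x \<in> tset \<times> tset" by (auto simp: space_torus3_sq)
    then show ?case
      using marg_both[OF \<theta> rL2_meas[OF asym_rL2[OF f(1)]]] d[of x]
      by (simp add: H_real_def dif_def) (simp add: both_def)
  qed
  then show ?thesis
    unfolding f(2) Usym_cls[OF \<theta> f(1)] H_op_cls[OF f(1)] H_op_cls[OF both_asym[OF \<theta> f(1)]]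
      Usym_cls[OF \<theta> H_real_asym[OF f(1)]]
    by (subst cls_eq_iff) (auto intro!: H_real_asym both_asym \<theta> f)
qed

lemma disp_pair_permute: "bij \<sigma> \<Longrightarrow> disp_pair \<gamma> (both (permute_coords \<sigma>) x) = disp_pair \<gamma> x"
proof -
  assume \<sigma>: "bij \<sigma>"
  have e: "eps (permute_coords \<sigma> p) = eps p" for p
    unfolding eps_def permute_coords_nth using \<sigma> by (rule sum.reindex_bij_betw)
  have "permute_coords \<sigma> p + permute_coords \<sigma> q = permute_coords \<sigma> (p + q)" for p q
    by (simp add: vec_eq_iff)
  then show ?thesis by (simp add: disp_pair_def disp_def both_def e)
qed

lemma cos_reflect: "p \<in> tset \<Longrightarrow> cos (reflect j p $ i) = cos (p $ i)"
  by (simp add: reflect_nth)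

text \<open>Holds also where \<open>p $ j = pi\<close>: there \<open>reflect\<close> changes
  nothing, but \<open>sin pi = 0\<close>.\<close>

lemma sin_reflect: "p \<in> tset \<Longrightarrow> sin (reflect j p $ i) = (if i = j then - sin (p $ i) else sin (p $ i))"
proof -
  assume "p \<in> tset"
  then have "p $ i \<le> pi" by blast
  then show ?thesis by (auto simp: reflect_nth order_less_le)
qed

lemma eps_reflect: "p \<in> tset \<Longrightarrow> eps (reflect j p) = eps p"
  by (simp add: eps_def cos_reflect)

text \<open>In the addition formula for the sum of the momenta both sines change sign together, so
  their product is unchanged.\<close>

lemma disp_pair_reflect:
  assumes "x \<in> tset \<times> tset"
  shows "disp_pair \<gamma> (both (reflect j) x) = disp_pair \<gamma> x"
proof -
  have x: "fst x \<in> tset" "snd x \<in> tset" using assms by auto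
  have "cos ((reflect j (fst x) + reflect j (snd x)) $ i) = cos ((fst x + snd x) $ i)" for i
    using x by (simp add: cos_add cos_reflect sin_reflect)
  then have "eps (reflect j (fst x) + reflect j (snd x)) = eps (fst x + snd x)"
    by (simp add: eps_def)
  then show ?thesis using x by (simp add: disp_pair_def disp_def both_def eps_reflect)
qed

section \<open>Weighted integrals behind the value \<open>gamma1\<close>\<close>

lemma cosine_le: "(sin x)\<^sup>2 \<le> 2 * (1 - cos x)" for x :: real
proof -
  have "(sin x)\<^sup>2 = (1 - cos x) * (1 + cos x)" by (simp add: sin_squared_eq power2_eq_square algebra_simps)
  also have "\<dots> \<le> (1 - cos x) * 2" by (intro mult_left_mono) auto
  finally show ?thesis by simp
qed

lemma integral_product:
  assumes u: "u \<in> rL2 torus3" and v: "v \<in> rL2 torus3"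
  shows "integrable torus3_sq (\<lambda>x. u (fst x) * v (snd x))"
    and "(\<integral>x. u (fst x) * v (snd x) \<partial>torus3_sq) = (\<integral>p. u p \<partial>torus3) * (\<integral>q. v q \<partial>torus3)"
proof -
  show "integrable torus3_sq (\<lambda>x. u (fst x) * v (snd x))"
    by (rule rL2_mult_integrable[OF rL2_fst[OF u] rL2_snd[OF v]])
  show "(\<integral>x. u (fst x) * v (snd x) \<partial>torus3_sq) = (\<integral>p. u p \<partial>torus3) * (\<integral>q. v q \<partial>torus3)"
    using integral_mult_snd[OF rL2_fst[OF u] v] by (simp add: marg_def)
qed

text \<open>The oscillating part of the dispersion: with
  \<open>w = 6 + 3 * \<gamma> - \<tau>\<close> the denominator \<open>disp - \<tau>\<close> becomes
  \<open>w - ssum\<close>, a perturbation of the constant \<open>w\<close>.\<close>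

definition ssum :: "real \<Rightarrow> (real ^ 3) \<times> (real ^ 3) \<Rightarrow> real" where
  "ssum \<gamma> x = (\<Sum>i\<in>UNIV. cos (fst x $ i) + cos (snd x $ i) + \<gamma> * cos (fst x $ i + snd x $ i))"

lemma disp_pair_ssum: "disp_pair \<gamma> x = 6 + 3 * \<gamma> - ssum \<gamma> x"
  by (simp add: disp_pair_def disp_def eps_def ssum_def sum.distrib sum_subtractf sum_distrib_left[symmetric] algebra_simps)

definition sin_mass :: real where
  "sin_mass = (\<integral>p. (sin (p $ 1))\<^sup>2 / eps p \<partial>torus3)"

lemma integrable_sin_eps: "integrable torus3 (\<lambda>p. sin (p $ i) * sin (p $ j) / eps p)"
proof (rule Bochner_Integration.integrable_bound[OF integrable_inverse_eps])
  show "AE p in torus3. norm (sin (p $ i) * sin (p $ j) / eps p) \<le> norm (1 / eps p)"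
    by (rule AE_I2) (simp add: abs_mult divide_right_mono mult_le_one)
qed measurable

text \<open>Exchanging the coordinates 1 and \<open>i\<close> preserves the measure and
  \<open>eps\<close>.\<close>

lemma sin_mass_eq: "(\<integral>p. (sin (p $ i))\<^sup>2 / eps p \<partial>torus3) = sin_mass"
proof -
  define \<sigma> where "\<sigma> = Transposition.transpose 1 i"
  have \<sigma>: "bij \<sigma>" by (simp add: \<sigma>_def)
  have e: "eps (permute_coords \<sigma> p) = eps p" for p
    unfolding eps_def permute_coords_nth using \<sigma> by (rule sum.reindex_bij_betw)
  have "sin_mass = (\<integral>p. (sin (permute_coords \<sigma> p $ 1))\<^sup>2 / eps (permute_coords \<sigma> p) \<partial>torus3)"
    unfolding sin_mass_def
    using mpres_integral[OF mpres_permute[OF \<sigma>], of "\<lambda>p. (sin (p $ 1))\<^sup>2 / eps p"] by simp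
  also have "\<dots> = (\<integral>p. (sin (p $ i))\<^sup>2 / eps p \<partial>torus3)"
    unfolding e by (simp add: \<sigma>_def)
  finally show ?thesis ..
qed

lemma sin_mass_pos: "0 < sin_mass"
proof -
  have i: "integrable torus3 (\<lambda>p. (sin (p $ 1))\<^sup>2 / eps p)"
    using integrable_sin_eps[of 1 1] by (simp add: power2_eq_square)
  have nn: "0 \<le> (sin (p $ 1))\<^sup>2 / eps p" for p by (simp add: eps_nonneg)
  have "sin_mass \<noteq> 0"
  proof
    assume "sin_mass = 0"
    then have "AE p in torus3. (sin (p $ 1))\<^sup>2 / eps p = 0"
      using integral_nonneg_eq_0_iff_AE[OF i] nn by (simp add: sin_mass_def)
    \<comment> \<open>A vanishing integral would make the slab \<open>0 < p $ 1 < pi\<close> null,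
      since the integrand is positive there, whereas the product formula gives its volume as a
      product of positive lengths.\<close>
    then have "AE p in torus3. \<not> (0 < p $ 1 \<and> p $ 1 < pi)"
      using AE_eps_pos
    proof eventually_elim
      case (elim p)
      then show ?case using sin_gt_zero[of "p $ 1"] by auto
    qed
    then have "(\<integral>\<^sup>+p. indicator {0<..<pi} (p $ 1) \<partial>torus3) = (\<integral>\<^sup>+p. 0 \<partial>torus3)"
      by (intro nn_integral_cong_AE) (auto simp: indicator_def elim: eventually_mono)
    then have zero: "(\<integral>\<^sup>+p. indicator {0<..<pi} (p $ 1) \<partial>torus3) = 0" by simp
    define g :: "3 \<Rightarrow> real \<Rightarrow> ennreal" where "g = (\<lambda>j x. if j = 1 then indicator {0<..<pi} x else 1)"
    have "(\<integral>\<^sup>+p. indicator {0<..<pi} (p $ 1) \<partial>torus3) = (\<integral>\<^sup>+p. (\<Prod>j\<in>UNIV. g j (p $ j)) \<partial>torus3)"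
      by (simp add: g_def prod.delta)
    also have "\<dots> = (\<Prod>j\<in>UNIV. \<integral>\<^sup>+x. g j x * indicator {- pi<..pi} x \<partial>lborel)"
      by (rule nn_integral_torus3_prod) (simp add: g_def)
    finally have "(\<Prod>j\<in>UNIV. \<integral>\<^sup>+x. g j x * indicator {- pi<..pi} x \<partial>lborel) = 0"
      unfolding zero by (rule sym)
    then obtain j where j: "(\<integral>\<^sup>+x. g j x * indicator {- pi<..pi} x \<partial>lborel) = 0"
      by auto
    have "(\<integral>\<^sup>+x. indicator {0<..<pi} x \<partial>lborel) \<le> (\<integral>\<^sup>+x. g j x * indicator {- pi<..pi} x \<partial>lborel)"
      by (rule nn_integral_mono) (auto simp: g_def indicator_def)
    then show False using j by simp
  qed
  moreover have "0 \<le> sin_mass" unfolding sin_mass_def using nn by (rule Bochner_Integration.integral_nonneg)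
  ultimately show ?thesis by simp
qed

lemma gamma1_eq: "gamma1 = (2 * pi) ^ 3 / sin_mass"
  by (simp add: gamma1_def sin_mass_def)

text \<open>The integrand is odd in coordinate \<open>i\<close>.\<close>

lemma sin_mass_orth:
  assumes "i \<noteq> j"
  shows "(\<integral>p. sin (p $ i) * sin (p $ j) / eps p \<partial>torus3) = 0"
  by (rule integral_odd_torus3[where j = i]) (use assms in \<open>auto simp: sin_reflect eps_reflect\<close>)

definition inv_mass :: real where "inv_mass = (\<integral>p. 1 / eps p \<partial>torus3)"

lemma eps_rL2:
  assumes h: "h \<in> rL2 torus3"
  shows "integrable torus3 (\<lambda>p. eps p * (h p)\<^sup>2)"
    and "(\<lambda>p. sqrt (eps p) * h p) \<in> rL2 torus3"
proof -
  show "(\<lambda>p. sqrt (eps p) * h p) \<in> rL2 torus3"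
    by (rule rL2_bounded_mult[OF h, where B = "sqrt 6"]) (auto simp: eps_nonneg eps_le)
  from rL2_sq[OF this] show "integrable torus3 (\<lambda>p. eps p * (h p)\<^sup>2)"
    by (simp add: power_mult_distrib eps_nonneg)
qed

text \<open>The product \<open>v * h\<close> is split into \<open>v / sqrt eps\<close> and
  \<open>sqrt eps * h\<close>, which is possible almost everywhere because \<open>eps\<close>
  vanishes on the torus only at the origin.\<close>

lemma weighted_Cauchy_Schwarz:
  assumes h: "h \<in> rL2 torus3" and v: "v \<in> borel_measurable torus3" "integrable torus3 (\<lambda>p. (v p)\<^sup>2 / eps p)"
  shows "(\<integral>p. v p * h p \<partial>torus3)\<^sup>2 \<le> (\<integral>p. (v p)\<^sup>2 / eps p \<partial>torus3) * (\<integral>p. eps p * (h p)\<^sup>2 \<partial>torus3)"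
proof -
  have m: "h \<in> borel_measurable torus3" using h by (rule rL2_meas)
  have g: "(\<lambda>p. v p / sqrt (eps p)) \<in> rL2 torus3"
    using v by (auto simp: rL2_def power_divide eps_nonneg)
  have "(\<integral>p. v p * h p \<partial>torus3) = (\<integral>p. (v p / sqrt (eps p)) * (sqrt (eps p) * h p) \<partial>torus3)"
    using v m AE_eps_pos by (intro integral_cong_AE) (auto elim!: eventually_mono)
  also have "\<dots>\<^sup>2 \<le> (\<integral>p. (v p / sqrt (eps p))\<^sup>2 \<partial>torus3) * (\<integral>p. (sqrt (eps p) * h p)\<^sup>2 \<partial>torus3)"
    by (rule rL2_Cauchy_Schwarz[OF g eps_rL2(2)[OF h]])
  finally show ?thesis by (simp add: power_divide power_mult_distrib eps_nonneg)
qed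

text \<open>The case \<open>v = 1\<close>, which rests on the integrability of
  \<open>1 / eps\<close>. Through this bound the L1 errors of the expansion are dominated by the
  degenerate form.\<close>

lemma abs_integral_sq_le:
  assumes h: "h \<in> rL2 torus3"
  shows "(\<integral>p. \<bar>h p\<bar> \<partial>torus3)\<^sup>2 \<le> inv_mass * (\<integral>p. eps p * (h p)\<^sup>2 \<partial>torus3)"
proof -
  have "(\<lambda>p. \<bar>h p\<bar>) \<in> rL2 torus3" using h by (auto simp: rL2_def)
  from weighted_Cauchy_Schwarz[OF this, of "\<lambda>_. 1"] show ?thesis
    using integrable_inverse_eps by (simp add: inv_mass_def)
qed

lemma rL2_sin: "(\<lambda>p. sin (p $ i)) \<in> rL2 torus3" and rL2_cos: "(\<lambda>p. cos (p $ i)) \<in> rL2 torus3"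
  by (rule torus3.rL2_bounded[where B = 1]; simp)+

lemma rL2_sin_mult: "h \<in> rL2 torus3 \<Longrightarrow> (\<lambda>p. sin (p $ i) * h p) \<in> rL2 torus3"
  and rL2_cos_mult: "h \<in> rL2 torus3 \<Longrightarrow> (\<lambda>p. cos (p $ i) * h p) \<in> rL2 torus3"
  by (erule rL2_bounded_mult[where B = 1]; simp)+

lemma sin_Bessel:
  assumes h: "h \<in> rL2 torus3"
  shows "(\<Sum>i\<in>UNIV. (\<integral>p. sin (p $ i) * h p \<partial>torus3)\<^sup>2) \<le> sin_mass * (\<integral>p. eps p * (h p)\<^sup>2 \<partial>torus3)"
proof -
  define s where "s = (\<lambda>i. \<integral>p. sin (p $ i) * h p \<partial>torus3)"
  define N where "N = (\<Sum>i\<in>(UNIV::3 set). (s i)\<^sup>2)"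
  define X where "X = (\<integral>p. eps p * (h p)\<^sup>2 \<partial>torus3)"
  \<comment> \<open>The test function uses the coefficients \<open>s i\<close> themselves: its
    pairing with \<open>h\<close> is \<open>N\<close> and its weighted norm squared is
    \<open>N * sin_mass\<close>, so that Cauchy-Schwarz reads
    \<open>N^2 \<le> N * sin_mass * X\<close>.\<close>
  define v where "v = (\<lambda>p :: real ^ 3. \<Sum>i\<in>UNIV. s i * sin (p $ i))"
  have si: "integrable torus3 (\<lambda>p. sin (p $ i) * h p)" for i
    by (rule torus3.rL2_integrable[OF rL2_sin_mult[OF h]])
  have vh: "(\<integral>p. v p * h p \<partial>torus3) = N"
  proof -
    have "(\<integral>p. v p * h p \<partial>torus3) = (\<integral>p. (\<Sum>i\<in>UNIV. s i * (sin (p $ i) * h p)) \<partial>torus3)"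
      by (simp add: v_def sum_distrib_right mult.assoc)
    also have "\<dots> = (\<Sum>i\<in>UNIV. s i * s i)" using si by (simp add: s_def)
    finally show ?thesis by (simp add: N_def power2_eq_square)
  qed
  define m where "m = (\<lambda>i j p. sin (p $ i) * sin (p $ j) / eps p :: real)"
  have mi: "integrable torus3 (m i j)" for i j unfolding m_def by (rule integrable_sin_eps)
  have vv: "(v p)\<^sup>2 / eps p = (\<Sum>i\<in>UNIV. \<Sum>j\<in>UNIV. s i * s j * m i j p)" for p
    by (simp add: v_def m_def power2_eq_square sum_product sum_divide_distrib algebra_simps)
  have vm: "v \<in> borel_measurable torus3" unfolding v_def by measurable
  have vi: "integrable torus3 (\<lambda>p. (v p)\<^sup>2 / eps p)"
    unfolding vv using mi by simp
  have "(\<integral>p. (v p)\<^sup>2 / eps p \<partial>torus3)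
      = (\<Sum>i\<in>UNIV. \<Sum>j\<in>UNIV. s i * s j * (\<integral>p. m i j p \<partial>torus3))"
    unfolding vv using mi by simp
  also have "\<dots> = (\<Sum>i\<in>UNIV. \<Sum>j\<in>UNIV. if j = i then (s i)\<^sup>2 * sin_mass else 0)"
  proof (intro sum.cong refl)
    fix i j
    show "s i * s j * (\<integral>p. m i j p \<partial>torus3) = (if j = i then (s i)\<^sup>2 * sin_mass else 0)"
      using sin_mass_orth[of i j] sin_mass_eq[of i] by (cases "i = j") (auto simp: m_def power2_eq_square)
  qed
  also have "\<dots> = N * sin_mass" by (simp add: N_def sum_distrib_right)
  finally have "(\<integral>p. (v p)\<^sup>2 / eps p \<partial>torus3) = N * sin_mass" .
  then have "N\<^sup>2 \<le> N * sin_mass * X"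
    using weighted_Cauchy_Schwarz[OF h vm vi] by (simp add: vh X_def)
  then have "N * N \<le> N * (sin_mass * X)" by (simp add: power2_eq_square mult.assoc)
  moreover have "0 \<le> N" unfolding N_def by (rule sum_nonneg) simp
  moreover have "0 \<le> sin_mass * X" unfolding X_def using sin_mass_pos eps_nonneg
    by (intro mult_nonneg_nonneg Bochner_Integration.integral_nonneg) auto
  ultimately have "N \<le> sin_mass * X" by (cases "N = 0") auto
  then show ?thesis by (simp add: N_def s_def X_def)
qed

section \<open>Large coupling expansion\<close>

text \<open>The coupling constant is \<open>k = \<lambda> / (2 * pi) ^ 3\<close>, and \<open>w = 6 + 3 * \<gamma> - \<tau>\<close>.  The last assumption says
  that \<open>\<tau>\<close> is the eigenvalue of the one-particle operator at \<open>q = 0\<close>; it will turn out to be the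
  infimum of the essential spectrum.\<close>

locale coupling =
  fixes \<gamma> w k :: real
  assumes \<gamma>: "0 < \<gamma>" and w: "2 * (6 + 3 * \<gamma>) \<le> w"
    and k: "k * (\<integral>s. 1 / (w - ssum \<gamma> (s, 0)) \<partial>torus3) = 1"
begin

definition s0 :: real where "s0 = 6 + 3 * \<gamma>"

text \<open>The inverse of multiplication by \<open>disp_pair \<gamma> x - (s0 - w)\<close>, see
  \<open>disp_pair_w\<close>.\<close>

definition K :: "(real ^ 3) \<times> (real ^ 3) \<Rightarrow> real" where "K x = 1 / (w - ssum \<gamma> x)"

text \<open>The determinant of the rank-one perturbation that is the one-particle operator at
  momentum \<open>q\<close>, taken at the energy \<tau>. It vanishes at \<open>q = 0\<close> by the
  assumption on \<open>k\<close>, and \<theta> is the coefficient of its leading behaviour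
  \<open>\<theta> * eps q\<close>.\<close>

definition \<Delta> :: "real ^ 3 \<Rightarrow> real" where "\<Delta> q = 1 - k * marg K q"

definition \<theta> :: real where "\<theta> = k * (2 * pi) ^ 3 / w\<^sup>2"

lemma s0w: "6 < s0" "2 * s0 \<le> w" "0 < w"
  using \<gamma> w by (auto simp: s0_def)

lemma ssum_abs: "\<bar>ssum \<gamma> x\<bar> \<le> s0"
proof -
  have "\<bar>cos (fst x $ i) + cos (snd x $ i) + \<gamma> * cos (fst x $ i + snd x $ i)\<bar> \<le> 1 + 1 + \<gamma> * 1" for i
  proof -
    have "\<bar>\<gamma> * cos (fst x $ i + snd x $ i)\<bar> \<le> \<gamma> * 1"
      unfolding abs_mult using \<gamma> by (intro mult_mono) auto
    then show ?thesis using abs_cos_le_one[of "fst x $ i"] abs_cos_le_one[of "snd x $ i"] by linarith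
  qed
  then have "\<bar>ssum \<gamma> x\<bar> \<le> (\<Sum>i\<in>(UNIV::3 set). 1 + 1 + \<gamma> * 1)"
    unfolding ssum_def by (intro order.trans[OF sum_abs] sum_mono)
  then show ?thesis by (simp add: s0_def)
qed

lemma ssum_w: "w / 2 \<le> w - ssum \<gamma> x" "0 < w - ssum \<gamma> x" "w - ssum \<gamma> x \<le> 2 * w"
  using ssum_abs[of x] s0w by auto

lemma K_bounds: "0 < K x" "K x \<le> 2 / w" "1 / (2 * w) \<le> K x" "\<bar>K x\<bar> \<le> 2 / w"
proof -
  show "0 < K x" using ssum_w(2) by (simp add: K_def)
  have "1 / (w - ssum \<gamma> x) \<le> 1 / (w / 2)" using ssum_w[of x] s0w by (intro divide_left_mono) auto
  then show "K x \<le> 2 / w" by (simp add: K_def)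
  show "1 / (2 * w) \<le> K x" unfolding K_def using ssum_w[of x] s0w by (intro divide_left_mono) auto
  show "\<bar>K x\<bar> \<le> 2 / w" using \<open>0 < K x\<close> \<open>K x \<le> 2 / w\<close> by simp
qed

lemma disp_pair_w: "disp_pair \<gamma> x - (s0 - w) = w - ssum \<gamma> x"
  by (simp add: disp_pair_ssum s0_def)

lemma ssum_meas [measurable]: "ssum \<gamma> \<in> borel_measurable torus3_sq"
  unfolding ssum_def[abs_def] by measurable

lemma K_meas [measurable]: "K \<in> borel_measurable torus3_sq"
  unfolding K_def[abs_def] by measurable

lemma K_swap: "K (prod.swap x) = K x"
  by (simp add: K_def ssum_def add.commute)

lemma zero_tset: "(0 :: real ^ 3) \<in> tset" by simp

lemma K_section: "q \<in> tset \<Longrightarrow> integrable torus3 (\<lambda>s. K (s, q))"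
  by (rule integrable_torus3_bounded[where B = "2 / w"]) (auto simp: section_meas K_bounds)

lemma k_marg: "k * marg K 0 = 1"
  using k by (simp add: marg_def K_def)

lemma marg_K_bounds:
  assumes "q \<in> tset"
  shows "(2 * pi) ^ 3 / (2 * w) \<le> marg K q" "marg K q \<le> (2 * pi) ^ 3 * 2 / w"
proof -
  have "(\<integral>s. 1 / (2 * w) \<partial>torus3) \<le> marg K q"
    unfolding marg_def using K_section[OF assms] K_bounds by (intro integral_mono) auto
  then show "(2 * pi) ^ 3 / (2 * w) \<le> marg K q" by (simp add: measure_torus3)
  have "marg K q \<le> (\<integral>s. 2 / w \<partial>torus3)"
    unfolding marg_def using K_section[OF assms] K_bounds by (intro integral_mono) auto
  then show "marg K q \<le> (2 * pi) ^ 3 * 2 / w" by (simp add: measure_torus3)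
qed

lemma k_pos: "0 < k"
proof -
  have "0 < (2 * pi) ^ 3 / (2 * w)" using s0w by simp
  then have "0 < marg K 0" using marg_K_bounds(1)[OF zero_tset] by linarith
  then show ?thesis using k_marg by (metis zero_less_mult_pos2 zero_less_one)
qed

lemma \<theta>_pos: "0 < \<theta>"
  using k_pos s0w by (simp add: \<theta>_def)

text \<open>The first order term \<open>d\<close> of the expansion contains \<open>sin (s $ i)\<close>, which is not \<open>O(eps q)\<close>, but
  this part is odd in \<open>s\<close> and drops out of the integral.\<close>

definition C1 :: real where "C1 = 12 * s0 * (1 + \<gamma>) + 192 * (1 + \<gamma>)\<^sup>2"

lemma marg_K_diff:
  assumes q: "q \<in> tset"
  shows "\<bar>marg K 0 - marg K q - (2 * pi) ^ 3 * eps q / w\<^sup>2\<bar> \<le> (2 * pi) ^ 3 * (C1 * eps q / w ^ 3)"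
proof -
  define A where "A = (\<lambda>s. w - ssum \<gamma> (s, 0))"
  define B where "B = (\<lambda>s. w - ssum \<gamma> (s, q))"
  define d where "d = (\<lambda>s. ssum \<gamma> (s, q) - ssum \<gamma> (s, 0))"
  define c where "c = (\<lambda>s :: real ^ 3. \<Sum>i\<in>UNIV. (1 - cos (q $ i)) * cos (s $ i))"
  define t where "t = (\<lambda>s :: real ^ 3. \<Sum>i\<in>UNIV. sin (q $ i) * sin (s $ i))"
  \<comment> \<open>The expansion is about the denominator \<open>A\<close> at \<open>q = 0\<close>
    and not about \<open>B\<close>: \<open>A\<close> is even in every coordinate of
    \<open>s\<close>, so the term with \<open>t\<close> integrates to zero. The rest
    \<open>r\<close> is of the order \<open>eps q / w ^ 3\<close>.\<close>
  define r where "r = (\<lambda>s. 1 / A s - 1 / B s - (eps q + \<gamma> * c s) / w\<^sup>2 - \<gamma> * t s / (A s)\<^sup>2)"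
  have d: "d s = - (eps q + \<gamma> * c s) - \<gamma> * t s" for s
    by (simp add: d_def ssum_def eps_def c_def t_def cos_add sum.distrib sum_subtractf
        sum_distrib_left algebra_simps)
  have AB: "w / 2 \<le> A s" "0 < A s" "w / 2 \<le> B s" "0 < B s" "A s \<le> w + s0" "A s = B s + d s" for s
    using ssum_w ssum_abs[of "(s, 0)"] by (auto simp: A_def B_def d_def)
  have r: "r s = (eps q + \<gamma> * c s) * (1 / (A s)\<^sup>2 - 1 / w\<^sup>2) - (d s)\<^sup>2 / ((A s)\<^sup>2 * B s)" for s
  proof -
    have "1 / A s - 1 / B s = - d s / (A s)\<^sup>2 - (d s)\<^sup>2 / ((A s)\<^sup>2 * B s)"
    proof -
      have "d s = A s - B s" using AB(6)[of s] by simp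
      show ?thesis unfolding \<open>d s = A s - B s\<close> using AB(2,4)[of s]
        by (simp add: field_simps power2_eq_square)
    qed
    also have "- d s / (A s)\<^sup>2 = (eps q + \<gamma> * c s) / (A s)\<^sup>2 + \<gamma> * t s / (A s)\<^sup>2"
      by (simp add: d add_divide_distrib diff_divide_distrib)
    finally show ?thesis by (simp add: r_def algebra_simps)
  qed
  have cb: "\<bar>c s\<bar> \<le> eps q" for s
  proof -
    have "\<bar>c s\<bar> \<le> (\<Sum>i\<in>UNIV. \<bar>(1 - cos (q $ i)) * cos (s $ i)\<bar>)" unfolding c_def by (rule sum_abs)
    also have "\<dots> \<le> eps q" unfolding eps_def
      by (intro sum_mono) (auto simp: abs_mult intro!: mult_left_le)
    finally show ?thesis .
  qed
  \<comment> \<open>Only the square of \<open>t\<close> is of the order \<open>eps q\<close>; this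
    suffices because \<open>t\<close> enters the remainder through the square of
    \<open>d\<close>.\<close>
  have tb: "(t s)\<^sup>2 \<le> 6 * eps q" for s
  proof -
    have "(t s)\<^sup>2 \<le> (\<Sum>i\<in>(UNIV::3 set). (sin (q $ i))\<^sup>2) * (\<Sum>i\<in>(UNIV::3 set). (sin (s $ i))\<^sup>2)"
      unfolding t_def by (rule Cauchy_Schwarz_ineq_sum)
    also have "\<dots> \<le> (\<Sum>i\<in>(UNIV::3 set). 2 * (1 - cos (q $ i))) * (\<Sum>i\<in>(UNIV::3 set). 1)"
      by (intro mult_mono sum_mono cosine_le) (auto intro!: sum_nonneg simp: abs_square_le_1)
    also have "\<dots> = 6 * eps q" by (simp only: eps_def sum_distrib_left[symmetric]) simp
    finally show ?thesis .
  qed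
  have ecb: "\<bar>eps q + \<gamma> * c s\<bar> \<le> (1 + \<gamma>) * eps q" for s
  proof -
    have "\<bar>\<gamma> * c s\<bar> \<le> \<gamma> * eps q" unfolding abs_mult using \<gamma> cb[of s] by (intro mult_mono) auto
    then show ?thesis using eps_nonneg[of q] by (simp add: algebra_simps)
  qed
  have db: "(d s)\<^sup>2 \<le> 24 * (1 + \<gamma>)\<^sup>2 * eps q" for s
  proof -
    have "(d s)\<^sup>2 \<le> 2 * (eps q + \<gamma> * c s)\<^sup>2 + 2 * (\<gamma> * t s)\<^sup>2"
      unfolding d using zero_le_power2[of "(eps q + \<gamma> * c s) - \<gamma> * t s"]
      by (simp add: power2_eq_square algebra_simps)
    moreover have "(eps q + \<gamma> * c s)\<^sup>2 \<le> ((1 + \<gamma>) * eps q)\<^sup>2"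
      using power_mono[OF ecb[of s], of 2] by simp
    moreover have "((1 + \<gamma>) * eps q)\<^sup>2 \<le> (1 + \<gamma>)\<^sup>2 * (6 * eps q)"
      unfolding power_mult_distrib power2_eq_square[of "eps q"]
      using eps_nonneg[of q] eps_le[of q] by (intro mult_left_mono mult_right_mono) auto
    moreover have "(\<gamma> * t s)\<^sup>2 \<le> (1 + \<gamma>)\<^sup>2 * (6 * eps q)"
      unfolding power_mult_distrib using \<gamma> tb[of s] by (intro mult_mono power_mono) auto
    ultimately show ?thesis by linarith
  qed
  have sqb: "\<bar>1 / (A s)\<^sup>2 - 1 / w\<^sup>2\<bar> \<le> 12 * s0 / w ^ 3" for s
  proof -
    have "1 / (A s)\<^sup>2 - 1 / w\<^sup>2 = (w - A s) * (w + A s) / (w\<^sup>2 * (A s)\<^sup>2)"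
      using AB(2)[of s] s0w by (simp add: field_simps power2_eq_square)
    then have "\<bar>1 / (A s)\<^sup>2 - 1 / w\<^sup>2\<bar> = \<bar>w - A s\<bar> * (w + A s) / (w\<^sup>2 * (A s)\<^sup>2)"
      using AB(2)[of s] s0w by (simp add: abs_mult)
    also have "\<dots> \<le> s0 * (3 * w) / (w\<^sup>2 * (w / 2)\<^sup>2)"
      using AB[of s] s0w ssum_abs[of "(s, 0)"]
      by (intro frac_le mult_mono power_mono) (auto simp: A_def)
    also have "\<dots> = 12 * s0 / w ^ 3" using s0w by (simp add: field_simps power2_eq_square power3_eq_cube)
    finally show ?thesis .
  qed
  \<comment> \<open>The two summands of \<open>C1\<close> come from replacing \<open>1 / A^2\<close>
    by \<open>1 / w^2\<close> and from the term quadratic in \<open>d\<close>; there three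
    denominators bounded below by \<open>w / 2\<close> turn 24 into 192.\<close>
  have rb: "\<bar>r s\<bar> \<le> C1 * eps q / w ^ 3" for s
  proof -
    have "\<bar>(eps q + \<gamma> * c s) * (1 / (A s)\<^sup>2 - 1 / w\<^sup>2)\<bar> \<le> ((1 + \<gamma>) * eps q) * (12 * s0 / w ^ 3)"
      unfolding abs_mult using ecb[of s] sqb[of s] \<gamma> eps_nonneg[of q] by (intro mult_mono) auto
    moreover have "\<bar>(d s)\<^sup>2 / ((A s)\<^sup>2 * B s)\<bar> \<le> (24 * (1 + \<gamma>)\<^sup>2 * eps q) / ((w / 2)\<^sup>2 * (w / 2))"
    proof -
      have "(d s)\<^sup>2 / ((A s)\<^sup>2 * B s) \<le> (24 * (1 + \<gamma>)\<^sup>2 * eps q) / ((w / 2)\<^sup>2 * (w / 2))"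
        using AB[of s] s0w db[of s] eps_nonneg[of q] by (intro frac_le mult_mono power_mono) auto
      moreover have "0 \<le> (d s)\<^sup>2 / ((A s)\<^sup>2 * B s)" using AB[of s] by simp
      ultimately show ?thesis by simp
    qed
    moreover have "(24 * (1 + \<gamma>)\<^sup>2 * eps q) / ((w / 2)\<^sup>2 * (w / 2)) = 192 * (1 + \<gamma>)\<^sup>2 * eps q / w ^ 3"
      using s0w by (simp add: field_simps power2_eq_square power3_eq_cube)
    moreover have "((1 + \<gamma>) * eps q) * (12 * s0 / w ^ 3) + 192 * (1 + \<gamma>)\<^sup>2 * eps q / w ^ 3 = C1 * eps q / w ^ 3"
      by (simp add: C1_def algebra_simps add_divide_distrib)
    ultimately show ?thesis unfolding r
      by (intro order.trans[OF abs_triangle_ineq4]) linarith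
  qed
  have Am: "A \<in> borel_measurable torus3" unfolding A_def
    using section_meas[OF ssum_meas zero_tset] by simp
  have Ai: "integrable torus3 (\<lambda>s. 1 / A s)" and Bi: "integrable torus3 (\<lambda>s. 1 / B s)"
    using K_section[OF zero_tset] K_section[OF q] by (simp_all add: K_def A_def B_def)
  have ci: "integrable torus3 (\<lambda>s. cos (s $ i))" and si: "integrable torus3 (\<lambda>s. sin (s $ i) / (A s)\<^sup>2)" for i
  proof -
    show "integrable torus3 (\<lambda>s. cos (s $ i))" by (rule integrable_torus3_bounded[where B = 1]) auto
    show "integrable torus3 (\<lambda>s. sin (s $ i) / (A s)\<^sup>2)"
    proof (rule integrable_torus3_bounded[where B = "1 / (w / 2)\<^sup>2"])
      show "\<bar>sin (s $ i) / (A s)\<^sup>2\<bar> \<le> 1 / (w / 2)\<^sup>2" for s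
        unfolding abs_divide using AB[of s] s0w by (intro frac_le) (auto intro!: power_mono)
    qed (use Am in measurable)
  qed
  have c0: "integrable torus3 c" "(\<integral>s. c s \<partial>torus3) = 0"
    unfolding c_def using ci by (auto simp: integral_cos_torus3)
  have t0: "integrable torus3 (\<lambda>s. t s / (A s)\<^sup>2)" "(\<integral>s. t s / (A s)\<^sup>2 \<partial>torus3) = 0"
  proof -
    define m where "m = (\<lambda>i s. sin (s $ i) / (A s)\<^sup>2)"
    have e: "t s / (A s)\<^sup>2 = (\<Sum>i\<in>UNIV. sin (q $ i) * m i s)" for s
      by (simp add: t_def m_def sum_divide_distrib)
    have "A (reflect i s) = A s" if "s \<in> tset" for s i
      using that by (simp add: A_def ssum_def cos_reflect)
    then have "(\<integral>s. m i s \<partial>torus3) = 0" for i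
      unfolding m_def using Am by (intro integral_odd_torus3[where j = i]) (auto simp: sin_reflect)
    moreover have "integrable torus3 (m i)" for i unfolding m_def by (rule si)
    ultimately show "integrable torus3 (\<lambda>s. t s / (A s)\<^sup>2)" "(\<integral>s. t s / (A s)\<^sup>2 \<partial>torus3) = 0"
      unfolding e by simp_all
  qed
  have ri: "integrable torus3 r"
    and "(\<integral>s. r s \<partial>torus3) = marg K 0 - marg K q - (2 * pi) ^ 3 * eps q / w\<^sup>2"
  proof -
    define E0 g m where "E0 = eps q / w\<^sup>2" and "g = \<gamma> / w\<^sup>2" and "m = (\<lambda>s. t s / (A s)\<^sup>2)"
    have e: "r = (\<lambda>s. 1 / A s - 1 / B s - (E0 + g * c s) - \<gamma> * m s)"
      by (auto simp: r_def E0_def g_def m_def add_divide_distrib)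
    have m0: "integrable torus3 m" "(\<integral>s. m s \<partial>torus3) = 0" using t0 by (auto simp: m_def)
    show "integrable torus3 r" unfolding e
      by (intro Bochner_Integration.integrable_diff Bochner_Integration.integrable_add
          integrable_mult_right Ai Bi c0 m0 torus3.integrable_const)
    have "(\<integral>s. r s \<partial>torus3) = (\<integral>s. 1 / A s \<partial>torus3) - (\<integral>s. 1 / B s \<partial>torus3) - (2 * pi) ^ 3 * E0"
      unfolding e using Ai Bi c0 m0 by (simp add: measure_torus3)
    then show "(\<integral>s. r s \<partial>torus3) = marg K 0 - marg K q - (2 * pi) ^ 3 * eps q / w\<^sup>2"
      by (simp add: marg_def K_def A_def B_def E0_def)
  qed
  then have "\<bar>marg K 0 - marg K q - (2 * pi) ^ 3 * eps q / w\<^sup>2\<bar> = \<bar>\<integral>s. r s \<partial>torus3\<bar>" by simp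
  also have "\<dots> \<le> (\<integral>s. \<bar>r s\<bar> \<partial>torus3)" by (rule integral_abs_bound)
  also have "\<dots> \<le> (\<integral>s. C1 * eps q / w ^ 3 \<partial>torus3)" using ri rb by (intro integral_mono) auto
  finally show ?thesis by (simp add: measure_torus3)
qed

lemma \<Delta>_bound:
  assumes q: "q \<in> tset"
  shows "\<bar>\<Delta> q - \<theta> * eps q\<bar> \<le> \<theta> * (C1 / w) * eps q"
proof -
  have "\<Delta> q - \<theta> * eps q = k * (marg K 0 - marg K q - (2 * pi) ^ 3 * eps q / w\<^sup>2)"
    using k_marg by (simp add: \<Delta>_def \<theta>_def algebra_simps)
  then have "\<bar>\<Delta> q - \<theta> * eps q\<bar> = k * \<bar>marg K 0 - marg K q - (2 * pi) ^ 3 * eps q / w\<^sup>2\<bar>"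
    by (simp only: abs_mult abs_of_pos[OF k_pos])
  also have "\<dots> \<le> k * ((2 * pi) ^ 3 * (C1 * eps q / w ^ 3))"
    by (intro mult_left_mono marg_K_diff q less_imp_le k_pos)
  also have "\<dots> = \<theta> * (C1 / w) * eps q"
    by (simp add: \<theta>_def power2_eq_square power3_eq_cube)
  finally show ?thesis .
qed

lemma \<Delta>_le: "q \<in> tset \<Longrightarrow> \<Delta> q \<le> \<theta> * (1 + C1 / w) * eps q"
  and \<Delta>_ge: "q \<in> tset \<Longrightarrow> \<theta> * (1 - C1 / w) * eps q \<le> \<Delta> q"
  using \<Delta>_bound[of q] by (auto simp: algebra_simps abs_le_iff)

end

lemma sin_sq_le_eps: "(sin (p $ i))\<^sup>2 \<le> 2 * eps p"
  using cosine_le[of "p $ i"] one_minus_cos_le_eps[of p i] by argo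

section \<open>The reduced form and its leading part\<close>

context coupling
begin

definition cross_form :: "(real ^ 3 \<Rightarrow> real) \<Rightarrow> real" where
  "cross_form h = (\<integral>x. K x * (h (fst x) * h (snd x)) \<partial>torus3_sq)"

definition diff_form :: "(real ^ 3 \<Rightarrow> real) \<Rightarrow> real" where
  "diff_form h = (\<integral>x. K x * (dif h x)\<^sup>2 \<partial>torus3_sq) / 2"

text \<open>The quadratic form of the identity minus \<open>k\<close> times the Birman-Schwinger
  operator at the energy \<tau>, which maps \<open>h\<close> to the marginal of
  \<open>\<lambda>x. K x * dif h x\<close>; its own form is \<open>diff_form\<close>, as half of
  \<open>dif\<close> is the adjoint of \<open>marg\<close>.\<close>

definition reduced_form :: "(real ^ 3 \<Rightarrow> real) \<Rightarrow> real" where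
  "reduced_form h = (\<integral>q. (h q)\<^sup>2 \<partial>torus3) - k * diff_form h"

lemma K_mult_integrable:
  assumes "integrable torus3_sq g"
  shows "integrable torus3_sq (\<lambda>x. K x * g x)"
proof (rule Bochner_Integration.integrable_bound)
  show "integrable torus3_sq (\<lambda>x. 2 / w * g x)" using assms by simp
  show "AE x in torus3_sq. norm (K x * g x) \<le> norm (2 / w * g x)"
    unfolding norm_mult using K_bounds s0w by (intro AE_I2 mult_right_mono) auto
qed (use assms in measurable)

lemma marg_K_mult:
  assumes h: "h \<in> rL2 torus3"
  shows "(\<integral>x. K x * (h (snd x))\<^sup>2 \<partial>torus3_sq) = (\<integral>q. marg K q * (h q)\<^sup>2 \<partial>torus3)"
    and "(\<integral>x. K x * (h (fst x))\<^sup>2 \<partial>torus3_sq) = (\<integral>q. marg K q * (h q)\<^sup>2 \<partial>torus3)"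
    and "integrable torus3 (\<lambda>q. marg K q * (h q)\<^sup>2)"
proof -
  note i = K_mult_integrable[OF snd_integrable(1)[OF rL2_sq[OF h]]]
  have e: "marg (\<lambda>x. K x * (h (snd x))\<^sup>2) = (\<lambda>q. marg K q * (h q)\<^sup>2)"
    by (rule ext) (simp add: marg_def)
  show 1: "(\<integral>x. K x * (h (snd x))\<^sup>2 \<partial>torus3_sq) = (\<integral>q. marg K q * (h q)\<^sup>2 \<partial>torus3)"
    using integral_marg[OF i] by (simp add: e)
  show "integrable torus3 (\<lambda>q. marg K q * (h q)\<^sup>2)"
    using integrable_marg[OF i] by (simp add: e)
  have "(\<integral>x. K x * (h (fst x))\<^sup>2 \<partial>torus3_sq) = (\<integral>x. K x * (h (snd x))\<^sup>2 \<partial>torus3_sq)"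
    using integral_swap[of "\<lambda>x. K x * (h (snd x))\<^sup>2"] i by (simp add: K_swap)
  then show "(\<integral>x. K x * (h (fst x))\<^sup>2 \<partial>torus3_sq) = (\<integral>q. marg K q * (h q)\<^sup>2 \<partial>torus3)"
    using 1 by simp
qed

text \<open>Expanding the square of \<open>dif h\<close>, each pure square integrates to
  \<open>marg K\<close> against the square of \<open>h\<close> and combines with the first term of
  the reduced form to \<Delta>; the mixed product is \<open>cross_form\<close>.\<close>

lemma reduced_form_eq:
  assumes h: "h \<in> rL2 torus3"
  shows "reduced_form h = (\<integral>q. \<Delta> q * (h q)\<^sup>2 \<partial>torus3) + k * cross_form h"
proof -
  define f1 f2 f3 where "f1 = (\<lambda>x. K x * (h (snd x))\<^sup>2)" and "f2 = (\<lambda>x. K x * (h (fst x))\<^sup>2)"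
    and "f3 = (\<lambda>x. K x * (h (fst x) * h (snd x)))"
  have i: "integrable torus3_sq f1" "integrable torus3_sq f2" "integrable torus3_sq f3"
    unfolding f1_def f2_def f3_def
    by (intro K_mult_integrable snd_integrable fst_integrable rL2_sq h integral_product)+
  have "diff_form h = (\<integral>x. f1 x + f2 x - 2 * f3 x \<partial>torus3_sq) / 2"
    unfolding diff_form_def dif_def f1_def f2_def f3_def by (simp add: power2_diff algebra_simps)
  also have "\<dots> = ((\<integral>x. f1 x \<partial>torus3_sq) + (\<integral>x. f2 x \<partial>torus3_sq)) / 2 - (\<integral>x. f3 x \<partial>torus3_sq)"
    using i by simp
  also have "\<dots> = (\<integral>q. marg K q * (h q)\<^sup>2 \<partial>torus3) - cross_form h"
    unfolding f1_def f2_def f3_def marg_K_mult[OF h] cross_form_def by simp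
  finally have diff_form: "diff_form h = (\<integral>q. marg K q * (h q)\<^sup>2 \<partial>torus3) - cross_form h" .
  have "(\<integral>q. \<Delta> q * (h q)\<^sup>2 \<partial>torus3) = (\<integral>q. (h q)\<^sup>2 - k * (marg K q * (h q)\<^sup>2) \<partial>torus3)"
    by (simp add: \<Delta>_def algebra_simps)
  also have "\<dots> = (\<integral>q. (h q)\<^sup>2 \<partial>torus3) - k * (\<integral>q. marg K q * (h q)\<^sup>2 \<partial>torus3)"
    using marg_K_mult(3)[OF h] rL2_sq[OF h] by simp
  finally show ?thesis by (simp add: reduced_form_def diff_form algebra_simps)
qed

lemma K_expansion: "\<bar>K x - 1 / w - ssum \<gamma> x / w\<^sup>2\<bar> \<le> 2 * s0\<^sup>2 / w ^ 3"
proof -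
  have e: "K x - 1 / w - ssum \<gamma> x / w\<^sup>2 = (ssum \<gamma> x)\<^sup>2 / (w\<^sup>2 * (w - ssum \<gamma> x))"
  proof -
    define b where "b = w - ssum \<gamma> x"
    have b: "ssum \<gamma> x = w - b" "0 < b" using ssum_w[of x] by (auto simp: b_def)
    show ?thesis using b(2) s0w unfolding K_def b(1) by (simp add: field_simps power2_eq_square)
  qed
  have "(ssum \<gamma> x)\<^sup>2 / (w\<^sup>2 * (w - ssum \<gamma> x)) \<le> s0\<^sup>2 / (w\<^sup>2 * (w / 2))"
    using ssum_w[of x] s0w ssum_abs[of x] power_mono[OF ssum_abs[of x], of 2]
    by (intro frac_le mult_left_mono) auto
  also have "\<dots> = 2 * s0\<^sup>2 / w ^ 3" using s0w by (simp add: field_simps power2_eq_square power3_eq_cube)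
  finally show ?thesis using ssum_w[of x] unfolding e by simp
qed

text \<open>In the first two orders of \<open>K\<close> the addition formula for \<open>cos\<close>
  separates the variables, so the integrals factor into one-variable integrals of \<open>h\<close>.
  Only the sine terms enter with a definite negative sign; they are the source of bound
  states.\<close>

lemma cross_form_expansion:
  assumes h: "h \<in> rL2 torus3"
  defines "a \<equiv> \<integral>p. h p \<partial>torus3" and "b \<equiv> \<Sum>i\<in>UNIV. \<integral>p. cos (p $ i) * h p \<partial>torus3"
  shows "\<bar>cross_form h - (a\<^sup>2 / w + 2 * a * b / w\<^sup>2 + \<gamma> / w\<^sup>2 * ((\<Sum>i\<in>UNIV. (\<integral>p. cos (p $ i) * h p \<partial>torus3)\<^sup>2)
        - (\<Sum>i\<in>UNIV. (\<integral>p. sin (p $ i) * h p \<partial>torus3)\<^sup>2)))\<bar>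
    \<le> 2 * s0\<^sup>2 / w ^ 3 * (\<integral>p. \<bar>h p\<bar> \<partial>torus3)\<^sup>2"
proof -
  define hh where "hh = (\<lambda>x :: (real^3) \<times> (real^3). h (fst x) * h (snd x))"
  define C S where "C = (\<lambda>i. \<integral>p. cos (p $ i) * h p \<partial>torus3)" and "S = (\<lambda>i. \<integral>p. sin (p $ i) * h p \<partial>torus3)"
  have hi: "integrable torus3_sq hh" "(\<integral>x. hh x \<partial>torus3_sq) = a * a"
    unfolding hh_def a_def using integral_product[OF h h] by auto
  define t1 t2 t3 t4 where
    "t1 = (\<lambda>i x. (cos (fst x $ i) * h (fst x)) * h (snd x))" and
    "t2 = (\<lambda>i x. h (fst x) * (cos (snd x $ i) * h (snd x)))" and
    "t3 = (\<lambda>i x. (cos (fst x $ i) * h (fst x)) * (cos (snd x $ i) * h (snd x)))" and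
    "t4 = (\<lambda>i x. (sin (fst x $ i) * h (fst x)) * (sin (snd x $ i) * h (snd x)))"
  define t where "t = (\<lambda>i x. (t1 i x + t2 i x) + \<gamma> * (t3 i x - t4 i x))"
  have ip: "integrable torus3_sq (t1 i)" "(\<integral>x. t1 i x \<partial>torus3_sq) = C i * a"
    "integrable torus3_sq (t2 i)" "(\<integral>x. t2 i x \<partial>torus3_sq) = a * C i"
    "integrable torus3_sq (t3 i)" "(\<integral>x. t3 i x \<partial>torus3_sq) = C i * C i"
    "integrable torus3_sq (t4 i)" "(\<integral>x. t4 i x \<partial>torus3_sq) = S i * S i" for i
    unfolding t1_def t2_def t3_def t4_def C_def S_def a_def
    by (rule integral_product[OF rL2_cos_mult[OF h] h] integral_product[OF h rL2_cos_mult[OF h]]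
        integral_product[OF rL2_cos_mult[OF h] rL2_cos_mult[OF h]]
        integral_product[OF rL2_sin_mult[OF h] rL2_sin_mult[OF h]])+
  have ti: "integrable torus3_sq (t i)" "(\<integral>x. t i x \<partial>torus3_sq) = 2 * a * C i + \<gamma> * ((C i)\<^sup>2 - (S i)\<^sup>2)" for i
    unfolding t_def using ip by (simp_all add: power2_eq_square)
  have st: "ssum \<gamma> x * hh x = (\<Sum>i\<in>UNIV. t i x)" for x
    unfolding ssum_def hh_def t_def t1_def t2_def t3_def t4_def sum_distrib_right cos_add
    by (intro sum.cong refl) (simp add: algebra_simps)
  have bC: "b = (\<Sum>i\<in>UNIV. C i)" by (simp only: b_def C_def)
  have si: "integrable torus3_sq (\<lambda>x. ssum \<gamma> x * hh x)"
    "(\<integral>x. ssum \<gamma> x * hh x \<partial>torus3_sq) = 2 * a * b + \<gamma> * ((\<Sum>i\<in>UNIV. (C i)\<^sup>2) - (\<Sum>i\<in>UNIV. (S i)\<^sup>2))"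
    unfolding st bC using ti
    by (simp_all add: sum.distrib sum_distrib_left sum_subtractf right_diff_distrib)
  have ki: "integrable torus3_sq (\<lambda>x. K x * hh x)" by (rule K_mult_integrable[OF hi(1)])
  define R where "R = (\<lambda>x. (K x - 1 / w - ssum \<gamma> x / w\<^sup>2) * hh x)"
  define u v where "u = 1 / w" and "v = 1 / w\<^sup>2"
  have R: "R x = K x * hh x - u * hh x - v * (ssum \<gamma> x * hh x)" for x
    by (simp add: R_def u_def v_def algebra_simps)
  have Ri: "integrable torus3_sq R"
    "(\<integral>x. R x \<partial>torus3_sq) = cross_form h - u * (a * a) - v * (\<integral>x. ssum \<gamma> x * hh x \<partial>torus3_sq)"
  proof -
    have "cross_form h = (\<integral>x. K x * hh x \<partial>torus3_sq)" by (simp only: cross_form_def hh_def)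
    then show "integrable torus3_sq R"
      "(\<integral>x. R x \<partial>torus3_sq) = cross_form h - u * (a * a) - v * (\<integral>x. ssum \<gamma> x * hh x \<partial>torus3_sq)"
      unfolding R using ki hi si(1) by simp_all
  qed
  have "\<bar>\<integral>x. R x \<partial>torus3_sq\<bar> \<le> (\<integral>x. \<bar>R x\<bar> \<partial>torus3_sq)" by (rule integral_abs_bound)
  also have "\<dots> \<le> (\<integral>x. 2 * s0\<^sup>2 / w ^ 3 * (\<bar>h (fst x)\<bar> * \<bar>h (snd x)\<bar>) \<partial>torus3_sq)"
  proof (rule integral_mono)
    show "integrable torus3_sq (\<lambda>x. \<bar>R x\<bar>)" using Ri by simp
    show "integrable torus3_sq (\<lambda>x. 2 * s0\<^sup>2 / w ^ 3 * (\<bar>h (fst x)\<bar> * \<bar>h (snd x)\<bar>))"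
      using integrable_abs[OF hi(1)] by (simp add: hh_def abs_mult)
    show "\<bar>R x\<bar> \<le> 2 * s0\<^sup>2 / w ^ 3 * (\<bar>h (fst x)\<bar> * \<bar>h (snd x)\<bar>)" for x
      unfolding R_def hh_def abs_mult by (intro mult_right_mono K_expansion) simp
  qed
  also have "\<dots> = 2 * s0\<^sup>2 / w ^ 3 * (\<integral>p. \<bar>h p\<bar> \<partial>torus3)\<^sup>2"
  proof -
    have "(\<lambda>p. \<bar>h p\<bar>) \<in> rL2 torus3" using h by (auto simp: rL2_def)
    from integral_product(2)[OF this this] show ?thesis by (simp add: power2_eq_square)
  qed
  finally show ?thesis
    unfolding Ri(2) si(2) u_def v_def by (simp add: C_def S_def power2_eq_square algebra_simps add_divide_distrib diff_divide_distrib)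
qed

text \<open>The constant is independent of \<open>w\<close>, so that a large \<open>w\<close> can be chosen afterwards.\<close>

definition C2 :: real where "C2 = C1 + (9 + 2 * s0\<^sup>2) * inv_mass / (2 * pi) ^ 3"

lemma inv_mass_nonneg: "0 \<le> inv_mass"
  unfolding inv_mass_def by (intro Bochner_Integration.integral_nonneg) (simp add: eps_nonneg)

lemma \<Delta>_integral:
  assumes h: "h \<in> rL2 torus3"
  defines "X \<equiv> \<integral>p. eps p * (h p)\<^sup>2 \<partial>torus3"
  shows "\<theta> * (1 - C1 / w) * X \<le> (\<integral>q. \<Delta> q * (h q)\<^sup>2 \<partial>torus3)"
    and "(\<integral>q. \<Delta> q * (h q)\<^sup>2 \<partial>torus3) \<le> \<theta> * (1 + C1 / w) * X"
proof -
  have i: "integrable torus3 (\<lambda>q. \<Delta> q * (h q)\<^sup>2)"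
    using marg_K_mult(3)[OF h] rL2_sq[OF h] by (simp add: \<Delta>_def left_diff_distrib mult.assoc)
  have j: "integrable torus3 (\<lambda>q. c * (eps q * (h q)\<^sup>2))" for c using eps_rL2(1)[OF h] by simp
  have "(\<integral>q. \<theta> * (1 - C1 / w) * (eps q * (h q)\<^sup>2) \<partial>torus3) \<le> (\<integral>q. \<Delta> q * (h q)\<^sup>2 \<partial>torus3)"
  proof (rule integral_mono[OF j i])
    fix q assume "q \<in> space torus3"
    then show "\<theta> * (1 - C1 / w) * (eps q * (h q)\<^sup>2) \<le> \<Delta> q * (h q)\<^sup>2"
      unfolding mult.assoc[symmetric] by (intro mult_right_mono \<Delta>_ge) (auto simp: space_torus3)
  qed
  then show "\<theta> * (1 - C1 / w) * X \<le> (\<integral>q. \<Delta> q * (h q)\<^sup>2 \<partial>torus3)" by (simp add: X_def)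
  have "(\<integral>q. \<Delta> q * (h q)\<^sup>2 \<partial>torus3) \<le> (\<integral>q. \<theta> * (1 + C1 / w) * (eps q * (h q)\<^sup>2) \<partial>torus3)"
  proof (rule integral_mono[OF i j])
    fix q assume "q \<in> space torus3"
    then show "\<Delta> q * (h q)\<^sup>2 \<le> \<theta> * (1 + C1 / w) * (eps q * (h q)\<^sup>2)"
      unfolding mult.assoc[symmetric] by (intro mult_right_mono \<Delta>_le) (auto simp: space_torus3)
  qed
  then show "(\<integral>q. \<Delta> q * (h q)\<^sup>2 \<partial>torus3) \<le> \<theta> * (1 + C1 / w) * X" by (simp add: X_def)
qed

lemma k_\<theta>: "k / w\<^sup>2 = \<theta> / (2 * pi) ^ 3"
  by (simp add: \<theta>_def)

lemma reduced_form_lower: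
  assumes h: "h \<in> rL2 torus3"
  defines "X \<equiv> \<integral>p. eps p * (h p)\<^sup>2 \<partial>torus3"
  shows "\<theta> * ((1 - C2 / w) * X - \<gamma> / (2 * pi) ^ 3 * (\<Sum>i\<in>UNIV. (\<integral>p. sin (p $ i) * h p \<partial>torus3)\<^sup>2)) \<le> reduced_form h"
proof -
  define a where "a = (\<integral>p. h p \<partial>torus3)"
  define C where "C = (\<lambda>i. \<integral>p. cos (p $ i) * h p \<partial>torus3)"
  define S2 where "S2 = (\<Sum>i\<in>UNIV. (\<integral>p. sin (p $ i) * h p \<partial>torus3)\<^sup>2)"
  define b where "b = (\<Sum>i\<in>UNIV. C i)"
  define n where "n = (\<integral>p. \<bar>h p\<bar> \<partial>torus3)"
  define M where "M = (2 * pi) ^ 3"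
  have M: "0 < M" by (simp add: M_def)
  have hi: "integrable torus3 (\<lambda>p. \<bar>h p\<bar>)" using torus3.rL2_integrable[OF h] by simp
  have Cn: "\<bar>C i\<bar> \<le> n" for i
  proof -
    have "\<bar>C i\<bar> \<le> (\<integral>p. \<bar>cos (p $ i) * h p\<bar> \<partial>torus3)" unfolding C_def by (rule integral_abs_bound)
    also have "\<dots> \<le> n" unfolding n_def
    proof (rule integral_mono[OF _ hi])
      show "integrable torus3 (\<lambda>p. \<bar>cos (p $ i) * h p\<bar>)"
        by (intro integrable_abs torus3.rL2_integrable rL2_cos_mult h)
    qed (simp add: abs_mult mult_left_le_one_le)
    finally show ?thesis .
  qed
  \<comment> \<open>Origin of the 9 in \<open>C2\<close>: three cosine coefficients, each at most
    \<open>n\<close>.\<close>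
  have "\<bar>b\<bar> \<le> (\<Sum>i\<in>(UNIV::3 set). n)" unfolding b_def by (intro order.trans[OF sum_abs] sum_mono Cn)
  then have "\<bar>b\<bar>\<^sup>2 \<le> (3 * n)\<^sup>2" by (intro power_mono) auto
  then have b9: "b\<^sup>2 \<le> 9 * n\<^sup>2" by (simp add: power_mult_distrib)
  \<comment> \<open>All errors below are multiples of the square of \<open>n\<close>, and this bound
    turns them into multiples of the weighted norm \<open>X\<close>; it is the origin of
    \<open>inv_mass\<close> in \<open>C2\<close>.\<close>
  have nX: "n\<^sup>2 \<le> inv_mass * X" unfolding n_def X_def by (rule abs_integral_sq_le[OF h])
  have C0: "0 \<le> (\<Sum>i\<in>UNIV. (C i)\<^sup>2)" by (rule sum_nonneg) simp
  have T: "a\<^sup>2 / w + 2 * a * b / w\<^sup>2 + \<gamma> / w\<^sup>2 * ((\<Sum>i\<in>UNIV. (C i)\<^sup>2) - S2) - 2 * s0\<^sup>2 / w ^ 3 * n\<^sup>2 \<le> cross_form h"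
    using cross_form_expansion[OF h] unfolding a_def C_def S2_def b_def n_def by linarith
  \<comment> \<open>Completing the square in \<open>a\<close>: the term of order
    \<open>1 / w\<close> absorbs the mixed term at the price of \<open>b^2 / w ^ 3\<close>, which is
    of the order of the remainder.\<close>
  have ab: "a\<^sup>2 / w + 2 * a * b / w\<^sup>2 \<ge> - b\<^sup>2 / w ^ 3"
  proof -
    have "0 \<le> (a + b / w)\<^sup>2 / w" using s0w by simp
    also have "\<dots> = a\<^sup>2 / w + 2 * a * b / w\<^sup>2 + b\<^sup>2 / w ^ 3"
      using s0w by (simp add: power2_sum power2_eq_square power3_eq_cube field_simps)
    finally show ?thesis by simp
  qed
  have "- (9 * n\<^sup>2) / w ^ 3 \<le> - b\<^sup>2 / w ^ 3" using b9 s0w by (intro divide_right_mono) auto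
  moreover have "\<gamma> / w\<^sup>2 * ((\<Sum>i\<in>UNIV. (C i)\<^sup>2) - S2) \<ge> - (\<gamma> / w\<^sup>2 * S2)"
    using C0 \<gamma> by (simp add: right_diff_distrib)
  ultimately have T2: "- (9 * n\<^sup>2) / w ^ 3 - \<gamma> / w\<^sup>2 * S2 - 2 * s0\<^sup>2 / w ^ 3 * n\<^sup>2 \<le> cross_form h"
    using T ab by linarith
  have "(9 + 2 * s0\<^sup>2) / w ^ 3 * n\<^sup>2 \<le> (9 + 2 * s0\<^sup>2) / w ^ 3 * (inv_mass * X)"
    using nX s0w by (intro mult_left_mono) auto
  then have "- ((9 + 2 * s0\<^sup>2) / w ^ 3 * (inv_mass * X)) - \<gamma> / w\<^sup>2 * S2 \<le> cross_form h"
    using T2 by (simp add: add_divide_distrib algebra_simps)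
  then have "k * (- ((9 + 2 * s0\<^sup>2) / w ^ 3 * (inv_mass * X)) - \<gamma> / w\<^sup>2 * S2) \<le> k * cross_form h"
    using k_pos by (intro mult_left_mono) auto
  also have "k * (- ((9 + 2 * s0\<^sup>2) / w ^ 3 * (inv_mass * X)) - \<gamma> / w\<^sup>2 * S2)
      = (k / w\<^sup>2) * (- ((9 + 2 * s0\<^sup>2) * inv_mass / w * X) - \<gamma> * S2)"
    using s0w by (simp add: power2_eq_square power3_eq_cube field_simps)
  also have "\<dots> = \<theta> * (- ((9 + 2 * s0\<^sup>2) * inv_mass / M / w * X) - \<gamma> / M * S2)"
    unfolding k_\<theta> M_def[symmetric] using M s0w by (simp add: field_simps)
  finally have "\<theta> * (1 - C1 / w) * X + \<theta> * (- ((9 + 2 * s0\<^sup>2) * inv_mass / M / w * X) - \<gamma> / M * S2) \<le> reduced_form h"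
    using \<Delta>_integral(1)[OF h] unfolding reduced_form_eq[OF h] X_def by linarith
  moreover have "\<theta> * (1 - C1 / w) * X + \<theta> * (- ((9 + 2 * s0\<^sup>2) * inv_mass / M / w * X) - \<gamma> / M * S2)
      = \<theta> * ((1 - C2 / w) * X - \<gamma> / M * S2)"
  proof -
    have C: "C2 = C1 + (9 + 2 * s0\<^sup>2) * inv_mass / M" by (simp only: C2_def M_def)
    show ?thesis unfolding C by (simp add: add_divide_distrib algebra_simps)
  qed
  ultimately show ?thesis by (simp add: M_def S2_def)
qed

text \<open>The minimiser of the leading part of the reduced form subject to a given value of
  \<open>\<integral>p. sin (p $ 1) * h p \<partial>torus3\<close>.\<close>

definition trial :: "real ^ 3 \<Rightarrow> real" where "trial p = sin (p $ 1) / eps p"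

text \<open>The singularity at the origin is harmless:
  \<open>(sin (p $ 1))^2 \<le> 2 * eps p\<close> bounds the square by
  \<open>2 / eps p\<close>.\<close>

lemma trial_rL2: "trial \<in> rL2 torus3"
proof -
  have "integrable torus3 (\<lambda>p. (trial p)\<^sup>2)"
  proof (rule Bochner_Integration.integrable_bound)
    show "integrable torus3 (\<lambda>p. 2 * (1 / eps p))" by (intro integrable_mult_right integrable_inverse_eps)
    show "AE p in torus3. norm ((trial p)\<^sup>2) \<le> norm (2 * (1 / eps p))"
      using AE_eps_pos
    proof eventually_elim
      case (elim p)
      have "(sin (p $ 1))\<^sup>2 \<le> 2 * eps p"
        by (rule sin_sq_le_eps)
      then have "(sin (p $ 1))\<^sup>2 / (eps p)\<^sup>2 \<le> 2 * eps p / (eps p)\<^sup>2" by (intro divide_right_mono) auto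
      then show ?case using elim by (simp add: trial_def power_divide power2_eq_square)
    qed
  qed (simp add: trial_def)
  then show ?thesis by (simp add: rL2_def trial_def[abs_def])
qed

lemma trial_reflect: "p \<in> tset \<Longrightarrow> trial (reflect j p) = (if j = 1 then - trial p else trial p)"
  by (auto simp: trial_def sin_reflect eps_reflect)

text \<open>Bessel's inequality is sharp here: the weighted norm squared of \<open>trial\<close> and
  its coefficient at \<open>sin (p $ 1)\<close> are both \<open>sin_mass\<close>. Oddness in the
  first coordinate removes the plain integral and the cosine coefficients, leaving the sine term and
  the remainder.\<close>

lemma trial_upper: "reduced_form trial \<le> \<theta> * sin_mass * (1 + C2 / w - \<gamma> / gamma1)"
proof -
  note h = trial_rL2
  have m: "trial \<in> borel_measurable torus3" by (rule rL2_meas[OF h])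
  define S2 where "S2 = (\<Sum>i\<in>UNIV. (\<integral>p. sin (p $ i) * trial p \<partial>torus3)\<^sup>2)"
  define n where "n = (\<integral>p. \<bar>trial p\<bar> \<partial>torus3)"
  define M where "M = (2 * pi) ^ 3"
  have M: "0 < M" by (simp add: M_def)
  have a: "(\<integral>p. trial p \<partial>torus3) = 0"
    by (rule integral_odd_torus3[where j = 1]) (auto simp: m trial_reflect)
  have C: "(\<integral>p. cos (p $ i) * trial p \<partial>torus3) = 0" for i
    by (rule integral_odd_torus3[where j = 1]) (use m in \<open>auto simp: trial_reflect cos_reflect\<close>)
  have X: "(\<integral>p. eps p * (trial p)\<^sup>2 \<partial>torus3) = sin_mass"
    unfolding sin_mass_def using m AE_eps_pos
    by (intro integral_cong_AE) (auto simp: trial_def power2_eq_square elim!: eventually_mono)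
  have S: "sin_mass\<^sup>2 \<le> S2"
  proof -
    have "(\<integral>p. sin (p $ 1) * trial p \<partial>torus3) = sin_mass" by (simp add: trial_def sin_mass_def power2_eq_square)
    then have "sin_mass\<^sup>2 = (\<integral>p. sin (p $ 1) * trial p \<partial>torus3)\<^sup>2" by simp
    also have "\<dots> \<le> S2" unfolding S2_def by (rule member_le_sum) auto
    finally show ?thesis .
  qed
  have nX: "n\<^sup>2 \<le> inv_mass * sin_mass" unfolding n_def X[symmetric] by (rule abs_integral_sq_le[OF h])
  have "cross_form trial \<le> - (\<gamma> / w\<^sup>2 * S2) + 2 * s0\<^sup>2 / w ^ 3 * n\<^sup>2"
    using cross_form_expansion[OF h] unfolding a C S2_def[symmetric] n_def[symmetric] by simp
  also have "\<dots> \<le> - (\<gamma> / w\<^sup>2 * sin_mass\<^sup>2) + (9 + 2 * s0\<^sup>2) / w ^ 3 * (inv_mass * sin_mass)"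
  proof (intro add_mono)
    show "- (\<gamma> / w\<^sup>2 * S2) \<le> - (\<gamma> / w\<^sup>2 * sin_mass\<^sup>2)"
      unfolding neg_le_iff_le using S \<gamma> by (intro mult_left_mono) auto
    show "2 * s0\<^sup>2 / w ^ 3 * n\<^sup>2 \<le> (9 + 2 * s0\<^sup>2) / w ^ 3 * (inv_mass * sin_mass)"
      using nX s0w by (intro mult_mono divide_right_mono) auto
  qed
  finally have "k * cross_form trial \<le> k * (- (\<gamma> / w\<^sup>2 * sin_mass\<^sup>2) + (9 + 2 * s0\<^sup>2) / w ^ 3 * (inv_mass * sin_mass))"
    using k_pos by (intro mult_left_mono) auto
  also have "\<dots> = (k / w\<^sup>2) * (- (\<gamma> * sin_mass\<^sup>2) + (9 + 2 * s0\<^sup>2) / w * inv_mass * sin_mass)"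
    using s0w by (simp add: power2_eq_square power3_eq_cube field_simps)
  also have "\<dots> = \<theta> * sin_mass * ((9 + 2 * s0\<^sup>2) * inv_mass / M / w - \<gamma> * sin_mass / M)"
    unfolding k_\<theta> M_def[symmetric] using M s0w by (simp add: field_simps power2_eq_square)
  finally have "reduced_form trial \<le> \<theta> * (1 + C1 / w) * sin_mass + \<theta> * sin_mass * ((9 + 2 * s0\<^sup>2) * inv_mass / M / w - \<gamma> * sin_mass / M)"
    using \<Delta>_integral(2)[OF h] unfolding reduced_form_eq[OF h] X by linarith
  also have "\<dots> = \<theta> * sin_mass * (1 + C2 / w - \<gamma> / gamma1)"
  proof -
    have g: "gamma1 = M / sin_mass" and C: "C2 = C1 + (9 + 2 * s0\<^sup>2) * inv_mass / M"
      by (simp_all only: gamma1_eq C2_def M_def)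
    show ?thesis unfolding g C using sin_mass_pos by (simp add: add_divide_distrib algebra_simps)
  qed
  finally show ?thesis .
qed

end

section \<open>Small neighbourhoods of the origin\<close>

lemma dif_indicator_sq:
  assumes h: "h \<in> rL2 torus3" and h01: "\<And>p. (h p)\<^sup>2 = h p"
  shows "(\<integral>x. (dif h x)\<^sup>2 \<partial>torus3_sq) = 2 * (\<integral>p. h p \<partial>torus3) * ((2 * pi) ^ 3 - (\<integral>p. h p \<partial>torus3))"
proof -
  have hi: "integrable torus3 h" by (rule torus3.rL2_integrable[OF h])
  note i = fst_integrable[OF hi] snd_integrable[OF hi] integral_product[OF h h]
  have "(\<integral>x. (dif h x)\<^sup>2 \<partial>torus3_sq) = (\<integral>x. h (snd x) + h (fst x) - 2 * (h (fst x) * h (snd x)) \<partial>torus3_sq)"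
    by (simp add: dif_def power2_diff h01 algebra_simps)
  also have "\<dots> = 2 * ((2 * pi) ^ 3 * (\<integral>p. h p \<partial>torus3)) - 2 * ((\<integral>p. h p \<partial>torus3) * (\<integral>p. h p \<partial>torus3))"
    using i by simp
  finally show ?thesis by (simp add: algebra_simps)
qed

lemma continuous_eps: "continuous_on UNIV eps"
  unfolding eps_def[abs_def] by (intro continuous_intros)

text \<open>The upper bound is Markov's inequality for \<open>1 / eps\<close>; positivity holds
  because the set contains an open neighbourhood of the origin.\<close>

lemma small_eps_set:
  assumes r: "0 < r"
  defines "h \<equiv> indicator {p. eps p < r} :: real ^ 3 \<Rightarrow> real"
  shows "h \<in> borel_measurable torus3" "0 < (\<integral>p. h p \<partial>torus3)" "(\<integral>p. h p \<partial>torus3) \<le> r * inv_mass"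
proof -
  have mb: "eps \<in> borel_measurable borel" by (rule borel_measurable_continuous_onI[OF continuous_eps])
  show m: "h \<in> borel_measurable torus3"
    unfolding h_def by (rule measurable_torus3) (use mb in measurable)
  have hi: "integrable torus3 h"
    by (rule integrable_torus3_bounded[OF m, where B = 1]) (simp add: h_def indicator_def)
  show "(\<integral>p. h p \<partial>torus3) \<le> r * inv_mass"
  proof -
    have "(\<integral>p. h p \<partial>torus3) \<le> (\<integral>p. r * (1 / eps p) \<partial>torus3)"
    proof (rule integral_mono_AE[OF hi])
      show "integrable torus3 (\<lambda>p. r * (1 / eps p))" by (intro integrable_mult_right integrable_inverse_eps)
      show "AE p in torus3. h p \<le> r * (1 / eps p)"
        using AE_eps_pos by eventually_elim (use r in \<open>auto simp: h_def indicator_def field_simps\<close>)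
    qed
    also have "\<dots> = r * inv_mass" unfolding inv_mass_def by (rule integral_mult_right_zero)
    finally show ?thesis .
  qed
  have "(\<integral>p. h p \<partial>torus3) \<noteq> 0"
  proof
    assume "(\<integral>p. h p \<partial>torus3) = 0"
    then have "AE p in torus3. h p = 0"
      using integral_nonneg_eq_0_iff_AE[OF hi] by (simp add: h_def)
    then have "AE p in (lborel :: (real ^ 3) measure). p \<in> tset \<longrightarrow> h p = 0"
      unfolding torus3_def by (subst (asm) AE_restrict_space_iff) auto
    then have ae: "AE p in (lborel :: (real ^ 3) measure). p \<notin> box (\<chi> i. - pi) (\<chi> i. pi) \<inter> {p. eps p < r}"
      by eventually_elim (auto simp: h_def mem_box_cart less_imp_le)
    define U where "U = box (\<chi> i. - pi) (\<chi> i. pi) \<inter> {p. eps p < r}"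
    have U: "open U" unfolding U_def
      by (intro open_Int open_box open_Collect_less continuous_eps continuous_on_const)
    have "U \<in> null_sets lborel"
      using ae U by (subst AE_iff_null_sets) (auto simp: U_def)
    then have "negligible U" using U
      by (auto simp: negligible_iff_null_sets null_sets_completion_iff)
    moreover have "0 \<in> U" using r by (simp add: U_def mem_box_cart eps_def)
    ultimately show False using open_not_negligible[OF U] by auto
  qed
  moreover have "0 \<le> (\<integral>p. h p \<partial>torus3)"
    by (rule Bochner_Integration.integral_nonneg) (simp add: h_def)
  ultimately show "0 < (\<integral>p. h p \<partial>torus3)" by simp
qed

section \<open>The form of \<open>H_op\<close> at the threshold energy\<close>

context coupling
begin

definition \<tau> :: real where "\<tau> = s0 - w"

text \<open>Orthogonality to \<open>sin_vec i\<close> means that the marginal has no sine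
  coefficient in coordinate \<open>i\<close>; the three conditions together remove the negative term
  of \<open>reduced_form_lower\<close>.\<close>

definition sin_vec :: "3 \<Rightarrow> asym_L2" where "sin_vec i = cls (dif (\<lambda>p. sin (p $ i)))"

lemma form_eq:
  assumes f: "f \<in> antisym_fun"
  shows "H_op \<gamma> k (cls f) \<bullet> cls f - \<tau> * (norm (cls f))\<^sup>2
    = (\<integral>x. (w - ssum \<gamma> x) * (f x)\<^sup>2 \<partial>torus3_sq) - 2 * k * (\<integral>q. (marg f q)\<^sup>2 \<partial>torus3)"
    and "integrable torus3_sq (\<lambda>x. (w - ssum \<gamma> x) * (f x)\<^sup>2)"
proof -
  have i: "integrable torus3_sq (\<lambda>x. disp_pair \<gamma> x * (f x * f x))" "integrable torus3_sq (\<lambda>x. (f x)\<^sup>2)"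
    using rL2_mult_integrable[OF asym_rL2[OF disp_pair_mult_asym[OF f]] asym_rL2[OF f]] rL2_sq[OF asym_rL2[OF f]]
    by (simp_all add: mult.assoc)
  have e: "(w - ssum \<gamma> x) * (f x)\<^sup>2 = disp_pair \<gamma> x * (f x * f x) - \<tau> * (f x)\<^sup>2" for x
    using disp_pair_w[of x] by (simp add: \<tau>_def power2_eq_square left_diff_distrib[symmetric] mult.assoc[symmetric])
  show "integrable torus3_sq (\<lambda>x. (w - ssum \<gamma> x) * (f x)\<^sup>2)" unfolding e using i by simp
  have "(\<integral>x. (w - ssum \<gamma> x) * (f x)\<^sup>2 \<partial>torus3_sq)
      = (\<integral>x. disp_pair \<gamma> x * (f x * f x) \<partial>torus3_sq) - \<tau> * (\<integral>x. (f x)\<^sup>2 \<partial>torus3_sq)"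
    unfolding e using i by simp
  then show "H_op \<gamma> k (cls f) \<bullet> cls f - \<tau> * (norm (cls f))\<^sup>2
    = (\<integral>x. (w - ssum \<gamma> x) * (f x)\<^sup>2 \<partial>torus3_sq) - 2 * k * (\<integral>q. (marg f q)\<^sup>2 \<partial>torus3)"
    using H_op_inner_cls[OF f f, of \<gamma> k] unfolding cls_norm[OF f] by (simp add: power2_eq_square)
qed

text \<open>Completing the square: for given \<open>marg f\<close>, the form is minimal at \<open>f = k * K * dif (marg f)\<close>.\<close>

lemma form_lower:
  assumes f: "f \<in> antisym_fun"
  shows "2 * k * reduced_form (marg f) \<le> H_op \<gamma> k (cls f) \<bullet> cls f - \<tau> * (norm (cls f))\<^sup>2"
proof -
  define F where "F = marg f"
  have F: "F \<in> rL2 torus3" unfolding F_def by (rule marg_rL2(1)[OF asym_rL2[OF f]])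
  define A B C where "A = (\<lambda>x. (w - ssum \<gamma> x) * (f x)\<^sup>2)" and "B = (\<lambda>x. f x * dif F x)"
    and "C = (\<lambda>x. K x * (dif F x)\<^sup>2)"
  have i: "integrable torus3_sq A" "integrable torus3_sq B" "integrable torus3_sq C"
    unfolding A_def B_def C_def
    by (intro form_eq(2) f rL2_mult_integrable asym_rL2 dif_asym F K_mult_integrable rL2_sq)+
  have "0 \<le> (\<integral>x. (w - ssum \<gamma> x) * (f x - k * (K x * dif F x))\<^sup>2 \<partial>torus3_sq)"
    using ssum_w(2) by (intro Bochner_Integration.integral_nonneg mult_nonneg_nonneg) (auto simp: less_imp_le)
  also have "(\<lambda>x. (w - ssum \<gamma> x) * (f x - k * (K x * dif F x))\<^sup>2) = (\<lambda>x. A x - 2 * k * B x + k\<^sup>2 * C x)"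
  proof (rule ext)
    fix x
    have "(w - ssum \<gamma> x) * K x = 1" using ssum_w(2)[of x] by (simp add: K_def)
    then have *: "(w - ssum \<gamma> x) * (K x * y) = y" for y by (simp add: mult.assoc[symmetric])
    show "(w - ssum \<gamma> x) * (f x - k * (K x * dif F x))\<^sup>2 = A x - 2 * k * B x + k\<^sup>2 * C x"
    proof -
      define W where "W = w - ssum \<gamma> x"
      have "W * (f x - k * (K x * dif F x))\<^sup>2
        = W * (f x)\<^sup>2 - 2 * k * (f x * (W * (K x * dif F x))) + k\<^sup>2 * (K x * dif F x * (W * (K x * dif F x)))"
        by (simp add: power2_eq_square algebra_simps)
      then show ?thesis unfolding W_def * by (simp add: A_def B_def C_def power2_eq_square algebra_simps)
    qed
  qed
  also have "(\<integral>x. A x - 2 * k * B x + k\<^sup>2 * C x \<partial>torus3_sq)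
      = (\<integral>x. A x \<partial>torus3_sq) - 2 * k * (\<integral>x. B x \<partial>torus3_sq) + k\<^sup>2 * (\<integral>x. C x \<partial>torus3_sq)"
    using i by simp
  also have "(\<integral>x. B x \<partial>torus3_sq) = 2 * (\<integral>q. F q * F q \<partial>torus3)"
    unfolding B_def F_def using F by (intro integral_mult_dif f) (simp add: F_def)
  also have "(\<integral>x. C x \<partial>torus3_sq) = 2 * diff_form F" by (simp add: C_def diff_form_def)
  finally have "0 \<le> (\<integral>x. A x \<partial>torus3_sq) - 4 * k * (\<integral>q. (F q)\<^sup>2 \<partial>torus3) + 2 * k\<^sup>2 * diff_form F"
    by (simp add: power2_eq_square)
  moreover have "H_op \<gamma> k (cls f) \<bullet> cls f - \<tau> * (norm (cls f))\<^sup>2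
      = (\<integral>x. A x \<partial>torus3_sq) - 2 * k * (\<integral>q. (F q)\<^sup>2 \<partial>torus3)"
    unfolding form_eq(1)[OF f] A_def F_def ..
  ultimately show ?thesis unfolding F_def[symmetric] reduced_form_def by (simp add: power2_eq_square algebra_simps)
qed

text \<open>If the weighted norm of the marginal is positive, then so is the reduced form. If it is
  zero, the marginal vanishes almost everywhere, the interaction drops out, and multiplication by
  \<open>w - ssum \<gamma> x \<ge> w / 2\<close> gives strictness.\<close>

lemma strict_form:
  assumes a: "a \<noteq> 0" and \<delta>: "0 < \<delta>"
    and reduced_form: "\<delta> * (\<integral>p. eps p * (marg (rp a) p)\<^sup>2 \<partial>torus3) \<le> reduced_form (marg (rp a))"
  shows "\<tau> * (norm a)\<^sup>2 < H_op \<gamma> k a \<bullet> a"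
proof -
  define f where "f = rp a"
  have f: "f \<in> antisym_fun" "a = cls f" by (auto simp: f_def)
  define F where "F = marg f"
  have F: "F \<in> rL2 torus3" unfolding F_def by (rule marg_rL2(1)[OF asym_rL2[OF f(1)]])
  define X where "X = (\<integral>p. eps p * (F p)\<^sup>2 \<partial>torus3)"
  have X0: "0 \<le> X" unfolding X_def by (intro Bochner_Integration.integral_nonneg) (simp add: eps_nonneg)
  have low: "2 * k * reduced_form F \<le> H_op \<gamma> k a \<bullet> a - \<tau> * (norm a)\<^sup>2"
    using form_lower[OF f(1)] by (simp add: F_def f(2))
  have BBX: "\<delta> * X \<le> reduced_form F" using reduced_form by (simp add: X_def F_def f_def)
  show ?thesis
  proof (cases "X = 0")
    case False
    then have "0 < \<delta> * X" using X0 \<delta> by simp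
    then have "0 < reduced_form F" using BBX by linarith
    then have "0 < 2 * k * reduced_form F" using k_pos by simp
    then show ?thesis using low by linarith
  next
    case True
    have "AE p in torus3. eps p * (F p)\<^sup>2 = 0"
      using True integral_nonneg_eq_0_iff_AE[OF eps_rL2(1)[OF F]] by (simp add: X_def eps_nonneg)
    then have "AE p in torus3. (F p)\<^sup>2 = 0" using AE_eps_pos by eventually_elim auto
    then have F0: "(\<integral>p. (F p)\<^sup>2 \<partial>torus3) = 0" by (rule integral_eq_zero_AE)
    have "w / 2 * (norm a)\<^sup>2 = (\<integral>x. w / 2 * (f x)\<^sup>2 \<partial>torus3_sq)"
      using cls_norm[OF f(1)] by (simp add: f(2))
    also have "\<dots> \<le> (\<integral>x. (w - ssum \<gamma> x) * (f x)\<^sup>2 \<partial>torus3_sq)"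
    proof (rule integral_mono[OF _ form_eq(2)[OF f(1)]])
      show "integrable torus3_sq (\<lambda>x. w / 2 * (f x)\<^sup>2)" using rL2_sq[OF asym_rL2[OF f(1)]] by simp
      show "w / 2 * (f x)\<^sup>2 \<le> (w - ssum \<gamma> x) * (f x)\<^sup>2" for x
        by (intro mult_right_mono ssum_w) simp
    qed
    also have "\<dots> = H_op \<gamma> k a \<bullet> a - \<tau> * (norm a)\<^sup>2"
      using form_eq(1)[OF f(1)] F0 by (simp add: f(2) F_def)
    finally have "w / 2 * (norm a)\<^sup>2 \<le> H_op \<gamma> k a \<bullet> a - \<tau> * (norm a)\<^sup>2" .
    moreover have "0 < w / 2 * (norm a)\<^sup>2" using a s0w by simp
    ultimately show ?thesis by linarith
  qed
qed

lemma sin_vec_inner: "a \<bullet> sin_vec i = 2 * (\<integral>p. sin (p $ i) * marg (rp a) p \<partial>torus3)"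
proof -
  have "cls (rp a) \<bullet> sin_vec i = (\<integral>x. rp a x * dif (\<lambda>p. sin (p $ i)) x \<partial>torus3_sq)"
    unfolding sin_vec_def by (intro cls_inner dif_asym rL2_sin rp_asym)
  also have "\<dots> = 2 * (\<integral>q. marg (rp a) q * sin (q $ i) \<partial>torus3)"
    by (intro integral_mult_dif rL2_sin rp_asym)
  finally show ?thesis by (simp add: mult.commute)
qed

text \<open>Bessel's inequality bounds the sine term of \<open>reduced_form_lower\<close> by
  \<open>\<gamma> / gamma1\<close> times the weighted norm, and the hypothesis \<open>c\<close>
  keeps the remaining coefficient positive.\<close>

lemma strict_below:
  assumes a: "a \<noteq> 0" and c: "C2 / w + \<gamma> / gamma1 < 1"
  shows "\<tau> * (norm a)\<^sup>2 < H_op \<gamma> k a \<bullet> a"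
proof (rule strict_form[OF a])
  define F where "F = marg (rp a)"
  have F: "F \<in> rL2 torus3" unfolding F_def by (rule marg_rL2(1)[OF rp_rL2])
  define X where "X = (\<integral>p. eps p * (F p)\<^sup>2 \<partial>torus3)"
  show "0 < \<theta> * (1 - C2 / w - \<gamma> / gamma1)" using c \<theta>_pos by simp
  have "\<gamma> / (2 * pi) ^ 3 * (\<Sum>i\<in>UNIV. (\<integral>p. sin (p $ i) * F p \<partial>torus3)\<^sup>2) \<le> \<gamma> / (2 * pi) ^ 3 * (sin_mass * X)"
    unfolding X_def using \<gamma> by (intro mult_left_mono sin_Bessel F) auto
  also have "\<dots> = \<gamma> / gamma1 * X" by (simp add: gamma1_eq)
  finally have "\<theta> * ((1 - C2 / w) * X - \<gamma> / gamma1 * X) \<le> reduced_form F"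
    using reduced_form_lower[OF F] \<theta>_pos unfolding X_def[symmetric]
    by (elim order.trans[rotated]) (intro mult_left_mono; simp)
  then show "\<theta> * (1 - C2 / w - \<gamma> / gamma1) * (\<integral>p. eps p * (marg (rp a) p)\<^sup>2 \<partial>torus3) \<le> reduced_form (marg (rp a))"
    unfolding F_def[symmetric] X_def[symmetric] by (simp add: algebra_simps)
qed

lemma strict_orth:
  assumes a: "a \<noteq> 0" and c: "C2 / w < 1" and u: "\<And>i. a \<bullet> sin_vec i = 0"
  shows "\<tau> * (norm a)\<^sup>2 < H_op \<gamma> k a \<bullet> a"
proof (rule strict_form[OF a])
  have F: "marg (rp a) \<in> rL2 torus3" by (rule marg_rL2(1)[OF rp_rL2])
  show "0 < \<theta> * (1 - C2 / w)" using c \<theta>_pos by simp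
  have "(\<integral>p. sin (p $ i) * marg (rp a) p \<partial>torus3) = 0" for i using sin_vec_inner[of a i] u[of i] by simp
  then show "\<theta> * (1 - C2 / w) * (\<integral>p. eps p * (marg (rp a) p)\<^sup>2 \<partial>torus3) \<le> reduced_form (marg (rp a))"
    using reduced_form_lower[OF F] by simp
qed

definition trial_fun :: "(real ^ 3) \<times> (real ^ 3) \<Rightarrow> real" where "trial_fun x = K x * dif trial x"

lemma K_asym: "f \<in> antisym_fun \<Longrightarrow> (\<lambda>x. K x * f x) \<in> antisym_fun"
  by (rule asym_mult[OF _ K_meas K_bounds(4) K_swap])

lemma trial_fun_asym: "trial_fun \<in> antisym_fun"
  unfolding trial_fun_def[abs_def] by (intro K_asym dif_asym trial_rL2)

text \<open>The marginal \<open>F\<close> of \<open>trial_fun\<close> need not be a multiple of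
  \<open>trial\<close>, but \<open>2 * reduced_form trial\<close> exceeds \<open>k\<close> times the
  form by twice the integral of the square of \<open>trial - k * F\<close>, so negativity of the
  reduced form carries over.\<close>

lemma trial_fun_form:
  assumes c: "1 + C2 / w < \<gamma> / gamma1"
  shows "H_op \<gamma> k (cls trial_fun) \<bullet> cls trial_fun < \<tau> * (norm (cls trial_fun))\<^sup>2"
proof -
  define F where "F = marg trial_fun"
  have F: "F \<in> rL2 torus3" unfolding F_def by (rule marg_rL2(1)[OF asym_rL2[OF trial_fun_asym]])
  have FX: "integrable torus3 (\<lambda>q. F q * trial q)" by (rule rL2_mult_integrable[OF F trial_rL2])
  have W: "(w - ssum \<gamma> x) * (trial_fun x)\<^sup>2 = trial_fun x * dif trial x" "trial_fun x * dif trial x = K x * (dif trial x)\<^sup>2" for x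
    using ssum_w(2)[of x] by (simp_all add: trial_fun_def K_def power2_eq_square)
  have 1: "(\<integral>x. trial_fun x * dif trial x \<partial>torus3_sq) = 2 * (\<integral>q. F q * trial q \<partial>torus3)"
    unfolding F_def by (rule integral_mult_dif[OF trial_fun_asym trial_rL2])
  have diff_form: "diff_form trial = (\<integral>q. F q * trial q \<partial>torus3)"
    unfolding diff_form_def W(2)[symmetric] 1 by simp
  have Q: "H_op \<gamma> k (cls trial_fun) \<bullet> cls trial_fun - \<tau> * (norm (cls trial_fun))\<^sup>2
      = 2 * (\<integral>q. F q * trial q \<partial>torus3) - 2 * k * (\<integral>q. (F q)\<^sup>2 \<partial>torus3)"
    unfolding form_eq(1)[OF trial_fun_asym] W(1) 1 F_def ..
  have "0 \<le> (\<integral>q. (trial q - k * F q)\<^sup>2 \<partial>torus3)" by simp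
  also have "(\<integral>q. (trial q - k * F q)\<^sup>2 \<partial>torus3) = (\<integral>q. (trial q)\<^sup>2 - 2 * k * (F q * trial q) + k\<^sup>2 * (F q)\<^sup>2 \<partial>torus3)"
    by (rule Bochner_Integration.integral_cong) (auto simp: power2_diff power_mult_distrib algebra_simps)
  also have "\<dots> = (\<integral>q. (trial q)\<^sup>2 \<partial>torus3) - 2 * k * (\<integral>q. F q * trial q \<partial>torus3) + k\<^sup>2 * (\<integral>q. (F q)\<^sup>2 \<partial>torus3)"
    using FX rL2_sq[OF F] rL2_sq[OF trial_rL2] by simp
  finally have "k * (H_op \<gamma> k (cls trial_fun) \<bullet> cls trial_fun - \<tau> * (norm (cls trial_fun))\<^sup>2) \<le> 2 * reduced_form trial"
    unfolding Q reduced_form_def diff_form by (simp add: power2_eq_square algebra_simps)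
  also have "reduced_form trial \<le> \<theta> * sin_mass * (1 + C2 / w - \<gamma> / gamma1)" by (rule trial_upper)
  also have "\<dots> < 0" using c \<theta>_pos sin_mass_pos by (intro mult_pos_neg) auto
  finally have "k * (H_op \<gamma> k (cls trial_fun) \<bullet> cls trial_fun - \<tau> * (norm (cls trial_fun))\<^sup>2) < 0" by simp
  then show ?thesis using k_pos by (simp add: mult_less_0_iff)
qed

text \<open>A Weyl sequence for \<open>\<tau>\<close> concentrates where \<open>eps q\<close> is small, that is, near \<open>q = 0\<close>.\<close>

lemma weyl_bound:
  assumes r: "0 < r" "r * inv_mass \<le> (2 * pi) ^ 3 / 2"
  shows "\<exists>a. a \<noteq> 0 \<and> (norm (H_op \<gamma> k a - \<tau> *\<^sub>R a))\<^sup>2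
    \<le> 16 * w\<^sup>2 * (2 * (\<theta> * (1 + C1 / w) * r)\<^sup>2 + 8 * k\<^sup>2 / w\<^sup>2 * (2 * pi) ^ 3 * (r * inv_mass)) * (norm a)\<^sup>2"
proof -
  define h where "h = (indicator {p. eps p < r} :: real ^ 3 \<Rightarrow> real)"
  define b where "b = (\<integral>p. h p \<partial>torus3)"
  define M where "M = (2 * pi) ^ 3"
  have M: "0 < M" by (simp add: M_def)
  have hm: "h \<in> borel_measurable torus3" and b: "0 < b" "b \<le> r * inv_mass"
    using small_eps_set[OF r(1)] by (simp_all add: h_def b_def)
  have h01: "0 \<le> h p" "h p \<le> 1" "(h p)\<^sup>2 = h p" for p by (auto simp: h_def indicator_def)
  have h: "h \<in> rL2 torus3" by (rule torus3.rL2_bounded[OF hm, where B = 1]) (simp add: h01)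
  have hi: "integrable torus3 h" by (rule torus3.rL2_integrable[OF h])
  \<comment> \<open>As \<open>K\<close> inverts the multiplication part of
    \<open>H - \<tau>\<close>, applying \<open>H - \<tau>\<close> to \<open>f\<close> leaves only
    \<open>dif v\<close> for the one-variable function \<open>v\<close> below.\<close>
  define f where "f = (\<lambda>x. K x * dif h x)"
  have f: "f \<in> antisym_fun" unfolding f_def by (intro K_asym dif_asym h)
  define a where "a = cls f"
  have na: "b * M / (4 * w\<^sup>2) \<le> (norm a)\<^sup>2"
  proof -
    \<comment> \<open>The smallness of \<open>r\<close> keeps \<open>b\<close> below half of the
      volume \<open>M\<close>, so that \<open>M - b\<close> is at least
      \<open>M / 2\<close>.\<close>
    have "b * M \<le> 2 * b * (M - b)"
    proof -
      have "2 * b \<le> M" using b r by (simp add: M_def)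
      then show ?thesis using b mult_left_mono[of "2 * b" M b] by (simp add: algebra_simps)
    qed
    then have "b * M / (4 * w\<^sup>2) \<le> (2 * b * (M - b)) / (4 * w\<^sup>2)" by (rule divide_right_mono) simp
    also have "\<dots> = (1 / (2 * w))\<^sup>2 * (2 * b * (M - b))" by (simp add: power_divide power_mult_distrib)
    also have "\<dots> = (\<integral>x. (1 / (2 * w))\<^sup>2 * (dif h x)\<^sup>2 \<partial>torus3_sq)"
      using dif_indicator_sq[OF h h01(3)] by (simp add: b_def M_def)
    also have "\<dots> \<le> (\<integral>x. (f x)\<^sup>2 \<partial>torus3_sq)"
    proof (rule integral_mono)
      show "integrable torus3_sq (\<lambda>x. (1 / (2 * w))\<^sup>2 * (dif h x)\<^sup>2)"
        using rL2_sq[OF asym_rL2[OF dif_asym[OF h]]] by simp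
      show "integrable torus3_sq (\<lambda>x. (f x)\<^sup>2)" by (rule rL2_sq[OF asym_rL2[OF f]])
      show "(1 / (2 * w))\<^sup>2 * (dif h x)\<^sup>2 \<le> (f x)\<^sup>2" for x
        unfolding f_def power_mult_distrib using K_bounds(3)[of x] s0w by (intro mult_right_mono power_mono) auto
    qed
    also have "\<dots> = (norm a)\<^sup>2" by (simp add: a_def cls_norm[OF f])
    finally show ?thesis .
  qed
  have a0: "a \<noteq> 0"
  proof
    assume "a = 0"
    moreover have "0 < b * M / (4 * w\<^sup>2)" using b M s0w by simp
    ultimately show False using na by simp
  qed
  define L where "L = (\<lambda>q. \<integral>s. K (s, q) * h s \<partial>torus3)"
  define v where "v = (\<lambda>q. h q - k * marg f q)"
  have v: "v \<in> rL2 torus3" unfolding v_def by (intro rL2_diff rL2_cmult h marg_rL2(1) asym_rL2 f)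
  have Ki: "integrable torus3 (\<lambda>s. K (s, q) * h s)" if "q \<in> tset" for q
    by (rule integrable_torus3_bounded[where B = "2 / w"])
       (use that section_meas[OF K_meas that] hm K_bounds h01 s0w in
        \<open>auto simp: abs_mult intro!: mult_le_one order.trans[OF mult_right_le_one_le]\<close>)
  \<comment> \<open>The first part is small because \<Delta> is of order \<open>r\<close> on the
    support of \<open>h\<close>; the second because \<open>L\<close> is of order \<open>b\<close>
    pointwise, so its squared norm is of order \<open>b^2\<close>, against order \<open>b\<close>
    for that of \<open>a\<close>.\<close>
  have vq: "v q = h q * \<Delta> q + k * L q" if q: "q \<in> tset" for q
  proof -
    have "marg f q = (\<integral>s. K (s, q) * h q - K (s, q) * h s \<partial>torus3)"
      by (simp add: marg_def f_def dif_def right_diff_distrib)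
    also have "\<dots> = marg K q * h q - L q"
      using Ki[OF q] K_section[OF q] by (simp add: L_def marg_def)
    finally have mf: "marg f q = marg K q * h q - L q" .
    show ?thesis unfolding v_def \<Delta>_def mf by (simp add: algebra_simps)
  qed
  have Lq: "\<bar>L q\<bar> \<le> 2 / w * b" if q: "q \<in> tset" for q
  proof -
    have "\<bar>L q\<bar> \<le> (\<integral>s. \<bar>K (s, q) * h s\<bar> \<partial>torus3)" unfolding L_def by (rule integral_abs_bound)
    also have "\<dots> \<le> (\<integral>s. 2 / w * h s \<partial>torus3)"
    proof (rule integral_mono)
      show "integrable torus3 (\<lambda>s. \<bar>K (s, q) * h s\<bar>)" using Ki[OF q] by simp
      show "\<bar>K (s, q) * h s\<bar> \<le> 2 / w * h s" for s
        unfolding abs_mult using K_bounds(4) h01(1) s0w by (intro mult_mono) auto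
    qed (use hi in simp)
    finally show ?thesis by (simp add: b_def)
  qed
  define \<eta> where "\<eta> = \<theta> * (1 + C1 / w) * r"
  have C1: "0 \<le> C1" unfolding C1_def using s0w \<gamma> by simp
  have \<eta>: "0 \<le> \<eta>" using C1 \<theta>_pos s0w r by (simp add: \<eta>_def)
  have hD: "\<bar>h q * \<Delta> q\<bar> \<le> \<eta> * h q" if q: "q \<in> tset" for q
  proof (cases "eps q < r")
    case True
    have "0 \<le> \<theta> * eps q" using \<theta>_pos eps_nonneg[of q] by simp
    then have "\<bar>\<Delta> q\<bar> \<le> \<theta> * (C1 / w) * eps q + \<theta> * eps q" using \<Delta>_bound[OF q] by arith
    also have "\<dots> = \<theta> * (1 + C1 / w) * eps q" by (simp add: algebra_simps)
    finally have "\<bar>\<Delta> q\<bar> \<le> \<theta> * (1 + C1 / w) * eps q" .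
    also have "\<theta> * (1 + C1 / w) * eps q \<le> \<eta>" unfolding \<eta>_def using True C1 \<theta>_pos s0w by (intro mult_left_mono) auto
    finally show ?thesis using True by (simp add: h_def)
  qed (simp add: h_def)
  have vb: "(v q)\<^sup>2 \<le> 2 * \<eta>\<^sup>2 * h q + 2 * (k * (2 / w * b))\<^sup>2" if q: "q \<in> tset" for q
  proof -
    have "(v q)\<^sup>2 \<le> 2 * (h q * \<Delta> q)\<^sup>2 + 2 * (k * L q)\<^sup>2"
      unfolding vq[OF q] using zero_le_power2[of "h q * \<Delta> q - k * L q"] unfolding power2_diff power2_sum by argo
    moreover have "(h q * \<Delta> q)\<^sup>2 \<le> \<eta>\<^sup>2 * h q"
      using power_mono[OF hD[OF q], of 2] by (simp add: power_mult_distrib h01(3))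
    moreover have "(k * L q)\<^sup>2 \<le> (k * (2 / w * b))\<^sup>2"
    proof -
      have "\<bar>k * L q\<bar> \<le> k * (2 / w * b)" unfolding abs_mult abs_of_pos[OF k_pos] using Lq[OF q] k_pos by (intro mult_left_mono) auto
      then show ?thesis using power_mono[of "\<bar>k * L q\<bar>" "k * (2 / w * b)" 2] by simp
    qed
    ultimately show ?thesis by argo
  qed
  have "(\<integral>q. (v q)\<^sup>2 \<partial>torus3) \<le> (\<integral>q. 2 * \<eta>\<^sup>2 * h q + 2 * (k * (2 / w * b))\<^sup>2 \<partial>torus3)"
    by (rule integral_mono[OF rL2_sq[OF v]]) (use hi vb in \<open>auto simp: space_torus3\<close>)
  also have "\<dots> = 2 * \<eta>\<^sup>2 * b + 2 * (k * (2 / w * b))\<^sup>2 * M"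
    using hi by (simp add: b_def M_def measure_torus3)
  also have "\<dots> = b * (2 * \<eta>\<^sup>2 + 8 * k\<^sup>2 / w\<^sup>2 * M * b)"
    by (simp add: power_mult_distrib power_divide power2_eq_square algebra_simps)
  also have "\<dots> \<le> b * (2 * \<eta>\<^sup>2 + 8 * k\<^sup>2 / w\<^sup>2 * M * (r * inv_mass))"
    using b M by (intro mult_left_mono add_left_mono) auto
  finally have vI: "(\<integral>q. (v q)\<^sup>2 \<partial>torus3) \<le> b * (2 * \<eta>\<^sup>2 + 8 * k\<^sup>2 / w\<^sup>2 * M * (r * inv_mass))" .
  have "H_op \<gamma> k a - \<tau> *\<^sub>R a = cls (dif v)"
  proof -
    have "H_real \<gamma> k f x - \<tau> * f x = dif v x" for x
    proof -
      have "disp_pair \<gamma> x * f x - \<tau> * f x = (w - ssum \<gamma> x) * f x"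
        using disp_pair_w[of x] by (simp add: \<tau>_def left_diff_distrib[symmetric])
      also have "\<dots> = dif h x" using ssum_w(2)[of x] by (simp add: f_def K_def)
      finally show ?thesis by (simp add: H_real_def v_def dif_def algebra_simps)
    qed
    then show ?thesis
      unfolding a_def H_op_cls[OF f] cls_scaleR[OF f]
      by (subst cls_diff[OF H_real_asym[OF f] asym_cmult[OF f]]) simp
  qed
  then have "(norm (H_op \<gamma> k a - \<tau> *\<^sub>R a))\<^sup>2 \<le> 4 * M * (\<integral>q. (v q)\<^sup>2 \<partial>torus3)"
    using norm_dif[OF v] by (simp add: M_def)
  also have "\<dots> \<le> 4 * M * (b * (2 * \<eta>\<^sup>2 + 8 * k\<^sup>2 / w\<^sup>2 * M * (r * inv_mass)))"
    using vI M by (intro mult_left_mono) auto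
  also have "\<dots> = 16 * w\<^sup>2 * (2 * \<eta>\<^sup>2 + 8 * k\<^sup>2 / w\<^sup>2 * M * (r * inv_mass)) * (b * M / (4 * w\<^sup>2))"
    using s0w by (simp add: field_simps)
  also have "\<dots> \<le> 16 * w\<^sup>2 * (2 * \<eta>\<^sup>2 + 8 * k\<^sup>2 / w\<^sup>2 * M * (r * inv_mass)) * (norm a)\<^sup>2"
    using na M r inv_mass_nonneg by (intro mult_left_mono mult_nonneg_nonneg add_nonneg_nonneg) auto
  finally show ?thesis using a0 unfolding \<eta>_def M_def by blast
qed

lemma weyl:
  assumes c: "0 < c"
  shows "\<exists>a. a \<noteq> 0 \<and> norm (H_op \<gamma> k a - \<tau> *\<^sub>R a) < c * norm a"
proof -
  define B where "B = (\<lambda>r. 16 * w\<^sup>2 * (2 * (\<theta> * (1 + C1 / w) * r)\<^sup>2 + 8 * k\<^sup>2 / w\<^sup>2 * (2 * pi) ^ 3 * (r * inv_mass)))"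
  have "(B \<longlongrightarrow> B 0) (at_right 0)" unfolding B_def by (intro tendsto_intros)
  then have 1: "\<forall>\<^sub>F r in at_right 0. B r < c\<^sup>2" by (rule order_tendstoD) (use c in \<open>simp add: B_def\<close>)
  have "((\<lambda>r. r * inv_mass) \<longlongrightarrow> 0 * inv_mass) (at_right 0)" by (intro tendsto_intros)
  then have 2: "\<forall>\<^sub>F r in at_right 0. r * inv_mass < (2 * pi) ^ 3 / 2" by (rule order_tendstoD) simp
  have "\<forall>\<^sub>F r in at_right (0::real). 0 < r" by (simp add: eventually_at_filter)
  with 1 2 have "\<forall>\<^sub>F r in at_right 0. 0 < r \<and> r * inv_mass < (2 * pi) ^ 3 / 2 \<and> B r < c\<^sup>2"
    by eventually_elim simp
  then obtain r where r: "0 < r" "r * inv_mass < (2 * pi) ^ 3 / 2" "B r < c\<^sup>2"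
    using eventually_happens'[of "at_right (0::real)"] by auto
  obtain a where a: "a \<noteq> 0" "(norm (H_op \<gamma> k a - \<tau> *\<^sub>R a))\<^sup>2 \<le> B r * (norm a)\<^sup>2"
    using weyl_bound[of r] r unfolding B_def by auto
  have "B r * (norm a)\<^sup>2 < c\<^sup>2 * (norm a)\<^sup>2" using r(3) a(1) by simp
  then have "(norm (H_op \<gamma> k a - \<tau> *\<^sub>R a))\<^sup>2 < (c * norm a)\<^sup>2" using a(2) by (simp add: power_mult_distrib)
  then have "norm (H_op \<gamma> k a - \<tau> *\<^sub>R a) < c * norm a" by (rule power2_less_imp_less) (use c in simp)
  then show ?thesis using a(1) by blast
qed

end

section \<open>Sectors of the reflection symmetries\<close>

lemma Usym_compose:
  assumes "mpres \<theta>" "mpres \<theta>'"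
  shows "Usym \<theta> (Usym \<theta>' a) = cls (\<lambda>x. rp a (both \<theta>' (both \<theta> x)))"
  using Usym_cls[OF assms(1) both_asym[OF assms(2) rp_asym], of a] by (simp add: Usym_def)

text \<open>Parity refers to reflecting one coordinate of both momenta simultaneously. The vectors
  \<open>sin_vec j\<close> with \<open>j \<noteq> i\<close> are orthogonal to
  \<open>sector i\<close>, so inside it the three orthogonality conditions reduce to the single one
  of \<open>min_eigenvector\<close>.\<close>

definition sector :: "3 \<Rightarrow> asym_L2 set" where
  "sector i = {a. \<forall>j. Usym (reflect j) a = (if j = i then - 1 else 1) *\<^sub>R a}"

lemma sector_D: "a \<in> sector i \<Longrightarrow> Usym (reflect j) a = (if j = i then - 1 else 1) *\<^sub>R a"
  unfolding sector_def by blast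

lemma sector_subspace: "subspace (sector i)"
proof -
  have l: "linear (Usym (reflect j))" for j
    by (rule bounded_linear.linear[OF Usym_bl[OF mpres_reflect]])
  show ?thesis
    by (auto simp: subspace_def sector_def linear_0[OF l] linear_add[OF l] linear_scale[OF l] scaleR_add_right)
qed

lemma sector_closed: "closed (sector i)"
proof -
  have "continuous_on UNIV (Usym (reflect j))" for j
    by (rule linear_continuous_on[OF Usym_bl[OF mpres_reflect]])
  then have "closed {a. Usym (reflect j) a = (if j = i then - 1 else 1) *\<^sub>R a}" for j
    by (intro closed_Collect_eq continuous_intros)
  then show ?thesis unfolding sector_def by (intro closed_Collect_all)
qed

text \<open>Reflection \<open>i\<close> is an isometry that acts as \<open>- 1\<close> on one sector
  and as \<open>1\<close> on the other.\<close>

lemma sector_orth: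
  assumes "a \<in> sector i" "b \<in> sector j" "i \<noteq> j"
  shows "a \<bullet> b = 0"
proof -
  have "a \<bullet> b = Usym (reflect i) a \<bullet> Usym (reflect i) b" by (rule Usym_inner[OF mpres_reflect, symmetric])
  also have "\<dots> = - (a \<bullet> b)" using assms by (simp add: sector_D)
  finally show ?thesis by simp
qed

lemma sector_H_op: "a \<in> sector i \<Longrightarrow> H_op \<gamma> k a \<in> sector i"
proof -
  assume a: "a \<in> sector i"
  have "Usym (reflect j) (H_op \<gamma> k a) = H_op \<gamma> k (Usym (reflect j) a)" for j
    by (rule Usym_H_op[OF mpres_reflect disp_pair_reflect, symmetric])
  then show ?thesis
    using a by (simp add: sector_def linear_scale[OF H_op_linear])
qed

lemma sector_clsI:
  assumes f: "f \<in> antisym_fun"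
    and s: "\<And>j x. x \<in> tset \<times> tset \<Longrightarrow> f (both (reflect j) x) = (if j = i then - 1 else 1) * f x"
  shows "cls f \<in> sector i"
proof -
  have "Usym (reflect j) (cls f) = (if j = i then - 1 else 1) *\<^sub>R cls f" for j
    unfolding Usym_cls[OF mpres_reflect f] cls_scaleR[OF f] using s asym_cmult[OF f, of "-1"]
    by (subst cls_eq_iff) (auto intro!: both_asym mpres_reflect asym_cmult f AE_I2 simp: space_torus3_sq)
  then show ?thesis by (simp add: sector_def)
qed

text \<open>Conjugating reflection \<open>j\<close> by the transposition \<open>\<sigma>\<close>
  gives reflection \<open>\<sigma> j\<close>.\<close>

lemma sector_permute:
  assumes a: "a \<in> sector 1"
  shows "Usym (permute_coords (Transposition.transpose 1 i)) a \<in> sector i"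
proof -
  define \<sigma> where "\<sigma> = Transposition.transpose 1 i"
  have b: "bij \<sigma>" by (simp add: \<sigma>_def)
  have ss: "\<sigma> (\<sigma> j) = j" for j by (simp add: \<sigma>_def)
  note mp = mpres_permute[OF b]
  have com: "both (permute_coords \<sigma>) (both (reflect j) x) = both (reflect (\<sigma> j)) (both (permute_coords \<sigma>) x)" for j x
  proof -
    have "permute_coords \<sigma> (reflect j p) = reflect (\<sigma> j) (permute_coords \<sigma> p)" for p
      unfolding vec_eq_iff permute_coords_nth reflect_nth using ss by metis
    then show ?thesis by (simp add: both_def)
  qed
  have "Usym (reflect j) (Usym (permute_coords \<sigma>) a) = Usym (permute_coords \<sigma>) (Usym (reflect (\<sigma> j)) a)" for j
    by (simp add: Usym_compose mp mpres_reflect com)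
  moreover have "\<sigma> j = 1 \<longleftrightarrow> j = i" for j
    unfolding \<sigma>_def Transposition.transpose_def by auto
  ultimately show ?thesis
    unfolding \<sigma>_def[symmetric] sector_def
    using sector_D[OF a] linear_scale[OF bounded_linear.linear[OF Usym_bl[OF mp]]] by simp
qed

context coupling
begin

lemma sin_vec_sector: "sin_vec i \<in> sector i"
  unfolding sin_vec_def
proof (rule sector_clsI[OF dif_asym[OF rL2_sin]])
  fix j and x :: "(real ^ 3) \<times> (real ^ 3)" assume "x \<in> tset \<times> tset"
  then have "fst x \<in> tset" "snd x \<in> tset" by auto
  then show "dif (\<lambda>p. sin (p $ i)) (both (reflect j) x) = (if j = i then - 1 else 1) * dif (\<lambda>p. sin (p $ i)) x"
    by (auto simp: dif_def both_def sin_reflect)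
qed

lemma trial_fun_sector: "cls trial_fun \<in> sector 1"
proof (rule sector_clsI[OF trial_fun_asym])
  fix j and x :: "(real ^ 3) \<times> (real ^ 3)" assume x: "x \<in> tset \<times> tset"
  then have x': "fst x \<in> tset" "snd x \<in> tset" by auto
  have "w - ssum \<gamma> (both (reflect j) x) = w - ssum \<gamma> x"
    using disp_pair_reflect[OF x, of \<gamma> j] by (simp add: disp_pair_ssum)
  then have "K (both (reflect j) x) = K x" by (simp add: K_def)
  moreover have "dif trial (both (reflect j) x) = (if j = 1 then - 1 else 1) * dif trial x"
    using x' by (auto simp: dif_def both_def trial_reflect)
  ultimately show "trial_fun (both (reflect j) x) = (if j = 1 then - 1 else 1) * trial_fun x"
    unfolding trial_fun_def by simp
qed

text \<open>No eigenvectors are singled out and \<open>z\<close> is free, so two choices of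
  \<open>z\<close> together exclude all spectrum below \<tau>.\<close>

lemma gap_below:
  assumes "C2 / w + \<gamma> / gamma1 < 1" "z < \<tau>"
  shows "spectral_gap (H_op \<gamma> k) ({} :: 3 set) (\<lambda>_. 0) sin_vec z \<tau>"
  by (rule spectral_gap.intro) (use assms H_op_bl H_op_sym strict_below in auto)

lemma gap_above:
  assumes c: "C2 / w < 1" "1 + C2 / w < \<gamma> / gamma1"
  shows "\<exists>z e. spectral_gap (H_op \<gamma> k) (UNIV :: 3 set) e sin_vec z \<tau> \<and> (\<forall>i. e i \<in> sector i)"
proof -
  have "\<exists>m<\<tau>. \<exists>x\<in>sector 1. norm x = 1 \<and> H_op \<gamma> k x = m *\<^sub>R x"
  proof (rule min_eigenvector[OF H_op_bl H_op_sym sector_subspace sector_closed sector_H_op])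
    fix x assume x: "x \<in> sector 1" "x \<bullet> sin_vec 1 = 0"
    have "x \<bullet> sin_vec i = 0" for i using sector_orth[OF x(1) sin_vec_sector, of i] x(2) by (cases "i = 1") auto
    then show "\<tau> * (norm x)\<^sup>2 \<le> H_op \<gamma> k x \<bullet> x"
      using strict_orth[OF _ c(1), of x] by (cases "x = 0") (auto simp: linear_0[OF H_op_linear])
  qed (use trial_fun_sector trial_fun_form[OF c(2)] in auto)
  then obtain z x where x: "z < \<tau>" "x \<in> sector 1" "norm x = 1" "H_op \<gamma> k x = z *\<^sub>R x" by blast
  \<comment> \<open>The coordinate transpositions commute with the operator and carry
    \<open>sector 1\<close> to the other sectors, which yields three orthonormal eigenvectors for
    the same \<open>z\<close>.\<close>
  define e where "e = (\<lambda>i. Usym (permute_coords (Transposition.transpose 1 i)) x)"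
  have mp: "mpres (permute_coords (Transposition.transpose 1 i))" for i by (rule mpres_permute) simp
  have eV: "e i \<in> sector i" for i unfolding e_def by (rule sector_permute[OF x(2)])
  have "spectral_gap (H_op \<gamma> k) (UNIV :: 3 set) e sin_vec z \<tau>"
  proof (rule spectral_gap.intro)
    show "e i \<bullet> e j = (if i = j then 1 else 0)" for i j
    proof (cases "i = j")
      case True
      have "e j \<bullet> e j = x \<bullet> x" unfolding e_def by (rule Usym_inner[OF mp])
      then show ?thesis using True x(3) by (simp add: norm_eq_1)
    qed (use sector_orth[OF eV eV] in auto)
    show "H_op \<gamma> k (e i) = z *\<^sub>R e i" for i
      unfolding e_def
      using Usym_H_op[OF mp disp_pair_permute, of i \<gamma> k x] x(4) linear_scale[OF bounded_linear.linear[OF Usym_bl[OF mp]]]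
      by simp
    show "e i \<bullet> sin_vec j = 0" if "i \<noteq> j" for i j by (rule sector_orth[OF eV sin_vec_sector that])
    show "\<tau> * (norm y)\<^sup>2 < H_op \<gamma> k y \<bullet> y" if "y \<noteq> 0" "\<And>i. i \<in> UNIV \<Longrightarrow> y \<bullet> sin_vec i = 0" for y
      using strict_orth[OF that(1) c(1)] that(2) by auto
  qed (use x H_op_bl H_op_sym in auto)
  then show ?thesis using eV by blast
qed

end

section \<open>Solving for the energy at a given coupling constant\<close>

text \<open>The condition on \<open>w\<close> is \<open>k * g w = 1\<close>. As \<open>g\<close> is
  continuous, positive at \<open>w0\<close> and bounded by a multiple of \<open>1 / w\<close>, it
  takes every value between 0 and \<open>g w0\<close>, whence \<open>k0 = 1 / g w0\<close>.\<close>

lemma coupling_exists: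
  assumes \<gamma>: "0 < \<gamma>" and w0: "2 * (6 + 3 * \<gamma>) \<le> w0"
  shows "\<exists>k0>0. \<forall>k>k0. \<exists>w\<ge>w0. coupling \<gamma> w k"
proof -
  define g where "g = (\<lambda>w. \<integral>s. 1 / (w - ssum \<gamma> (s, 0)) \<partial>torus3)"
  have ab: "\<bar>ssum \<gamma> x\<bar> \<le> 6 + 3 * \<gamma>" for x
  proof -
    have "0 \<le> disp_pair \<gamma> x" unfolding disp_pair_def disp_def using \<gamma> by (simp add: eps_nonneg)
    moreover have "disp_pair \<gamma> x \<le> 12 + 6 * \<gamma>" using disp_pair_bound[of \<gamma> x] \<gamma> by simp
    ultimately show ?thesis unfolding disp_pair_ssum by simp
  qed
  have w0p: "0 < w0" using \<gamma> w0 by simp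
  have low: "w / 2 \<le> w - ssum \<gamma> x" if "w0 \<le> w" for w x using ab[of x] that w0 by auto
  have m: "(\<lambda>s. ssum \<gamma> (s, 0)) \<in> borel_measurable torus3"
    unfolding ssum_def by simp
  have int: "integrable torus3 (\<lambda>s. 1 / (w - ssum \<gamma> (s, 0)))" if w: "w0 \<le> w" for w
  proof (rule integrable_torus3_bounded[where B = "1 / (w / 2)"])
    show "\<bar>1 / (w - ssum \<gamma> (s, 0))\<bar> \<le> 1 / (w / 2)" for s
      unfolding abs_divide using low[OF w, of "(s, 0)"] w0p w by (intro frac_le) auto
  qed (use m in measurable)
  have gpos: "0 < g w0"
  proof -
    have "(\<integral>s. 1 / (2 * w0) \<partial>torus3) \<le> g w0"
      unfolding g_def
    proof (rule integral_mono[OF _ int])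
      show "1 / (2 * w0) \<le> 1 / (w0 - ssum \<gamma> (s, 0))" for s
        using low[of w0 "(s, 0)"] ab[of "(s, 0)"] w0 w0p by (intro divide_left_mono) auto
    qed auto
    moreover have "0 < (\<integral>s. 1 / (2 * w0) \<partial>torus3)" using w0p by (simp add: measure_torus3)
    ultimately show ?thesis by linarith
  qed
  have gup: "g w \<le> (2 * pi) ^ 3 * 2 / w" if w: "w0 \<le> w" for w
  proof -
    have "g w \<le> (\<integral>s. 1 / (w / 2) \<partial>torus3)" unfolding g_def
    proof (rule integral_mono[OF int[OF w]])
      show "1 / (w - ssum \<gamma> (s, 0)) \<le> 1 / (w / 2)" for s
        using low[OF w, of "(s, 0)"] w0p w by (intro divide_left_mono) auto
    qed simp
    then show ?thesis by (simp add: measure_torus3)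
  qed
  have cont: "continuous_on {w0..} g"
  proof (rule lipschitz_on_continuous_on)
    show "((2 * pi) ^ 3 * (4 / w0\<^sup>2))-lipschitz_on {w0..} g"
    proof (rule lipschitz_onI)
      fix v w assume vw: "v \<in> {w0..}" "w \<in> {w0..}"
      have "\<bar>g v - g w\<bar> = \<bar>\<integral>s. 1 / (v - ssum \<gamma> (s, 0)) - 1 / (w - ssum \<gamma> (s, 0)) \<partial>torus3\<bar>"
        using int[of v] int[of w] vw by (simp add: g_def)
      also have "\<dots> \<le> (\<integral>s. \<bar>1 / (v - ssum \<gamma> (s, 0)) - 1 / (w - ssum \<gamma> (s, 0))\<bar> \<partial>torus3)"
        by (rule integral_abs_bound)
      also have "\<dots> \<le> (\<integral>s. \<bar>v - w\<bar> / (w0 / 2)\<^sup>2 \<partial>torus3)"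
      proof (rule integral_mono)
        show "integrable torus3 (\<lambda>s. \<bar>1 / (v - ssum \<gamma> (s, 0)) - 1 / (w - ssum \<gamma> (s, 0))\<bar>)"
          using int[of v] int[of w] vw by simp
        fix s
        define A B where "A = v - ssum \<gamma> (s, 0)" and "B = w - ssum \<gamma> (s, 0)"
        have AB: "w0 / 2 \<le> A" "w0 / 2 \<le> B" using low[of v "(s, 0)"] low[of w "(s, 0)"] vw by (auto simp: A_def B_def)
        have "1 / A - 1 / B = (w - v) / (A * B)" using AB w0p by (simp add: A_def B_def field_simps)
        then have "\<bar>1 / A - 1 / B\<bar> = \<bar>v - w\<bar> / (A * B)" using AB w0p by (simp add: abs_mult abs_minus_commute)
        also have "\<dots> \<le> \<bar>v - w\<bar> / (w0 / 2)\<^sup>2"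
          unfolding power2_eq_square using AB w0p by (intro divide_left_mono mult_mono mult_pos_pos) auto
        finally show "\<bar>1 / (v - ssum \<gamma> (s, 0)) - 1 / (w - ssum \<gamma> (s, 0))\<bar> \<le> \<bar>v - w\<bar> / (w0 / 2)\<^sup>2"
          by (simp add: A_def B_def)
      qed simp
      also have "\<dots> = (2 * pi) ^ 3 * (4 / w0\<^sup>2) * dist v w"
        by (simp add: measure_torus3 dist_real_def power_divide)
      finally show "dist (g v) (g w) \<le> (2 * pi) ^ 3 * (4 / w0\<^sup>2) * dist v w" by (simp add: dist_real_def)
    qed (use w0p in simp)
  qed
  show ?thesis
  proof (rule exI[of _ "1 / g w0"], intro conjI allI impI)
    fix k assume k: "1 / g w0 < k"
    have kp: "0 < k" using k gpos by (meson divide_pos_pos less_trans zero_less_one)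
    \<comment> \<open>At \<open>w1\<close> the upper bound \<open>gup\<close> is at most
      \<open>1 / k\<close>, which supplies the right end for the intermediate value theorem.\<close>
    define w1 where "w1 = max w0 ((2 * pi) ^ 3 * 2 * k)"
    have w1: "w0 \<le> w1" "(2 * pi) ^ 3 * 2 * k \<le> w1" by (auto simp: w1_def)
    have "g w1 \<le> 1 / k"
    proof -
      have "(2 * pi) ^ 3 * 2 / w1 \<le> 1 / k" using w1 w0p kp by (simp add: field_simps)
      then show ?thesis using gup[OF w1(1)] by linarith
    qed
    moreover have "1 / k \<le> g w0" using k gpos kp by (simp add: field_simps)
    moreover have "continuous_on {w0..w1} g" using cont by (rule continuous_on_subset) auto
    ultimately obtain w where w: "w0 \<le> w" "g w = 1 / k" using IVT2'[of g w1 "1 / k" w0] w1(1) by auto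
    have "k * g w = 1" using w kp by simp
    then have "coupling \<gamma> w k"
      using \<gamma> w0 w unfolding g_def by (intro coupling.intro) auto
    then show "\<exists>w\<ge>w0. coupling \<gamma> w k" using w(1) by blast
  qed (use gpos in simp)
qed

section \<open>Complex functions as pairs of real classes\<close>

definition cpair :: "((real ^ 3) \<times> (real ^ 3) \<Rightarrow> complex) \<Rightarrow> asym_L2 \<times> asym_L2" where
  "cpair f = (cls (\<lambda>x. Re (f x)), cls (\<lambda>x. Im (f x)))"

lemma L2_antisym_iff:
  "f \<in> L2_antisym \<longleftrightarrow> (\<lambda>x. Re (f x)) \<in> antisym_fun \<and> (\<lambda>x. Im (f x)) \<in> antisym_fun"
proof
  assume f: "f \<in> L2_antisym"
  have m: "f \<in> borel_measurable torus3_sq" and i: "integrable torus3_sq (\<lambda>x. (cmod (f x))\<^sup>2)"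
    using f by (auto simp: L2_antisym_def L2_def)
  have "AE x in torus3_sq. f (prod.swap x) = - f x"
    using f by (auto simp: L2_antisym_def case_prod_beta' prod.swap_def minus_equation_iff eq_commute elim!: eventually_mono)
  then have s: "AE x in torus3_sq. Re (f (prod.swap x)) = - Re (f x)" "AE x in torus3_sq. Im (f (prod.swap x)) = - Im (f x)"
    by (auto elim: eventually_mono)
  have "integrable torus3_sq (\<lambda>x. (Re (f x))\<^sup>2)" "integrable torus3_sq (\<lambda>x. (Im (f x))\<^sup>2)"
    using m by (auto intro!: Bochner_Integration.integrable_bound[OF i] simp: cmod_power2)
  then show "(\<lambda>x. Re (f x)) \<in> antisym_fun \<and> (\<lambda>x. Im (f x)) \<in> antisym_fun"
    using m s by (auto simp: antisym_fun_def rL2_def)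
next
  assume "(\<lambda>x. Re (f x)) \<in> antisym_fun \<and> (\<lambda>x. Im (f x)) \<in> antisym_fun"
  then have m: "(\<lambda>x. Re (f x)) \<in> borel_measurable torus3_sq" "(\<lambda>x. Im (f x)) \<in> borel_measurable torus3_sq"
    and i: "integrable torus3_sq (\<lambda>x. (Re (f x))\<^sup>2)" "integrable torus3_sq (\<lambda>x. (Im (f x))\<^sup>2)"
    and s: "AE x in torus3_sq. Re (f (prod.swap x)) = - Re (f x)" "AE x in torus3_sq. Im (f (prod.swap x)) = - Im (f x)"
    by (auto simp: antisym_fun_def rL2_def)
  have "f \<in> borel_measurable torus3_sq" using m by (subst borel_measurable_complex_iff) auto
  moreover have "integrable torus3_sq (\<lambda>x. (cmod (f x))\<^sup>2)" using i by (simp add: cmod_power2)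
  moreover have "AE x in torus3_sq. f x = - f (prod.swap x)"
    using s by eventually_elim (simp add: complex_eq_iff)
  ultimately show "f \<in> L2_antisym"
    by (simp add: L2_antisym_def L2_def case_prod_beta' prod.swap_def)
qed

lemma cpair_surj: "\<exists>f\<in>L2_antisym. cpair f = v"
proof -
  obtain a b where v: "v = (a, b)" by (cases v)
  show ?thesis
    by (rule bexI[of _ "\<lambda>x. Complex (rp a x) (rp b x)"]) (auto simp: cpair_def v L2_antisym_iff)
qed

text \<open>Passes from representatives to classes in any statement that depends on
  \<open>cpair f\<close> only.\<close>

lemma all_cpair: "(\<forall>f\<in>L2_antisym. Q (cpair f)) \<longleftrightarrow> (\<forall>v. Q v)"
proof safe
  fix v assume *: "\<forall>f\<in>L2_antisym. Q (cpair f)"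
  obtain f where "f \<in> L2_antisym" "cpair f = v" using cpair_surj by blast
  then show "Q v" using * by blast
qed blast

lemma ex_cpair: "(\<exists>f\<in>L2_antisym. Q (cpair f)) \<longleftrightarrow> (\<exists>v. Q v)"
  using all_cpair[of "\<lambda>v. \<not> Q v"] by blast

lemma cpair_eq_iff:
  assumes "f \<in> L2_antisym" "g \<in> L2_antisym"
  shows "cpair f = cpair g \<longleftrightarrow> (AE x in torus3_sq. f x = g x)"
proof -
  have "cpair f = cpair g \<longleftrightarrow> (AE x in torus3_sq. Re (f x) = Re (g x)) \<and> (AE x in torus3_sq. Im (f x) = Im (g x))"
    using assms by (simp add: cpair_def cls_eq_iff L2_antisym_iff)
  also have "\<dots> \<longleftrightarrow> (AE x in torus3_sq. f x = g x)"
    unfolding AE_conj_iff[symmetric] by (simp add: complex_eq_iff)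
  finally show ?thesis .
qed

lemma cpair_zero: "(\<lambda>_. 0) \<in> L2_antisym" "cpair (\<lambda>_. 0) = 0"
  by (auto simp: L2_antisym_iff asym_zero cpair_def zero_asym_L2_def zero_prod_def)

lemma cpair_add:
  assumes "f \<in> L2_antisym" "g \<in> L2_antisym"
  shows "(\<lambda>x. f x + g x) \<in> L2_antisym" "cpair (\<lambda>x. f x + g x) = cpair f + cpair g"
  using assms by (auto simp: L2_antisym_iff cpair_def cls_add asym_add)

lemma cpair_diff:
  assumes "f \<in> L2_antisym" "g \<in> L2_antisym"
  shows "(\<lambda>x. f x - g x) \<in> L2_antisym" "cpair (\<lambda>x. f x - g x) = cpair f - cpair g"
  using assms by (auto simp: L2_antisym_iff cpair_def cls_diff asym_diff)

lemma cpair_cmult: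
  assumes "f \<in> L2_antisym"
  shows "(\<lambda>x. z * f x) \<in> L2_antisym" "cpair (\<lambda>x. z * f x) = cmul z (cpair f)"
  using assms by (auto simp: L2_antisym_iff cpair_def cmul_def cls_diff asym_diff cls_add asym_add asym_cmult cls_scaleR)

lemma L2_norm_cpair:
  assumes "f \<in> L2_antisym"
  shows "L2_norm torus3_sq f = norm (cpair f)"
proof -
  have f: "(\<lambda>x. Re (f x)) \<in> antisym_fun" "(\<lambda>x. Im (f x)) \<in> antisym_fun" using assms by (auto simp: L2_antisym_iff)
  have "(\<integral>x. (cmod (f x))\<^sup>2 \<partial>torus3_sq) = (\<integral>x. (Re (f x))\<^sup>2 \<partial>torus3_sq) + (\<integral>x. (Im (f x))\<^sup>2 \<partial>torus3_sq)"
    unfolding cmod_power2 using f[THEN asym_rL2, THEN rL2_sq] by simp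
  then show ?thesis by (simp add: L2_norm_def cpair_def norm_Pair cls_norm f)
qed

text \<open>Real and imaginary parts decouple because the coefficients of \<open>H\<close> are real.
  Only almost every section of \<open>f\<close> is integrable and satisfies the antisymmetry that
  converts the second integral, so the identity holds almost everywhere.\<close>

lemma H_AE:
  assumes f: "f \<in> L2_antisym"
  shows "AE x in torus3_sq. H \<gamma> l f x
    = Complex (H_real \<gamma> (l / (2 * pi) ^ 3) (\<lambda>x. Re (f x)) x) (H_real \<gamma> (l / (2 * pi) ^ 3) (\<lambda>x. Im (f x)) x)"
proof -
  define a b where "a = (\<lambda>x. Re (f x))" and "b = (\<lambda>x. Im (f x))"
  have ab: "a \<in> antisym_fun" "b \<in> antisym_fun" using f by (auto simp: L2_antisym_iff a_def b_def)
  have fm: "f \<in> borel_measurable torus3_sq" using f by (auto simp: L2_antisym_def L2_def)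
  have fab: "f x = Complex (a x) (b x)" for x by (simp add: a_def b_def)
  define \<Phi> where "\<Phi> = (\<lambda>q. Complex (marg a q) (marg b q))"
  have i: "integrable torus3_sq a" "integrable torus3_sq b"
    using ab[THEN asym_rL2] by (auto intro: torus3_sq.rL2_integrable)
  have anti: "AE x in torus3_sq. f (snd x, fst x) = - f x"
    using f by (auto simp: L2_antisym_def case_prod_beta' elim!: eventually_mono)
  have one: "AE q in torus3. (\<integral>s. f (s, q) \<partial>torus3) = \<Phi> q \<and> (\<integral>s. f (q, s) \<partial>torus3) = - \<Phi> q"
    using AE_integrable_sections[OF i(1)] AE_integrable_sections[OF i(2)] AE_sections[OF anti] AE_space
  proof eventually_elim
    case (elim q)
    have q: "q \<in> tset" using elim by (simp add: space_torus3)
    have ci: "integrable torus3 (\<lambda>s. f (s, q))"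
      unfolding fab Complex_eq using elim by (intro Bochner_Integration.integrable_add integrable_mult_right integrable_of_real)
    have 1: "(\<integral>s. f (s, q) \<partial>torus3) = \<Phi> q"
      using ci by (simp add: \<Phi>_def marg_def complex_eq_iff a_def b_def)
    have sec: "(\<lambda>s. f (s, q)) \<in> borel_measurable torus3" using ci by auto
    have sec2: "(\<lambda>s. f (q, s)) \<in> borel_measurable torus3"
    proof -
      have "(\<lambda>s. (q, s)) \<in> torus3 \<rightarrow>\<^sub>M torus3_sq"
        using q by (intro measurable_Pair measurable_const) (auto simp: space_torus3)
      then show ?thesis using fm by (rule measurable_compose)
    qed
    have "(\<integral>s. f (q, s) \<partial>torus3) = (\<integral>s. - f (s, q) \<partial>torus3)"
      by (rule integral_cong_AE[OF sec2]) (use sec elim in auto)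
    then show ?case using 1 by simp
  qed
  show ?thesis
    using AE_torus3_both[OF one]
  proof eventually_elim
    case (elim x)
    obtain p q where x: "x = (p, q)" by (cases x)
    define k where "k = l / (2 * pi) ^ 3"
    have "H \<gamma> l f x = of_real (disp \<gamma> p q) * f (p, q) - of_real k * (\<Phi> q - \<Phi> p)"
      unfolding H_def k_def[symmetric] using elim by (simp add: x algebra_simps)
    also have "\<dots> = Complex (H_real \<gamma> k a x) (H_real \<gamma> k b x)"
      by (simp add: complex_eq_iff \<Phi>_def H_real_def disp_pair_def dif_def x a_def b_def)
    finally show ?case by (simp only: a_def b_def k_def)
  qed
qed

definition H_complex :: "real \<Rightarrow> real \<Rightarrow> asym_L2 \<times> asym_L2 \<Rightarrow> asym_L2 \<times> asym_L2" where
  "H_complex \<gamma> l = map_prod (H_op \<gamma> (l / (2 * pi) ^ 3)) (H_op \<gamma> (l / (2 * pi) ^ 3))"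

text \<open>The bridge from the definitions on representatives to the Hilbert space:
  \<open>g = 0\<close> serves eigenvectors and injectivity, general \<open>g\<close> the bounded
  inverse.\<close>

lemma H_eq_iff:
  assumes f: "f \<in> L2_antisym" and g: "g \<in> L2_antisym"
  shows "(AE x in torus3_sq. H \<gamma> l f x - z * f x = g x)
    \<longleftrightarrow> H_complex \<gamma> l (cpair f) - cmul z (cpair f) = cpair g"
proof -
  define k where "k = l / (2 * pi) ^ 3"
  define h where "h = (\<lambda>x. Complex (H_real \<gamma> k (\<lambda>x. Re (f x)) x) (H_real \<gamma> k (\<lambda>x. Im (f x)) x))"
  have ab: "(\<lambda>x. Re (f x)) \<in> antisym_fun" "(\<lambda>x. Im (f x)) \<in> antisym_fun" using f by (auto simp: L2_antisym_iff)
  have h: "h \<in> L2_antisym" by (simp add: L2_antisym_iff h_def H_real_asym ab)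
  have ch: "cpair h = H_complex \<gamma> l (cpair f)"
    unfolding H_complex_def k_def[symmetric] by (simp add: cpair_def h_def H_op_cls ab)
  note zf = cpair_cmult[OF f, of z]
  note d = cpair_diff[OF h zf(1)]
  have "(AE x in torus3_sq. H \<gamma> l f x - z * f x = g x) \<longleftrightarrow> (AE x in torus3_sq. h x - z * f x = g x)"
    using H_AE[OF f, of \<gamma> l] unfolding k_def[symmetric] h_def[symmetric]
    by (intro eventually_subst) (auto simp: h_def elim!: eventually_mono)
  also have "\<dots> \<longleftrightarrow> cpair (\<lambda>x. h x - z * f x) = cpair g"
    by (rule cpair_eq_iff[OF d(1) g, symmetric])
  finally show ?thesis by (simp add: d zf ch)
qed

lemma eigenspace_iff:
  shows "f \<in> eigenspace torus3_sq L2_antisym (H \<gamma> l) z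
    \<longleftrightarrow> f \<in> L2_antisym \<and> H_complex \<gamma> l (cpair f) = cmul z (cpair f)"
proof (cases "f \<in> L2_antisym")
  case True
  then show ?thesis
    using H_eq_iff[OF True cpair_zero(1), of \<gamma> l z]
    by (simp add: eigenspace_def cpair_zero(2))
qed (simp add: eigenspace_def)

lemma is_eigenvalue_iff:
  shows "is_eigenvalue torus3_sq L2_antisym (H \<gamma> l) z
    \<longleftrightarrow> (\<exists>v. v \<noteq> 0 \<and> H_complex \<gamma> l v = cmul z v)"
proof -
  have "(AE x in torus3_sq. f x = 0) \<longleftrightarrow> cpair f = 0" if "f \<in> L2_antisym" for f
    using cpair_eq_iff[OF that cpair_zero(1)] by (simp add: cpair_zero(2))
  then have "is_eigenvalue torus3_sq L2_antisym (H \<gamma> l) z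
      \<longleftrightarrow> (\<exists>f\<in>L2_antisym. cpair f \<noteq> 0 \<and> H_complex \<gamma> l (cpair f) = cmul z (cpair f))"
    unfolding is_eigenvalue_def Bex_def eigenspace_iff by blast
  also have "\<dots> \<longleftrightarrow> (\<exists>v. v \<noteq> 0 \<and> H_complex \<gamma> l v = cmul z v)"
    by (rule ex_cpair)
  finally show ?thesis .
qed

lemma resolvent_iff:
  shows "z \<in> resolvent_set torus3_sq L2_antisym (H \<gamma> l)
    \<longleftrightarrow> (\<forall>v. H_complex \<gamma> l v = cmul z v \<longrightarrow> v = 0) \<and>
       (\<exists>C. \<forall>g. \<exists>v. H_complex \<gamma> l v - cmul z v = g \<and> norm v \<le> C * norm g)"
proof -
  have z: "(AE x in torus3_sq. f x = 0) \<longleftrightarrow> cpair f = 0" if "f \<in> L2_antisym" for f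
    using cpair_eq_iff[OF that cpair_zero(1)] by (simp add: cpair_zero(2))
  have e: "(AE x in torus3_sq. H \<gamma> l f x - z * f x = 0) \<longleftrightarrow> H_complex \<gamma> l (cpair f) = cmul z (cpair f)"
    if "f \<in> L2_antisym" for f
    using H_eq_iff[OF that cpair_zero(1), of \<gamma> l z] by (simp add: cpair_zero(2))
  have 1: "(\<forall>f\<in>L2_antisym. (AE x in torus3_sq. H \<gamma> l f x - z * f x = 0) \<longrightarrow> (AE x in torus3_sq. f x = 0))
    \<longleftrightarrow> (\<forall>v. H_complex \<gamma> l v = cmul z v \<longrightarrow> v = 0)"
  proof -
    have "(\<forall>f\<in>L2_antisym. (AE x in torus3_sq. H \<gamma> l f x - z * f x = 0) \<longrightarrow> (AE x in torus3_sq. f x = 0))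
      \<longleftrightarrow> (\<forall>f\<in>L2_antisym. H_complex \<gamma> l (cpair f) = cmul z (cpair f) \<longrightarrow> cpair f = 0)"
      by (intro ball_cong refl) (simp only: e z)
    also have "\<dots> \<longleftrightarrow> (\<forall>v. H_complex \<gamma> l v = cmul z v \<longrightarrow> v = 0)" by (rule all_cpair)
    finally show ?thesis .
  qed
  have 2: "(\<forall>g\<in>L2_antisym. \<exists>f\<in>L2_antisym. (AE x in torus3_sq. H \<gamma> l f x - z * f x = g x)
       \<and> L2_norm torus3_sq f \<le> C * L2_norm torus3_sq g)
    \<longleftrightarrow> (\<forall>g. \<exists>v. H_complex \<gamma> l v - cmul z v = g \<and> norm v \<le> C * norm g)" for C
  proof -
    have "(\<forall>g\<in>L2_antisym. \<exists>f\<in>L2_antisym. (AE x in torus3_sq. H \<gamma> l f x - z * f x = g x)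
         \<and> L2_norm torus3_sq f \<le> C * L2_norm torus3_sq g)
      \<longleftrightarrow> (\<forall>g\<in>L2_antisym. \<exists>f\<in>L2_antisym. H_complex \<gamma> l (cpair f) - cmul z (cpair f) = cpair g
         \<and> norm (cpair f) \<le> C * norm (cpair g))"
      by (intro ball_cong bex_cong refl) (simp add: H_eq_iff L2_norm_cpair )
    also have "\<dots> \<longleftrightarrow> (\<forall>g\<in>L2_antisym. \<exists>v. H_complex \<gamma> l v - cmul z v = cpair g \<and> norm v \<le> C * norm (cpair g))"
      by (intro ball_cong refl ex_cpair)
    also have "\<dots> \<longleftrightarrow> (\<forall>g. \<exists>v. H_complex \<gamma> l v - cmul z v = g \<and> norm v \<le> C * norm g)" by (rule all_cpair)
    finally show ?thesis .
  qed
  show ?thesis unfolding resolvent_set_def mem_Collect_eq 1 2 ..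
qed

lemma cmul_of_real: "cmul (of_real r) v = r *\<^sub>R v"
  by (cases v) (simp add: cmul_def)

text \<open>Linear dependence is a notion for sets and does not see repetitions, so a repeated
  vector is treated separately, by the difference of two occurrences. Otherwise there are more
  distinct vectors than the dimension allows.\<close>

lemma complex_homogeneous_system:
  fixes c :: "nat \<Rightarrow> complex ^ 3"
  assumes n: "3 < n"
  shows "\<exists>d. (\<exists>j<n. d j \<noteq> 0) \<and> (\<forall>i. (\<Sum>j<n. d j * c j $ i) = 0)"
proof (cases "inj_on c {..<n}")
  case False
  then obtain j k where jk: "j < n" "k < n" "j \<noteq> k" "c j = c k" by (auto simp: inj_on_def)
  define d :: "nat \<Rightarrow> complex" where "d = (\<lambda>m. (if m = j then 1 else 0) - (if m = k then 1 else 0))"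
  have "(\<Sum>m<n. d m * c m $ i) = (\<Sum>m<n. if m = j then c m $ i else 0) - (\<Sum>m<n. if m = k then c m $ i else 0)" for i
    unfolding sum_subtractf[symmetric] by (rule sum.cong) (auto simp: d_def)
  then have "(\<Sum>m<n. d m * c m $ i) = 0" for i using jk by simp
  moreover have "d j \<noteq> 0" using jk by (simp add: d_def)
  ultimately show ?thesis using jk(1) by blast
next
  case True
  have "vec.dependent (c ` {..<n})"
  proof (rule ccontr)
    assume i: "\<not> vec.dependent (c ` {..<n})"
    have "card (c ` {..<n}) \<le> vec.dim (UNIV :: (complex ^ 3) set)"
      by (rule vec.independent_card_le_dim[OF _ i]) simp
    then show False using n by (simp add: card_image[OF True] vec_dim_card card_cart_basis)
  qed
  then obtain u where u: "\<exists>v\<in>c ` {..<n}. u v \<noteq> 0" "(\<Sum>v\<in>c ` {..<n}. u v *s v) = 0"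
    by (subst (asm) vec.dependent_finite) auto
  have "(\<Sum>j<n. u (c j) *s c j) = 0" using u(2) by (simp add: sum.reindex[OF True])
  then have "(\<Sum>j<n. u (c j) *s c j) $ i = 0" for i by simp
  then have "(\<Sum>j<n. u (c j) * c j $ i) = 0" for i by (simp add: sum_component)
  then show ?thesis using u(1) by (intro exI[of _ "\<lambda>j. u (c j)"]) auto
qed

section \<open>Spectra of operators with a gap\<close>

locale H_gap = spectral_gap "H_op \<gamma> (l / (2 * pi) ^ 3)" I e u z \<tau>
  for \<gamma> l :: real and I :: "3 set" and e u :: "3 \<Rightarrow> asym_L2" and z \<tau> :: real
begin

lemma H_resolvent:
  assumes w: "Re w < \<tau>" "w \<noteq> of_real z"
  shows "w \<in> resolvent_set torus3_sq L2_antisym (H \<gamma> l)"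
proof -
  have "v = 0" if v: "H_complex \<gamma> l v = cmul w v" for v
  proof (rule ccontr)
    assume v0: "v \<noteq> 0"
    have im: "Im w = 0" by (rule eigen_complex[OF _ v0]) (use v in \<open>simp add: H_complex_def\<close>)
    obtain a b where ab: "v = (a, b)" by (cases v)
    have "H_op \<gamma> (l / (2 * pi) ^ 3) a = Re w *\<^sub>R a" "H_op \<gamma> (l / (2 * pi) ^ 3) b = Re w *\<^sub>R b"
      using v im by (simp_all only: H_complex_def ab map_prod_simp cmul_def) simp_all
    then have "Re w = z" using eigen_low[of a "Re w"] eigen_low[of b "Re w"] v0 w(1) by (auto simp: ab zero_prod_def)
    then show False using w(2) im by (simp add: complex_eq_iff)
  qed
  then show ?thesis
    unfolding resolvent_iff using resolvent_bound[OF w] by (simp add: H_complex_def)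
qed

lemma H_eigen:
  assumes v: "H_complex \<gamma> l v = cmul (of_real x) v" "v \<noteq> 0" "x \<le> \<tau>"
  shows "x = z" "fst v = P (fst v)" "snd v = P (snd v)"
proof -
  obtain a b where ab: "v = (a, b)" by (cases v)
  have T: "H_op \<gamma> (l / (2 * pi) ^ 3) a = x *\<^sub>R a" "H_op \<gamma> (l / (2 * pi) ^ 3) b = x *\<^sub>R b"
    using v(1) unfolding cmul_of_real by (simp_all only: H_complex_def ab map_prod_simp scaleR_Pair prod.inject)
  have P0: "P 0 = 0" by (simp add: P_def)
  show "x = z" using eigen_low[OF T(1)] eigen_low[OF T(2)] v by (auto simp: ab zero_prod_def)
  show "fst v = P (fst v)" using eigen_low[OF T(1)] v(3) P0 by (cases "a = 0") (auto simp: ab)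
  show "snd v = P (snd v)" using eigen_low[OF T(2)] v(3) P0 by (cases "b = 0") (auto simp: ab)
qed

lemma not_eigenvalue:
  assumes "x \<le> \<tau>" "x \<noteq> z"
  shows "\<not> is_eigenvalue torus3_sq L2_antisym (H \<gamma> l) (of_real x)"
  unfolding is_eigenvalue_iff using H_eigen(1) assms by blast

text \<open>A bounded inverse at \<tau> is incompatible with approximate eigenvectors: by
  injectivity the preimage of \<open>(H - \<tau>) a\<close> is \<open>a\<close> itself, and its norm
  would exceed the bound. As \<tau> is not an eigenvalue, it is not in the discrete spectrum
  either.\<close>

lemma threshold_spectrum:
  assumes weyl: "\<And>c. 0 < c \<Longrightarrow> \<exists>a. a \<noteq> 0 \<and> norm (H_op \<gamma> (l / (2 * pi) ^ 3) a - \<tau> *\<^sub>R a) < c * norm a"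
  shows "of_real \<tau> \<in> essential_spectrum torus3_sq L2_antisym (H \<gamma> l)"
proof -
  have "of_real \<tau> \<notin> resolvent_set torus3_sq L2_antisym (H \<gamma> l)"
  proof
    assume "of_real \<tau> \<in> resolvent_set torus3_sq L2_antisym (H \<gamma> l)"
    then obtain C where inj: "\<And>v. H_complex \<gamma> l v = cmul (of_real \<tau>) v \<Longrightarrow> v = 0"
      and C: "\<And>g. \<exists>v. H_complex \<gamma> l v - cmul (of_real \<tau>) v = g \<and> norm v \<le> C * norm g"
      unfolding resolvent_iff by blast
    \<comment> \<open>The bound \<open>C\<close> need not be positive, but the accuracy
      \<open>1 / D\<close> must be.\<close>
    define D where "D = max C 1"
    have D: "0 < D" "C \<le> D" by (auto simp: D_def)
    obtain a where a: "a \<noteq> 0" "norm (H_op \<gamma> (l / (2 * pi) ^ 3) a - \<tau> *\<^sub>R a) < 1 / D * norm a"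
      using weyl[of "1 / D"] D by auto
    define g where "g = (H_op \<gamma> (l / (2 * pi) ^ 3) a - \<tau> *\<^sub>R a, 0 :: asym_L2)"
    have lin: "linear (H_op \<gamma> (l / (2 * pi) ^ 3))" by (rule H_op_linear)
    have eq: "H_complex \<gamma> l (a, 0) - cmul (of_real \<tau>) (a, 0) = g"
      unfolding cmul_of_real g_def H_complex_def by (simp only: map_prod_simp linear_0[OF lin] scaleR_Pair) simp
    obtain v where v: "H_complex \<gamma> l v - cmul (of_real \<tau>) v = g" "norm v \<le> C * norm g" using C by blast
    have "H_complex \<gamma> l (v - (a, 0)) - cmul (of_real \<tau>) (v - (a, 0))
        = (H_complex \<gamma> l v - cmul (of_real \<tau>) v) - (H_complex \<gamma> l (a, 0) - cmul (of_real \<tau>) (a, 0))"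
      unfolding cmul_of_real H_complex_def
      by (cases v) (simp only: map_prod_simp diff_Pair linear_diff[OF lin] scaleR_diff_right scaleR_Pair prod.inject; simp add: algebra_simps)
    then have "v - (a, 0) = 0" unfolding v(1) eq by (intro inj) simp
    then have va: "v = (a, 0)" by simp
    have "norm a = norm v" by (simp add: va)
    also have "\<dots> \<le> D * norm g" using v(2) D by (meson mult_right_mono norm_ge_zero order_trans)
    also have "\<dots> < D * (1 / D * norm a)" using a(2) D by (intro mult_strict_left_mono) (auto simp: g_def)
    finally show False using D by simp
  qed
  then have s: "of_real \<tau> \<in> spectrum torus3_sq L2_antisym (H \<gamma> l)" by (simp add: spectrum_def)
  have "\<not> is_eigenvalue torus3_sq L2_antisym (H \<gamma> l) (of_real \<tau>)" by (rule not_eigenvalue) (use z\<tau> in auto)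
  then show ?thesis using s by (simp add: essential_spectrum_def discrete_spectrum_def)
qed

text \<open>Below \<tau> only \<open>z\<close> can belong to the spectrum, and it is excluded by
  assumption, so the infimum is attained at \<tau>.\<close>

lemma ess_inf_eq:
  assumes weyl: "\<And>c. 0 < c \<Longrightarrow> \<exists>a. a \<noteq> 0 \<and> norm (H_op \<gamma> (l / (2 * pi) ^ 3) a - \<tau> *\<^sub>R a) < c * norm a"
    and z: "of_real z \<notin> essential_spectrum torus3_sq L2_antisym (H \<gamma> l)"
  shows "ess_inf torus3_sq L2_antisym (H \<gamma> l) = \<tau>"
  unfolding ess_inf_def
proof (rule cInf_eq_minimum)
  show "\<tau> \<in> {x. complex_of_real x \<in> essential_spectrum torus3_sq L2_antisym (H \<gamma> l)}"
    using threshold_spectrum[OF weyl] by simp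
  fix x assume "x \<in> {x. complex_of_real x \<in> essential_spectrum torus3_sq L2_antisym (H \<gamma> l)}"
  then have x: "of_real x \<in> essential_spectrum torus3_sq L2_antisym (H \<gamma> l)" by simp
  show "\<tau> \<le> x"
  proof (rule ccontr)
    assume "\<not> \<tau> \<le> x"
    then have "of_real x \<in> resolvent_set torus3_sq L2_antisym (H \<gamma> l)"
      using x z by (intro H_resolvent) auto
    then show False using x by (simp add: essential_spectrum_def spectrum_def)
  qed
qed

lemma eigenspace_expansion:
  assumes f: "f \<in> eigenspace torus3_sq L2_antisym (H \<gamma> l) (of_real z)"
  defines "c \<equiv> \<lambda>i. Complex (fst (cpair f) \<bullet> e i) (snd (cpair f) \<bullet> e i)"
  shows "cpair f = ((\<Sum>i\<in>I. Re (c i) *\<^sub>R e i), (\<Sum>i\<in>I. Im (c i) *\<^sub>R e i))"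
proof (cases "cpair f = 0")
  case True
  then show ?thesis by (simp add: c_def zero_prod_def)
next
  case False
  have "H_complex \<gamma> l (cpair f) = cmul (of_real z) (cpair f)" using f by (simp add: eigenspace_iff)
  from H_eigen(2,3)[OF this False] z\<tau> show ?thesis
    by (intro prod_eqI) (simp_all add: c_def P_def)
qed

lemma eigenspace_e:
  assumes "i \<in> I"
  shows "(\<lambda>x. of_real (rp (e i) x)) \<in> eigenspace torus3_sq L2_antisym (H \<gamma> l) (of_real z)"
    "cpair (\<lambda>x. of_real (rp (e i) x)) = (e i, 0)"
proof -
  show c: "cpair (\<lambda>x. of_real (rp (e i) x)) = (e i, 0)" by (simp add: cpair_def zero_asym_L2_def)
  have "H_complex \<gamma> l (e i, 0) = z *\<^sub>R (e i, 0)"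
    unfolding H_complex_def by (simp only: map_prod_simp linear_0[OF H_op_linear] Te[OF assms] scaleR_Pair) simp
  then show "(\<lambda>x. of_real (rp (e i) x)) \<in> eigenspace torus3_sq L2_antisym (H \<gamma> l) (of_real z)"
    by (simp add: eigenspace_iff c cmul_of_real L2_antisym_iff asym_zero)
qed

lemma cpair_sum:
  assumes "finite J" "\<And>j. j \<in> J \<Longrightarrow> f j \<in> L2_antisym"
  shows "(\<lambda>x. \<Sum>j\<in>J. d j * f j x) \<in> L2_antisym \<and> cpair (\<lambda>x. \<Sum>j\<in>J. d j * f j x) = (\<Sum>j\<in>J. cmul (d j) (cpair (f j)))"
  using assms by (induction J rule: finite_induct) (auto simp: cpair_zero cpair_add cpair_cmult)

text \<open>The lower bound comes from the three orthonormal eigenvectors, read as complex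
  functions. For the upper bound, the coefficient vectors of more than three eigenfunctions satisfy
  a linear relation, which passes to the functions by \<open>eigenspace_expansion\<close>.\<close>

lemma multiplicity_three:
  assumes I: "I = UNIV"
  shows "multiplicity_ev torus3_sq L2_antisym (H \<gamma> l) (of_real z) = 3"
proof -
  define S where "S = {n. \<exists>b. (\<forall>i<n. b i \<in> eigenspace torus3_sq L2_antisym (H \<gamma> l) (of_real z)) \<and> lin_indep_AE torus3_sq n b}"
  have "3 \<in> S"
  proof -
    define ix :: "nat \<Rightarrow> 3" where "ix = (\<lambda>m. if m = 0 then 1 else if m = 1 then 2 else 3)"
    have ix: "ix i = ix j \<longleftrightarrow> i = j" if "i < 3" "j < 3" for i j
      using that by (auto simp: ix_def numeral_3_eq_3 less_Suc_eq)
    define b where "b = (\<lambda>m x. complex_of_real (rp (e (ix m)) x))"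
    have be: "b m \<in> eigenspace torus3_sq L2_antisym (H \<gamma> l) (of_real z)" and bc: "cpair (b m) = (e (ix m), 0)" for m
      using eigenspace_e[of "ix m"] I by (auto simp: b_def)
    have bL: "b m \<in> L2_antisym" for m using be[of m] by (simp add: eigenspace_iff)
    have "lin_indep_AE torus3_sq 3 b"
      unfolding lin_indep_AE_def
    proof (intro allI impI)
      fix c :: "nat \<Rightarrow> complex" and j :: nat
      assume ae: "AE x in torus3_sq. (\<Sum>i<3. c i * b i x) = 0" and j: "j < 3"
      have s: "(\<lambda>x. \<Sum>i<3. c i * b i x) \<in> L2_antisym"
        "cpair (\<lambda>x. \<Sum>i<3. c i * b i x) = (\<Sum>i<3. cmul (c i) (cpair (b i)))"
        using cpair_sum[of "{..<3::nat}" b c] bL by auto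
      have "(\<Sum>i<3. cmul (c i) (cpair (b i))) = 0"
        using cpair_eq_iff[OF s(1) cpair_zero(1)] ae by (simp add: s(2) cpair_zero(2))
      \<comment> \<open>Pairing with \<open>(e (ix j), 0)\<close> and \<open>(0, e (ix j))\<close>
        reads off the real and the imaginary part of \<open>c j\<close>.\<close>
      then have "(\<Sum>i<3. cmul (c i) (cpair (b i))) \<bullet> (e (ix j), 0) = 0" "(\<Sum>i<3. cmul (c i) (cpair (b i))) \<bullet> (0, e (ix j)) = 0"
        by simp_all
      moreover have "cmul (c i) (cpair (b i)) \<bullet> (e (ix j), 0) = (if i = j then Re (c i) else 0)"
        "cmul (c i) (cpair (b i)) \<bullet> (0, e (ix j)) = (if i = j then Im (c i) else 0)" if "i < 3" for i
        using on[of "ix i" "ix j"] ix[OF that j] I by (auto simp: bc cmul_def)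
      ultimately have "(\<Sum>i<3. if i = j then Re (c i) else 0) = 0" "(\<Sum>i<3. if i = j then Im (c i) else 0) = 0"
        unfolding inner_sum_left by (simp_all cong: sum.cong_simp)
      then show "c j = 0" using j by (simp add: complex_eq_iff)
    qed
    then show ?thesis unfolding S_def using be by blast
  qed
  moreover have "n \<le> 3" if nS: "n \<in> S" for n
  proof (rule ccontr)
    assume "\<not> n \<le> 3"
    then have n: "3 < n" by simp
    obtain b where "\<forall>i<n. b i \<in> eigenspace torus3_sq L2_antisym (H \<gamma> l) (of_real z)" "lin_indep_AE torus3_sq n b"
      using nS unfolding S_def by blast
    then have b: "\<And>i. i < n \<Longrightarrow> b i \<in> eigenspace torus3_sq L2_antisym (H \<gamma> l) (of_real z)"
      and li: "lin_indep_AE torus3_sq n b" by auto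
    define c where "c = (\<lambda>j. \<chi> i. Complex (fst (cpair (b j)) \<bullet> e i) (snd (cpair (b j)) \<bullet> e i))"
    obtain d where d: "\<exists>j<n. d j \<noteq> 0" "\<And>i. (\<Sum>j<n. d j * c j $ i) = 0"
      using complex_homogeneous_system[OF n, of c] by blast
    have bL: "b j \<in> L2_antisym" if "j < n" for j using b[OF that] by (simp add: eigenspace_iff)
    have s: "(\<lambda>x. \<Sum>j<n. d j * b j x) \<in> L2_antisym"
      "cpair (\<lambda>x. \<Sum>j<n. d j * b j x) = (\<Sum>j<n. cmul (d j) (cpair (b j)))"
      using cpair_sum[of "{..<n}" b d] bL by auto
    have cp: "cpair (b j) = (\<Sum>i\<in>UNIV. cmul (c j $ i) (e i, 0))" if "j < n" for j
      using eigenspace_expansion[OF b[OF that]] I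
      by (simp add: c_def cmul_def prod_eq_iff fst_sum snd_sum)
    have "(\<Sum>j<n. cmul (d j) (cpair (b j))) = (\<Sum>j<n. \<Sum>i\<in>UNIV. cmul (d j * c j $ i) (e i, 0))"
    proof (rule sum.cong[OF refl])
      fix j assume "j \<in> {..<n}"
      then show "cmul (d j) (cpair (b j)) = (\<Sum>i\<in>UNIV. cmul (d j * c j $ i) (e i, 0))"
        by (simp only: cp lessThan_iff cmul_cmul[symmetric])
           (rule linear_sum[OF bounded_linear.linear[OF cmul_bl]])
    qed
    also have "\<dots> = (\<Sum>i\<in>UNIV. \<Sum>j<n. cmul (d j * c j $ i) (e i, 0))" by (rule sum.swap)
    also have "\<dots> = (\<Sum>i\<in>UNIV. cmul (\<Sum>j<n. d j * c j $ i) (e i, 0))"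
      by (rule sum.cong) (auto simp: cmul_def prod_eq_iff fst_sum snd_sum scaleR_sum_left)
    also have "\<dots> = 0" unfolding d(2) by (simp add: cmul_def zero_prod_def[symmetric])
    finally have "AE x in torus3_sq. (\<Sum>j<n. d j * b j x) = 0"
      using cpair_eq_iff[OF s(1) cpair_zero(1)] by (simp add: s(2) cpair_zero(2))
    then show False using li d(1) unfolding lin_indep_AE_def by blast
  qed
  ultimately have "(SUP n\<in>S. enat n) = enat 3"
    by (intro antisym SUP_least SUP_upper) auto
  then show ?thesis by (simp add: multiplicity_ev_def S_def numeral_eq_enat)
qed

text \<open>The disc of radius \<open>\<tau> - z\<close> about \<open>z\<close> lies in the half
  plane where \<open>z\<close> is the only possible point of the spectrum, so \<open>z\<close> is
  isolated; its multiplicity is finite.\<close>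

lemma z_not_essential:
  assumes I: "I = UNIV"
  shows "of_real z \<notin> essential_spectrum torus3_sq L2_antisym (H \<gamma> l)"
    "is_eigenvalue torus3_sq L2_antisym (H \<gamma> l) (of_real z)"
proof -
  define f where "f = (\<lambda>x. complex_of_real (rp (e 1) x))"
  have f: "f \<in> eigenspace torus3_sq L2_antisym (H \<gamma> l) (of_real z)" "cpair f = (e 1, 0)"
    using eigenspace_e[of 1] I by (auto simp: f_def)
  have "e 1 \<noteq> 0" using on[of 1 1] I by auto
  then have v: "(e 1, 0) \<noteq> (0 :: asym_L2 \<times> asym_L2)" by (simp add: zero_prod_def)
  show ev: "is_eigenvalue torus3_sq L2_antisym (H \<gamma> l) (of_real z)"
    unfolding is_eigenvalue_iff using v f by (auto simp: eigenspace_iff intro!: exI[of _ "(e 1, 0)"])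
  have "\<not> of_real z islimpt spectrum torus3_sq L2_antisym (H \<gamma> l)"
  proof
    assume "of_real z islimpt spectrum torus3_sq L2_antisym (H \<gamma> l)"
    then obtain w where w: "w \<in> spectrum torus3_sq L2_antisym (H \<gamma> l)" "w \<noteq> of_real z" "dist w (of_real z) < \<tau> - z"
      unfolding islimpt_approachable using z\<tau> by (meson diff_gt_0_iff_gt)
    have "Re w - z \<le> cmod (w - of_real z)" using complex_Re_le_cmod[of "w - of_real z"] by simp
    then have "Re w < \<tau>" using w(3) by (simp add: dist_norm)
    then show False using H_resolvent[of w] w by (simp add: spectrum_def)
  qed
  moreover have "multiplicity_ev torus3_sq L2_antisym (H \<gamma> l) (of_real z) < \<infinity>"
    by (simp add: multiplicity_three[OF I])
  ultimately show "of_real z \<notin> essential_spectrum torus3_sq L2_antisym (H \<gamma> l)"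
    using ev by (simp add: essential_spectrum_def discrete_spectrum_def)
qed

end

section \<open>Parity of the eigenfunctions\<close>

lemma gamma1_pos: "0 < gamma1"
  using sin_mass_pos by (simp add: gamma1_eq)

lemma reflect_all:
  assumes x: "x \<in> tset \<times> tset" and "(\<forall>i. fst x $ i \<noteq> pi) \<and> (\<forall>i. snd x $ i \<noteq> pi)"
  shows "both (reflect 3) (both (reflect 2) (both (reflect 1) x)) = (- fst x, - snd x)"
proof -
  have "reflect 3 (reflect 2 (reflect 1 p)) = - p" if p: "p \<in> tset" "\<forall>i. p $ i \<noteq> pi" for p
  proof -
    have "p $ i < pi" for i using p by (auto simp: order_less_le)
    then show ?thesis by (simp add: vec_eq_iff forall_3 reflect_nth)
  qed
  moreover have "fst x \<in> tset" "snd x \<in> tset" using x by auto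
  ultimately show ?thesis using assms(2) by (simp add: both_def)
qed

text \<open>The three reflections together send \<open>(p, q)\<close> to \<open>(- p, - q)\<close> up to a null set, and each
  \<open>sector i\<close> is odd under exactly one of them.\<close>

lemma sector_odd:
  assumes a: "a \<in> sector i"
  shows "AE x in torus3_sq. rp a (- fst x, - snd x) = - rp a x"
proof -
  define U where "U = (\<lambda>j. Usym (reflect j))"
  have lin: "U j (c *\<^sub>R b) = c *\<^sub>R U j b" for j c b
    unfolding U_def by (rule linear_scale[OF bounded_linear.linear[OF Usym_bl[OF mpres_reflect]]])
  define s :: "3 \<Rightarrow> real" where "s = (\<lambda>j. if j = i then - 1 else 1)"
  have Ua: "U j a = s j *\<^sub>R a" for j unfolding U_def s_def by (rule sector_D[OF a])
  have "U 1 (U 2 (U 3 a)) = (s 3 * s 2 * s 1) *\<^sub>R a"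
    by (simp only: Ua lin scaleR_scaleR)
  also have "s 3 * s 2 * s 1 = - 1"
    using exhaust_3[of i] by (elim disjE) (simp_all add: s_def)
  finally have u1: "U 1 (U 2 (U 3 a)) = - a" by simp
  have u2: "U 1 (U 2 (U 3 a)) = cls (\<lambda>x. rp a (both (reflect 3) (both (reflect 2) (both (reflect 1) x))))"
    unfolding U_def Usym_compose[OF mpres_reflect mpres_reflect, of 2 3]
    by (rule Usym_cls[OF mpres_reflect both_asym[OF mpres_reflect both_asym[OF mpres_reflect rp_asym]]])
  have u3: "- a = cls (\<lambda>x. (- 1) * rp a x)"
    using cls_scaleR[OF rp_asym, of "- 1" a] by simp
  have "AE x in torus3_sq. rp a (both (reflect 3) (both (reflect 2) (both (reflect 1) x))) = (- 1) * rp a x"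
    by (rule cls_eq_iff[THEN iffD1, OF
          both_asym[OF mpres_reflect both_asym[OF mpres_reflect both_asym[OF mpres_reflect rp_asym]]]
          asym_cmult[OF rp_asym] trans[OF u2[symmetric] trans[OF u1 u3]]])
  then show ?thesis using AE_torus3_both[OF AE_torus3_interior] AE_space
  proof eventually_elim
    case (elim x)
    then show ?case using reflect_all[of x] by (simp add: space_torus3_sq)
  qed
qed

context H_gap
begin

text \<open>Almost everywhere \<open>f\<close> is a complex combination of the \<open>e i\<close>,
  which are odd by \<open>sector_odd\<close>.\<close>

lemma eigenspace_odd:
  assumes e: "\<And>i. e i \<in> sector i" and f: "f \<in> eigenspace torus3_sq L2_antisym (H \<gamma> l) (of_real z)"
  shows "odd_AE f"
proof -
  define c where "c = (\<lambda>i. Complex (fst (cpair f) \<bullet> e i) (snd (cpair f) \<bullet> e i))"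
  define g where "g = (\<lambda>x. \<Sum>i\<in>I. c i * of_real (rp (e i) x))"
  have fL: "f \<in> L2_antisym" using f by (simp add: eigenspace_iff)
  have bL: "(\<lambda>x. complex_of_real (rp (e i) x)) \<in> L2_antisym" for i by (simp add: L2_antisym_iff asym_zero)
  have gL: "g \<in> L2_antisym" "cpair g = (\<Sum>i\<in>I. cmul (c i) (cpair (\<lambda>x. complex_of_real (rp (e i) x))))"
    using cpair_sum[OF I, of "\<lambda>i x. complex_of_real (rp (e i) x)" c] bL by (auto simp: g_def)
  have "cpair g = (\<Sum>i\<in>I. cmul (c i) (e i, 0))"
    unfolding gL(2) by (intro sum.cong refl) (simp add: eigenspace_e)
  also have "\<dots> = cpair f"
    by (subst eigenspace_expansion[OF f]) (simp add: c_def[symmetric] cmul_def prod_eq_iff fst_sum snd_sum, simp add: c_def)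
  finally have fg: "AE x in torus3_sq. g x = f x" using cpair_eq_iff[OF gL(1) fL] by simp
  \<comment> \<open>Equality almost everywhere is carried to the reflected points: the three
    reflections preserve null sets and compose to the point reflection away from the faces of the
    cube.\<close>
  moreover have "AE x in torus3_sq. g (- fst x, - snd x) = f (- fst x, - snd x)"
  proof -
    note mpres_AE[OF mpres_reflect fg, of 3]
    note mpres_AE[OF mpres_reflect this, of 2]
    note mpres_AE[OF mpres_reflect this, of 1]
    then show ?thesis using AE_torus3_both[OF AE_torus3_interior] AE_space
    proof eventually_elim
      case (elim x)
      show ?case using elim reflect_all[of x] by (simp add: space_torus3_sq)
    qed
  qed
  moreover have "AE x in torus3_sq. \<forall>i. rp (e i) (- fst x, - snd x) = - rp (e i) x"
    using sector_odd[OF e] by (simp add: AE_all_countable)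
  ultimately have "AE x in torus3_sq. f (- fst x, - snd x) = - f x"
  proof eventually_elim
    case (elim x)
    have "g (- fst x, - snd x) = - g x" by (simp add: g_def elim(3) sum_negf)
    then show ?case using elim by simp
  qed
  then show ?thesis by (simp add: odd_AE_def case_prod_beta')
qed

end

section \<open>The two regimes and the thresholds\<close>

lemma no_eigenvalues_below_gamma1:
  assumes \<gamma>: "0 < \<gamma>" "\<gamma> < gamma1"
  shows "\<exists>l1>0. \<forall>l>l1. eigenvalues_below torus3_sq L2_antisym (H \<gamma> l) = {}"
proof -
  define d where "d = 1 - \<gamma> / gamma1"
  have d: "0 < d" using \<gamma> by (simp add: d_def)
  \<comment> \<open>The second entry gives \<open>C2 / w < d\<close> for all
    \<open>w \<ge> w0\<close>; it can be fixed beforehand because \<open>C2\<close> depends on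
    \<gamma> only.\<close>
  define w0 where "w0 = max (2 * (6 + 3 * \<gamma>)) (coupling.C2 \<gamma> / d + 1)"
  have w0: "2 * (6 + 3 * \<gamma>) \<le> w0" by (simp add: w0_def)
  obtain k0 where k0: "0 < k0" "\<And>k. k > k0 \<Longrightarrow> \<exists>w\<ge>w0. coupling \<gamma> w k"
    using coupling_exists[OF \<gamma>(1), of w0] w0 by blast
  have "eigenvalues_below torus3_sq L2_antisym (H \<gamma> l) = {}" if l: "l > k0 * (2 * pi) ^ 3" for l
  proof -
    define k where "k = l / (2 * pi) ^ 3"
    have "k > k0" using l by (simp add: k_def pos_less_divide_eq)
    then obtain w where ww: "w \<ge> w0" "coupling \<gamma> w k" using k0 by blast
    interpret coupling \<gamma> w k by (rule ww(2))
    have "C2 / d + 1 \<le> w" using ww(1) unfolding w0_def by (simp only: max.bounded_iff)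
    then have "C2 / d < w" "0 < w" using s0w by auto
    then have "C2 / w < d" using d by (simp add: field_simps)
    then have c: "C2 / w + \<gamma> / gamma1 < 1" by (simp add: d_def)
    have gap: "H_gap \<gamma> l {} (\<lambda>_. 0) sin_vec z \<tau>" if "z < \<tau>" for z
      unfolding H_gap_def k_def[symmetric] by (rule gap_below[OF c that])
    \<comment> \<open>Any auxiliary \<open>z\<close> different from \<open>x\<close> shows that
      \<open>x\<close> is not an eigenvalue.\<close>
    have no: "\<not> is_eigenvalue torus3_sq L2_antisym (H \<gamma> l) (of_real x)" if "x < \<tau>" for x
      using H_gap.not_eigenvalue[OF gap[of "x - 1"], of x] that by simp
    have wl: "\<exists>a. a \<noteq> 0 \<and> norm (H_op \<gamma> (l / (2 * pi) ^ 3) a - \<tau> *\<^sub>R a) < c * norm a" if "0 < c" for c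
      unfolding k_def[symmetric] by (rule weyl[OF that])
    \<comment> \<open>The auxiliary value \<open>\<tau> - 1\<close> inserted into
      \<open>ess_inf_eq\<close> is shown to be regular with another auxiliary value,
      \<open>\<tau> - 2\<close>.\<close>
    have "of_real (\<tau> - 1) \<in> resolvent_set torus3_sq L2_antisym (H \<gamma> l)"
      by (rule H_gap.H_resolvent[OF gap[of "\<tau> - 2"]]) auto
    then have "of_real (\<tau> - 1) \<notin> essential_spectrum torus3_sq L2_antisym (H \<gamma> l)"
      by (simp add: essential_spectrum_def spectrum_def)
    then have ei: "ess_inf torus3_sq L2_antisym (H \<gamma> l) = \<tau>"
      using H_gap.ess_inf_eq[OF gap[of "\<tau> - 1"] wl] by simp
    show ?thesis unfolding eigenvalues_below_def ei using no by blast
  qed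
  moreover have "0 < k0 * (2 * pi) ^ 3" using k0(1) by simp
  ultimately show ?thesis by blast
qed

lemma triple_eigenvalue_above_gamma1:
  assumes \<gamma>: "gamma1 < \<gamma>"
  shows "\<exists>l2>0. \<forall>l>l2. \<exists>z. eigenvalues_below torus3_sq L2_antisym (H \<gamma> l) = {z}
      \<and> multiplicity_ev torus3_sq L2_antisym (H \<gamma> l) (complex_of_real z) = 3
      \<and> (\<forall>f \<in> eigenspace torus3_sq L2_antisym (H \<gamma> l) (complex_of_real z). odd_AE f)"
proof -
  \<comment> \<open>The minimum provides for both conditions of \<open>gap_above\<close> by a single
    bound on \<open>C2 / w\<close>.\<close>
  define d where "d = min 1 (\<gamma> / gamma1 - 1)"
  have d: "0 < d" "d \<le> 1" "d \<le> \<gamma> / gamma1 - 1" using \<gamma> gamma1_pos by (auto simp: d_def)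
  have \<gamma>0: "0 < \<gamma>" using \<gamma> gamma1_pos by linarith
  define w0 where "w0 = max (2 * (6 + 3 * \<gamma>)) (coupling.C2 \<gamma> / d + 1)"
  have w0: "2 * (6 + 3 * \<gamma>) \<le> w0" by (simp add: w0_def)
  obtain k0 where k0: "0 < k0" "\<And>k. k > k0 \<Longrightarrow> \<exists>w\<ge>w0. coupling \<gamma> w k"
    using coupling_exists[OF \<gamma>0, of w0] w0 by blast
  have "\<exists>z. eigenvalues_below torus3_sq L2_antisym (H \<gamma> l) = {z}
      \<and> multiplicity_ev torus3_sq L2_antisym (H \<gamma> l) (complex_of_real z) = 3
      \<and> (\<forall>f \<in> eigenspace torus3_sq L2_antisym (H \<gamma> l) (complex_of_real z). odd_AE f)"
    if l: "l > k0 * (2 * pi) ^ 3" for l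
  proof -
    define k where "k = l / (2 * pi) ^ 3"
    have "k > k0" using l by (simp add: k_def pos_less_divide_eq)
    then obtain w where ww: "w \<ge> w0" "coupling \<gamma> w k" using k0 by blast
    interpret coupling \<gamma> w k by (rule ww(2))
    have "C2 / d + 1 \<le> w" using ww(1) unfolding w0_def by (simp only: max.bounded_iff)
    then have "C2 / d < w" "0 < w" using s0w by auto
    then have "C2 / w < d" using d by (simp add: field_simps)
    then have c: "C2 / w < 1" "1 + C2 / w < \<gamma> / gamma1" using d by auto
    obtain z e where gap: "spectral_gap (H_op \<gamma> k) (UNIV :: 3 set) e sin_vec z \<tau>" and e: "\<And>i. e i \<in> sector i"
      using gap_above[OF c] by blast
    interpret gap: H_gap \<gamma> l UNIV e sin_vec z \<tau>
      unfolding H_gap_def k_def[symmetric] by (rule gap)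
    have wl: "\<exists>a. a \<noteq> 0 \<and> norm (H_op \<gamma> (l / (2 * pi) ^ 3) a - \<tau> *\<^sub>R a) < c * norm a" if "0 < c" for c
      unfolding k_def[symmetric] by (rule weyl[OF that])
    have ei: "ess_inf torus3_sq L2_antisym (H \<gamma> l) = \<tau>"
      by (rule gap.ess_inf_eq[OF wl gap.z_not_essential(1)]) auto
    have only: "x = z" if "is_eigenvalue torus3_sq L2_antisym (H \<gamma> l) (complex_of_real x)" "x < \<tau>" for x
      using gap.not_eigenvalue[of x] that by (cases "x = z") simp_all
    have "is_eigenvalue torus3_sq L2_antisym (H \<gamma> l) (complex_of_real z)"
      by (rule gap.z_not_essential(2)[OF refl])
    then have "eigenvalues_below torus3_sq L2_antisym (H \<gamma> l) = {z}"
      unfolding eigenvalues_below_def ei using only gap.z\<tau> by blast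
    moreover have "\<forall>f \<in> eigenspace torus3_sq L2_antisym (H \<gamma> l) (complex_of_real z). odd_AE f"
      by (intro ballI gap.eigenspace_odd[OF e])
    ultimately show ?thesis by (intro exI[of _ z] conjI gap.multiplicity_three[OF refl])
  qed
  moreover have "0 < k0 * (2 * pi) ^ 3" using k0(1) by simp
  ultimately show ?thesis by blast
qed

lemma count_below_empty:
  "eigenvalues_below M V A = {} \<Longrightarrow> count_below M V A = 0"
  by (simp add: count_below_def)

lemma count_below_singleton:
  assumes "eigenvalues_below M V A = {z}"
  shows "count_below M V A = multiplicity_ev M V A (complex_of_real z)"
proof -
  have "{Z. finite Z \<and> Z \<subseteq> eigenvalues_below M V A} = {{}, {z}}"
    using assms by (auto simp: subset_singleton_iff)
  then show ?thesis by (simp add: count_below_def sup_absorb2)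
qed

lemma discrete_below_subset: "discrete_below M V A \<subseteq> eigenvalues_below M V A"
  by (auto simp: discrete_below_def eigenvalues_below_def discrete_spectrum_def)

theorem theorem1p5:
  shows "(\<forall>\<gamma>. 0 < \<gamma> \<and> \<gamma> < gamma1 \<longrightarrow>
            (\<exists>l1>0. \<forall>l>l1. discrete_below torus3_sq L2_antisym (H \<gamma> l) = {}))
       \<and> (\<forall>\<gamma>>gamma1. \<exists>l2>0. \<forall>l>l2.
            (\<exists>z. eigenvalues_below torus3_sq L2_antisym (H \<gamma> l) = {z}
               \<and> multiplicity_ev torus3_sq L2_antisym (H \<gamma> l) (complex_of_real z) = 3
               \<and> (\<forall>f \<in> eigenspace torus3_sq L2_antisym (H \<gamma> l) (complex_of_real z). odd_AE f))
          \<and> 1 \<le> count_below torus3_sq L2_antisym (H \<gamma> l)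
          \<and> 3 \<le> count_below torus3_sq L2_antisym (H \<gamma> l))
       \<and> is_threshold 1 gamma1
       \<and> is_threshold 3 gamma1"
proof -
  have a: "\<exists>l1>0. \<forall>l>l1. discrete_below torus3_sq L2_antisym (H \<gamma> l) = {}
      \<and> count_below torus3_sq L2_antisym (H \<gamma> l) = 0" if "0 < \<gamma>" "\<gamma> < gamma1" for \<gamma>
  proof -
    obtain l1 where "l1 > 0" "\<And>l. l > l1 \<Longrightarrow> eigenvalues_below torus3_sq L2_antisym (H \<gamma> l) = {}"
      using no_eigenvalues_below_gamma1[OF \<open>0 < \<gamma>\<close> \<open>\<gamma> < gamma1\<close>] by blast
    then show ?thesis
      using discrete_below_subset[of torus3_sq L2_antisym "H \<gamma> _"]
      by (intro exI[of _ l1]) (auto simp: count_below_empty)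
  qed
  have b: "\<exists>l2>0. \<forall>l>l2. (\<exists>z. eigenvalues_below torus3_sq L2_antisym (H \<gamma> l) = {z}
      \<and> multiplicity_ev torus3_sq L2_antisym (H \<gamma> l) (complex_of_real z) = 3
      \<and> (\<forall>f \<in> eigenspace torus3_sq L2_antisym (H \<gamma> l) (complex_of_real z). odd_AE f))
      \<and> count_below torus3_sq L2_antisym (H \<gamma> l) = 3" if \<gamma>: "gamma1 < \<gamma>" for \<gamma>
  proof -
    obtain l2 where l2: "l2 > 0" "\<And>l. l > l2 \<Longrightarrow> \<exists>z. eigenvalues_below torus3_sq L2_antisym (H \<gamma> l) = {z}
      \<and> multiplicity_ev torus3_sq L2_antisym (H \<gamma> l) (complex_of_real z) = 3
      \<and> (\<forall>f \<in> eigenspace torus3_sq L2_antisym (H \<gamma> l) (complex_of_real z). odd_AE f)"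
      using triple_eigenvalue_above_gamma1[OF \<gamma>] by blast
    moreover have "count_below torus3_sq L2_antisym (H \<gamma> l) = 3" if "l > l2" for l
      using l2(2)[OF that] by (elim exE conjE) (simp add: count_below_singleton)
    ultimately show ?thesis by blast
  qed
  have b': "\<exists>l2>0. \<forall>l>l2. enat n \<le> count_below torus3_sq L2_antisym (H \<gamma> l)" if n: "gamma1 < \<gamma>" "n \<le> 3" for \<gamma> n
  proof -
    have "enat n \<le> 3" using n(2) by (simp add: numeral_eq_enat)
    moreover obtain l2 where "l2 > 0" "\<forall>l>l2. count_below torus3_sq L2_antisym (H \<gamma> l) = 3"
      using b[OF n(1)] by blast
    ultimately show ?thesis by (intro exI[of _ l2]) auto
  qed
  \<comment> \<open>The count jumps from 0 to 3 at \<open>gamma1\<close>, so this number is the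
    threshold for every \<open>n\<close> from 1 to 3.\<close>
  have t: "is_threshold n gamma1" if n: "0 < n" "n \<le> 3" for n
  proof -
    have "\<exists>l0>0. \<forall>l>l0. count_below torus3_sq L2_antisym (H \<gamma> l) < enat n" if "0 < \<gamma>" "\<gamma> < gamma1" for \<gamma>
    proof -
      have "(0 :: enat) < enat n" using n(1) by (simp add: zero_enat_def)
      moreover obtain l0 where "l0 > 0" "\<forall>l>l0. count_below torus3_sq L2_antisym (H \<gamma> l) = 0"
        using a[OF \<open>0 < \<gamma>\<close> \<open>\<gamma> < gamma1\<close>] by blast
      ultimately show ?thesis by (intro exI[of _ l0]) auto
    qed
    moreover have "\<exists>l0>0. \<forall>l>l0. enat n \<le> count_below torus3_sq L2_antisym (H \<gamma> l)" if "gamma1 < \<gamma>" for \<gamma>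
      by (rule b'[OF that n(2)])
    ultimately show ?thesis unfolding is_threshold_def using gamma1_pos by auto
  qed
  have 13: "(1 :: enat) \<le> 3" by (simp add: one_enat_def numeral_eq_enat)
  have "\<forall>\<gamma>. 0 < \<gamma> \<and> \<gamma> < gamma1 \<longrightarrow> (\<exists>l1>0. \<forall>l>l1. discrete_below torus3_sq L2_antisym (H \<gamma> l) = {})"
    using a by blast
  moreover have "\<forall>\<gamma>>gamma1. \<exists>l2>0. \<forall>l>l2.
            (\<exists>z. eigenvalues_below torus3_sq L2_antisym (H \<gamma> l) = {z}
               \<and> multiplicity_ev torus3_sq L2_antisym (H \<gamma> l) (complex_of_real z) = 3
               \<and> (\<forall>f \<in> eigenspace torus3_sq L2_antisym (H \<gamma> l) (complex_of_real z). odd_AE f))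
          \<and> 1 \<le> count_below torus3_sq L2_antisym (H \<gamma> l)
          \<and> 3 \<le> count_below torus3_sq L2_antisym (H \<gamma> l)"
  proof (intro allI impI)
    fix \<gamma> assume "gamma1 < \<gamma>"
    then obtain l2 where l2: "l2 > 0" "\<And>l. l > l2 \<Longrightarrow> (\<exists>z. eigenvalues_below torus3_sq L2_antisym (H \<gamma> l) = {z}
      \<and> multiplicity_ev torus3_sq L2_antisym (H \<gamma> l) (complex_of_real z) = 3
      \<and> (\<forall>f \<in> eigenspace torus3_sq L2_antisym (H \<gamma> l) (complex_of_real z). odd_AE f))
      \<and> count_below torus3_sq L2_antisym (H \<gamma> l) = 3" using b by blast
    show "\<exists>l2>0. \<forall>l>l2.
            (\<exists>z. eigenvalues_below torus3_sq L2_antisym (H \<gamma> l) = {z}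
               \<and> multiplicity_ev torus3_sq L2_antisym (H \<gamma> l) (complex_of_real z) = 3
               \<and> (\<forall>f \<in> eigenspace torus3_sq L2_antisym (H \<gamma> l) (complex_of_real z). odd_AE f))
          \<and> 1 \<le> count_below torus3_sq L2_antisym (H \<gamma> l)
          \<and> 3 \<le> count_below torus3_sq L2_antisym (H \<gamma> l)"
      using l2 13 by (intro exI[of _ l2]) auto
  qed
  moreover have "is_threshold 1 gamma1" "is_threshold 3 gamma1" by (rule t; simp)+
  ultimately show ?thesis by (intro conjI)
qed

end
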